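(* Let $L:TQ\times\mathbb{R}\to\mathbb{R}$ be a smooth and regular Lagrangian function. Let $c=(c_q,c_t)$ be a curve in $\hat\Omega(q_1,q_2,[0,1])$, and let $$\chi(\tau)=\left(c_q(\tau),\frac{c_q'(\tau)}{c_t'(\tau)},\hat{\mathcal Z}(c)(\tau)\right)\in TQ\times\mathbb{R}.$$ Then $c$ is a critical point of $\hat{\mathcal A}$ if and only if both of the following hold: (1) for $\tau\in[0,\tau_i)\cup(\tau_i,1]$, $$\frac{\partial L}{\partial q^j}(\chi(\tau))-\frac{\mathrm d}{\mathrm dt}\frac{\partial L}{\partial\dot q^j}(\chi(\tau))+\frac{\partial L}{\partial\dot q^j}(\chi(\tau))\,\frac{\partial L}{\partial z}(\chi(\tau))=0\qquad (j=1,\dots,n),$$ $$\frac{\mathrm d}{\mathrm dt}E_L(\chi(\tau))=\frac{\partial L}{\partial z}(\chi(\tau))\,E_L(\chi(\tau));$$ (2) for any $v\in T_{c_q(\tau_i)}\partial C$, $$\frac{\partial L}{\partial\dot q^j}(\chi(\tau_i^-))\,v^j=\frac{\partial L}{\partial\dot q^j}(\chi(\tau_i^+))\,v^j,$$ and $$E_L(\chi(\tau_i^-))=E_L(\chi(\tau_i^+)),$$ where $\chi(\tau_i^\pm)=\lim_{\tau\to\tau_i^\pm}\chi(\tau)$.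
   Context: $Q$ is a smooth manifold of dimension $n$ (configuration space), with local coordinates $(q^1,\dots,q^n)$ and induced coordinates $(q^j,\dot q^j,z)$ on $TQ\times\mathbb{R}$; summation over repeated indices is understood, and $v=v^j\,\partial/\partial q^j$ for tangent vectors. $C\subset Q$ is a submanifold with boundary $\partial C$ (the admissible configurations). The Lagrangian $L$ is regular if the matrix $\left(\frac{\partial^2L}{\partial\dot q^j\partial\dot q^k}\right)$ is invertible. Its energy is $E_L=\dot q^j\frac{\partial L}{\partial\dot q^j}-L$. Fix $\tau_i\in(0,1)$ (the impact parameter; the subscript $i$ is a label, not an index), points $q_1,q_2\in Q$, and a real number $\hat z_0$. Define - $\mathcal T=\{c_t\in C^\infty([0,1],\mathbb{R}) : c_t'>0 \text{ in } [0,1]\}$; - $\mathcal Q=\mathcal Q([0,1],\tau_i,\partial C,Q)$: the set of $C^0$, piecewise $C^2$ curves $c_q:[0,1]\to Q$ that have only one singularity, at $\tau_i$, and satisfy $c_q(\tau_i)\in\partial C$ (derivatives at $0$ and $1$ are understood as one-sided limits); - $\mathcal M=\mathcal T\times\mathcal Q$ (the path space), which is a smooth manifold. The tangent space $T_{c_q}\mathcal Q$ consists of the $C^0$, piecewise $C^2$ maps $u:[0,1]\to TQ$ along $c_q$ with $u(\tau_i)\in T_{c_q(\tau_i)}\partial C$; - $\hat\Omega(q_1,q_2,[0,1])\subset\mathcal M$: the subset of those $c=(c_q,c_t)$ such that $c_q(0)=q_1$ and $c_q(1)=q_2$. For $c=(c_q,c_t)\in\hat\Omega(q_1,q_2,[0,1])$,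 $\hat{\mathcal Z}(c)=\hat{\mathcal Z}(c_q,c_t):[0,1]\to\mathbb{R}$ denotes the solution of $$\frac{\mathrm d\hat{\mathcal Z}(c)}{\mathrm d\tau}(\tau)=L\left(c_q(\tau),\frac{c_q'(\tau)}{c_t'(\tau)},\hat{\mathcal Z}(c)(\tau)\right)c_t'(\tau),\qquad \hat{\mathcal Z}(c)(0)=\hat z_0,$$ and the action functional is $\hat{\mathcal A}:\hat\Omega(q_1,q_2,[0,1])\to\mathbb{R}$, $\hat{\mathcal A}(c)=\hat{\mathcal Z}(c)(1)$. A curve $c$ is a critical point of $\hat{\mathcal A}$ if $T_c\hat{\mathcal A}=0$. Time is $t=c_t(\tau)$, so along $\chi$ one has $\frac{\mathrm d}{\mathrm dt}=\frac{1}{c_t'(\tau)}\frac{\mathrm d}{\mathrm d\tau}$.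
   Formalization: Critical point is taken with respect to variations of (c_q,c_t) that vanish at both endpoints also in the time component c_t; with free time endpoints the "if" direction fails (e.g. a free particle with nonzero energy). Existence of the solution Ẑ(c) on [0,1] is assumed. *)

theory Defs
  imports "HOL-Analysis.Analysis"
begin

section \<open>Differentiability classes\<close>

text \<open>
  Class C^k on a set on which Frechet derivatives are unique: below, open sets, nondegenerate
  intervals, products of such, and relatively open subsets of these. At boundary points the
  derivative is taken within the set, so on a closed interval it is one-sided at the endpoints.
\<close>

primrec Ck_on :: "nat \<Rightarrow> ('a::euclidean_space \<Rightarrow> 'b::real_normed_vector) \<Rightarrow> 'a set \<Rightarrow> bool" where
  "Ck_on 0 f S \<longleftrightarrow> continuous_on S f"
| "Ck_on (Suc k) f S \<longleftrightarrow>
     f differentiable_on S \<and> (\<forall>v. Ck_on k (\<lambda>x. frechet_derivative f (at x within S) v) S)"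

definition smooth_on :: "('a::euclidean_space \<Rightarrow> 'b::real_normed_vector) \<Rightarrow> 'a set \<Rightarrow> bool" where
  "smooth_on f S \<longleftrightarrow> (\<forall>k. Ck_on k f S)"


section \<open>Smooth manifolds\<close>

text \<open>
  The manifold is a whole (Hausdorff, second countable) type \<open>'q\<close>, of dimension \<open>CARD('n)\<close>.
  A chart is its domain together with a coordinate map, whose values off the domain are irrelevant.
\<close>

type_synonym ('q, 'n) chart = "'q set \<times> ('q \<Rightarrow> real ^ 'n)"

definition chart_inv :: "('q, 'n) chart \<Rightarrow> real ^ 'n \<Rightarrow> 'q" where
  "chart_inv \<phi> = inv_into (fst \<phi>) (snd \<phi>)"

definition is_chart :: "('q::topological_space, 'n::finite) chart \<Rightarrow> bool" where
  "is_chart \<phi> \<longleftrightarrow> open (fst \<phi>) \<and> open (snd \<phi> ` fst \<phi>) \<and>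
     homeomorphism (fst \<phi>) (snd \<phi> ` fst \<phi>) (snd \<phi>) (chart_inv \<phi>)"

definition compatible :: "('q::topological_space, 'n::finite) chart \<Rightarrow> ('q, 'n) chart \<Rightarrow> bool" where
  "compatible \<phi> \<psi> \<longleftrightarrow>
     smooth_on (snd \<psi> \<circ> chart_inv \<phi>) (snd \<phi> ` (fst \<phi> \<inter> fst \<psi>)) \<and>
     smooth_on (snd \<phi> \<circ> chart_inv \<psi>) (snd \<psi> ` (fst \<phi> \<inter> fst \<psi>))"

text \<open>A smooth structure, given as a maximal smooth atlas.\<close>

definition smooth_structure ::
  "('q::{t2_space, second_countable_topology}, 'n::finite) chart set \<Rightarrow> bool" where
  "smooth_structure A \<longleftrightarrow>
     (\<forall>\<phi>\<in>A. is_chart \<phi>) \<and>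
     (\<Union>\<phi>\<in>A. fst \<phi>) = UNIV \<and>
     (\<forall>\<phi>\<in>A. \<forall>\<psi>\<in>A. compatible \<phi> \<psi>) \<and>
     (\<forall>\<phi>. is_chart \<phi> \<and> (\<forall>\<psi>\<in>A. compatible \<phi> \<psi>) \<longrightarrow> \<phi> \<in> A)"

definition manifold_Ck ::
  "('q::topological_space, 'n::finite) chart set \<Rightarrow> nat \<Rightarrow> ('a::euclidean_space \<Rightarrow> 'q) \<Rightarrow> 'a set \<Rightarrow> bool"
  where
  "manifold_Ck A k f S \<longleftrightarrow>
     continuous_on S f \<and> (\<forall>\<phi>\<in>A. Ck_on k (snd \<phi> \<circ> f) (S \<inter> f -` fst \<phi>))"


section \<open>The tangent bundle\<close>

text \<open>
  A tangent vector at \<open>p\<close> is the family of its component vectors in all charts around \<open>p\<close>, related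
  by the Jacobians of the coordinate changes (and 0 for all other charts, to make it unique).
  So the components \<open>v\<^sup>j\<close> of \<open>w\<close> in the chart \<open>\<phi>\<close> are \<open>snd w \<phi> $ j\<close>.
\<close>

type_synonym ('q, 'n) tvec = "'q \<times> (('q, 'n) chart \<Rightarrow> real ^ 'n)"

definition tangent_bundle :: "('q::topological_space, 'n::finite) chart set \<Rightarrow> ('q, 'n) tvec set" where
  "tangent_bundle A = {(p, v).
     (\<forall>\<phi>. \<not> (\<phi> \<in> A \<and> p \<in> fst \<phi>) \<longrightarrow> v \<phi> = 0) \<and>
     (\<forall>\<phi>\<in>A. \<forall>\<psi>\<in>A. p \<in> fst \<phi> \<inter> fst \<psi> \<longrightarrow>
        v \<psi> = frechet_derivative (snd \<psi> \<circ> chart_inv \<phi>) (at (snd \<phi> p)) (v \<phi>))}"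

text \<open>The tangent vector with induced coordinates \<open>(x, y)\<close> in the chart \<open>\<phi>\<close>.\<close>

definition tvec_of ::
  "('q::topological_space, 'n::finite) chart set \<Rightarrow> ('q, 'n) chart \<Rightarrow> real ^ 'n \<Rightarrow> real ^ 'n \<Rightarrow> ('q, 'n) tvec"
  where
  "tvec_of A \<phi> x y = (let p = chart_inv \<phi> x in
     (p, \<lambda>\<psi>. if \<psi> \<in> A \<and> p \<in> fst \<psi>
             then frechet_derivative (snd \<psi> \<circ> chart_inv \<phi>) (at x) y else 0))"

definition tscale :: "real \<Rightarrow> ('q, 'n::finite) tvec \<Rightarrow> ('q, 'n) tvec" where
  "tscale r w = (fst w, \<lambda>\<psi>. r *\<^sub>R snd w \<psi>)"

text \<open>The velocity vector at parameter \<open>t\<close> of a curve defined on \<open>I\<close>.\<close>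

definition velocity ::
  "('q::topological_space, 'n::finite) chart set \<Rightarrow> (real \<Rightarrow> 'q) \<Rightarrow> real set \<Rightarrow> real \<Rightarrow> ('q, 'n) tvec" where
  "velocity A \<gamma> I t = (\<gamma> t, \<lambda>\<psi>. if \<psi> \<in> A \<and> \<gamma> t \<in> fst \<psi>
     then vector_derivative (snd \<psi> \<circ> \<gamma>) (at t within I) else 0)"


section \<open>Submanifolds with boundary\<close>

definition interior_slice_chart ::
  "('q::topological_space, 'n::finite) chart set \<Rightarrow> nat \<Rightarrow> 'q set \<Rightarrow> 'q \<Rightarrow> bool" where
  "interior_slice_chart A k C p \<longleftrightarrow> (\<exists>\<phi>\<in>A. \<exists>K. card K = k \<and> p \<in> fst \<phi> \<and>
     snd \<phi> ` (C \<inter> fst \<phi>) = {x \<in> snd \<phi> ` fst \<phi>. \<forall>j. j \<notin> K \<longrightarrow> x $ j = 0})"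

definition boundary_slice_chart ::
  "('q::topological_space, 'n::finite) chart set \<Rightarrow> nat \<Rightarrow> 'q set \<Rightarrow> 'q \<Rightarrow> bool" where
  "boundary_slice_chart A k C p \<longleftrightarrow> (\<exists>\<phi>\<in>A. \<exists>K. \<exists>a\<in>K. card K = k \<and> p \<in> fst \<phi> \<and> snd \<phi> p $ a = 0 \<and>
     snd \<phi> ` (C \<inter> fst \<phi>) = {x \<in> snd \<phi> ` fst \<phi>. (\<forall>j. j \<notin> K \<longrightarrow> x $ j = 0) \<and> 0 \<le> x $ a})"

text \<open>Embedded \<open>k\<close>-dimensional submanifolds with (possibly empty) boundary.\<close>

definition submanifold_with_boundary ::
  "('q::topological_space, 'n::finite) chart set \<Rightarrow> nat \<Rightarrow> 'q set \<Rightarrow> bool" where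
  "submanifold_with_boundary A k C \<longleftrightarrow>
     (\<forall>p\<in>C. interior_slice_chart A k C p \<or> boundary_slice_chart A k C p)"

definition manifold_boundary ::
  "('q::topological_space, 'n::finite) chart set \<Rightarrow> nat \<Rightarrow> 'q set \<Rightarrow> 'q set" where
  "manifold_boundary A k C = {p \<in> C. boundary_slice_chart A k C p}"

text \<open>The tangent space at \<open>p\<close> of a submanifold \<open>B\<close> without boundary: velocities of curves in \<open>B\<close>.\<close>

definition tangent_space ::
  "('q::topological_space, 'n::finite) chart set \<Rightarrow> 'q set \<Rightarrow> 'q \<Rightarrow> ('q, 'n) tvec set" where
  "tangent_space A B p = {velocity A \<beta> UNIV 0 | \<beta>. \<beta> 0 = p \<and>
     (\<exists>\<epsilon>>0. \<beta> ` {-\<epsilon><..<\<epsilon>} \<subseteq> B \<and> (\<forall>k. manifold_Ck A k \<beta> {-\<epsilon><..<\<epsilon>}))}"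


section \<open>Lagrangians\<close>

text \<open>
  A Lagrangian is a function on \<open>tangent_bundle A \<times> UNIV\<close>; its values elsewhere are never used.
  In a chart it becomes a function of \<open>(q, q', z)\<close>.
\<close>

definition local_rep ::
  "('q::topological_space, 'n::finite) chart set \<Rightarrow> (('q, 'n) tvec \<times> real \<Rightarrow> real) \<Rightarrow> ('q, 'n) chart
     \<Rightarrow> (real ^ 'n) \<times> (real ^ 'n) \<times> real \<Rightarrow> real" where
  "local_rep A L \<phi> = (\<lambda>(x, y, z). L (tvec_of A \<phi> x y, z))"

definition coords :: "('q, 'n) chart \<Rightarrow> ('q, 'n) tvec \<times> real \<Rightarrow> (real ^ 'n) \<times> (real ^ 'n) \<times> real" where
  "coords \<phi> = (\<lambda>(w, z). (snd \<phi> (fst w), snd w \<phi>, z))"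

definition D_q :: "((real ^ 'n) \<times> (real ^ 'n) \<times> real \<Rightarrow> real) \<Rightarrow> 'n::finite
     \<Rightarrow> (real ^ 'n) \<times> (real ^ 'n) \<times> real \<Rightarrow> real" where
  "D_q F j \<xi> = frechet_derivative F (at \<xi>) (axis j 1, 0, 0)"

definition D_v :: "((real ^ 'n) \<times> (real ^ 'n) \<times> real \<Rightarrow> real) \<Rightarrow> 'n::finite
     \<Rightarrow> (real ^ 'n) \<times> (real ^ 'n) \<times> real \<Rightarrow> real" where
  "D_v F j \<xi> = frechet_derivative F (at \<xi>) (0, axis j 1, 0)"

definition D_z :: "((real ^ 'n::finite) \<times> (real ^ 'n) \<times> real \<Rightarrow> real)
     \<Rightarrow> (real ^ 'n) \<times> (real ^ 'n) \<times> real \<Rightarrow> real" where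
  "D_z F \<xi> = frechet_derivative F (at \<xi>) (0, 0, 1)"

definition energy :: "((real ^ 'n::finite) \<times> (real ^ 'n) \<times> real \<Rightarrow> real)
     \<Rightarrow> (real ^ 'n) \<times> (real ^ 'n) \<times> real \<Rightarrow> real" where
  "energy F = (\<lambda>(x, y, z). (\<Sum>j\<in>UNIV. y $ j * D_v F j (x, y, z)) - F (x, y, z))"

definition smooth_lagrangian ::
  "('q::topological_space, 'n::finite) chart set \<Rightarrow> (('q, 'n) tvec \<times> real \<Rightarrow> real) \<Rightarrow> bool" where
  "smooth_lagrangian A L \<longleftrightarrow>
     (\<forall>\<phi>\<in>A. smooth_on (local_rep A L \<phi>) ((snd \<phi> ` fst \<phi>) \<times> UNIV \<times> UNIV))"

definition regular_lagrangian ::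
  "('q::topological_space, 'n::finite) chart set \<Rightarrow> (('q, 'n) tvec \<times> real \<Rightarrow> real) \<Rightarrow> bool" where
  "regular_lagrangian A L \<longleftrightarrow>
     (\<forall>\<phi>\<in>A. \<forall>\<xi> \<in> (snd \<phi> ` fst \<phi>) \<times> UNIV \<times> UNIV.
        invertible ((\<chi> j k. D_v (D_v (local_rep A L \<phi>) k) j \<xi>) :: real ^ 'n ^ 'n))"


section \<open>The path space\<close>

text \<open>
  Paths are pairs \<open>(c\<^sub>q, c\<^sub>t)\<close> of functions on \<open>{0..1}\<close>; their values elsewhere are irrelevant.
\<close>

type_synonym 'q path = "(real \<Rightarrow> 'q) \<times> (real \<Rightarrow> real)"

definition time_paths :: "(real \<Rightarrow> real) set" where
  "time_paths = {ct. smooth_on ct {0..1} \<and>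
     (\<forall>\<tau>\<in>{0..1}. 0 < vector_derivative ct (at \<tau> within {0..1}))}"

definition config_paths ::
  "('q::topological_space, 'n::finite) chart set \<Rightarrow> real \<Rightarrow> 'q set \<Rightarrow> (real \<Rightarrow> 'q) set" where
  "config_paths A \<tau>\<^sub>i B = {cq. continuous_on {0..1} cq \<and>
     manifold_Ck A 2 cq {0..\<tau>\<^sub>i} \<and> manifold_Ck A 2 cq {\<tau>\<^sub>i..1} \<and> cq \<tau>\<^sub>i \<in> B}"

definition Omega ::
  "('q::topological_space, 'n::finite) chart set \<Rightarrow> real \<Rightarrow> 'q set \<Rightarrow> 'q \<Rightarrow> 'q \<Rightarrow> 'q path set" where
  "Omega A \<tau>\<^sub>i B q1 q2 = {(cq, ct). cq \<in> config_paths A \<tau>\<^sub>i B \<and> ct \<in> time_paths \<and>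
     cq 0 = q1 \<and> cq 1 = q2}"

text \<open>The tangent space at \<open>cq\<close> of the space of configuration paths.\<close>

definition config_tangent ::
  "('q::topological_space, 'n::finite) chart set \<Rightarrow> real \<Rightarrow> 'q set \<Rightarrow> (real \<Rightarrow> 'q)
     \<Rightarrow> (real \<Rightarrow> ('q, 'n) tvec) set" where
  "config_tangent A \<tau>\<^sub>i B cq = {u.
     (\<forall>\<tau>\<in>{0..1}. u \<tau> \<in> tangent_bundle A \<and> fst (u \<tau>) = cq \<tau>) \<and>
     (\<forall>\<phi>\<in>A. continuous_on ({0..1} \<inter> cq -` fst \<phi>) (\<lambda>\<tau>. snd (u \<tau>) \<phi>) \<and>
        Ck_on 2 (\<lambda>\<tau>. snd (u \<tau>) \<phi>) ({0..\<tau>\<^sub>i} \<inter> cq -` fst \<phi>) \<and>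
        Ck_on 2 (\<lambda>\<tau>. snd (u \<tau>) \<phi>) ({\<tau>\<^sub>i..1} \<inter> cq -` fst \<phi>)) \<and>
     u \<tau>\<^sub>i \<in> tangent_space A B (cq \<tau>\<^sub>i)}"

text \<open>
  Infinitesimal variations \<open>(u, \<delta>)\<close> of a path, with \<open>u\<close> and \<open>\<delta>\<close> both vanishing at the endpoints.
  The condition on \<open>\<delta>\<close> cannot be dropped: if the final time may vary, then critical paths are
  forced to have zero energy, which the equations of motion do not imply.
\<close>

definition fixed_end_variations ::
  "('q::topological_space, 'n::finite) chart set \<Rightarrow> real \<Rightarrow> 'q set \<Rightarrow> 'q path
     \<Rightarrow> ((real \<Rightarrow> ('q, 'n) tvec) \<times> (real \<Rightarrow> real)) set" where
  "fixed_end_variations A \<tau>\<^sub>i B c = {(u, \<delta>). u \<in> config_tangent A \<tau>\<^sub>i B (fst c) \<and>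
     smooth_on \<delta> {0..1} \<and> snd (u 0) = (\<lambda>_. 0) \<and> snd (u 1) = (\<lambda>_. 0) \<and> \<delta> 0 = 0 \<and> \<delta> 1 = 0}"

text \<open>\<open>\<Gamma>\<close> is a differentiable curve in the path space \<open>P\<close> with \<open>\<Gamma> 0 = c\<close> and \<open>\<Gamma>' 0 = (u, \<delta>)\<close>.\<close>

definition path_curve ::
  "('q::topological_space, 'n::finite) chart set \<Rightarrow> real \<Rightarrow> 'q path set \<Rightarrow> 'q path
     \<Rightarrow> (real \<Rightarrow> ('q, 'n) tvec) \<times> (real \<Rightarrow> real) \<Rightarrow> (real \<Rightarrow> 'q path) \<Rightarrow> bool" where
  "path_curve A \<tau>\<^sub>i P c w \<Gamma> \<longleftrightarrow> (\<exists>\<epsilon>>0.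
     (\<forall>s\<in>{-\<epsilon><..<\<epsilon>}. \<Gamma> s \<in> P) \<and>
     manifold_Ck A 2 (\<lambda>(s, \<tau>). fst (\<Gamma> s) \<tau>) ({-\<epsilon><..<\<epsilon>} \<times> {0..\<tau>\<^sub>i}) \<and>
     manifold_Ck A 2 (\<lambda>(s, \<tau>). fst (\<Gamma> s) \<tau>) ({-\<epsilon><..<\<epsilon>} \<times> {\<tau>\<^sub>i..1}) \<and>
     smooth_on (\<lambda>(s, \<tau>). snd (\<Gamma> s) \<tau>) ({-\<epsilon><..<\<epsilon>} \<times> {0..1}) \<and>
     (\<forall>\<tau>\<in>{0..1}. fst (\<Gamma> 0) \<tau> = fst c \<tau> \<and> snd (\<Gamma> 0) \<tau> = snd c \<tau> \<and>
        velocity A (\<lambda>s. fst (\<Gamma> s) \<tau>) UNIV 0 = fst w \<tau> \<and>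
        vector_derivative (\<lambda>s. snd (\<Gamma> s) \<tau>) (at 0) = snd w \<tau>))"


section \<open>The action functional\<close>

text \<open>The lifted path \<open>\<chi>\<close>, with velocity taken with respect to the time \<open>t = c\<^sub>t \<tau>\<close>.\<close>

definition lifted_path ::
  "('q::topological_space, 'n::finite) chart set \<Rightarrow> 'q path \<Rightarrow> (real \<Rightarrow> real) \<Rightarrow> real
     \<Rightarrow> ('q, 'n) tvec \<times> real" where
  "lifted_path A c Z \<tau> =
     (tscale (1 / vector_derivative (snd c) (at \<tau> within {0..1})) (velocity A (fst c) {0..1} \<tau>), Z \<tau>)"

text \<open>At \<open>\<tau>\<^sub>i\<close> the velocity jumps, so there the solution is only required to be continuous.\<close>

definition herglotz_solution ::
  "('q::topological_space, 'n::finite) chart set \<Rightarrow> (('q, 'n) tvec \<times> real \<Rightarrow> real) \<Rightarrow> real \<Rightarrow> real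
     \<Rightarrow> 'q path \<Rightarrow> (real \<Rightarrow> real) \<Rightarrow> bool" where
  "herglotz_solution A L \<tau>\<^sub>i z0 c Z \<longleftrightarrow> continuous_on {0..1} Z \<and> Z 0 = z0 \<and>
     (\<forall>\<tau>\<in>{0..1} - {\<tau>\<^sub>i}. (Z has_real_derivative
        L (lifted_path A c Z \<tau>) * vector_derivative (snd c) (at \<tau> within {0..1})) (at \<tau> within {0..1}))"

text \<open>
  For a smooth Lagrangian two solutions agree on \<open>{0..1}\<close>, and only these values are used.
\<close>

definition Zhat ::
  "('q::topological_space, 'n::finite) chart set \<Rightarrow> (('q, 'n) tvec \<times> real \<Rightarrow> real) \<Rightarrow> real \<Rightarrow> real
     \<Rightarrow> 'q path \<Rightarrow> real \<Rightarrow> real" where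
  "Zhat A L \<tau>\<^sub>i z0 c = (SOME Z. herglotz_solution A L \<tau>\<^sub>i z0 c Z)"

definition action ::
  "('q::topological_space, 'n::finite) chart set \<Rightarrow> (('q, 'n) tvec \<times> real \<Rightarrow> real) \<Rightarrow> real \<Rightarrow> real
     \<Rightarrow> 'q path \<Rightarrow> real" where
  "action A L \<tau>\<^sub>i z0 c = Zhat A L \<tau>\<^sub>i z0 c 1"

text \<open>
  The tangent map of the action at \<open>c\<close>, evaluated on the velocity of a curve \<open>\<Gamma>\<close> through \<open>c\<close>, is the
  derivative of the action along \<open>\<Gamma>\<close>. For \<open>\<Gamma>\<close> close to \<open>c\<close> the action is well defined if it is
  so at \<open>c\<close>.
\<close>

definition critical_point ::
  "('q::topological_space, 'n::finite) chart set \<Rightarrow> (('q, 'n) tvec \<times> real \<Rightarrow> real) \<Rightarrow> real \<Rightarrow> real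
     \<Rightarrow> 'q set \<Rightarrow> 'q \<Rightarrow> 'q \<Rightarrow> 'q path \<Rightarrow> bool" where
  "critical_point A L \<tau>\<^sub>i z0 B q1 q2 c \<longleftrightarrow>
     (\<forall>w \<in> fixed_end_variations A \<tau>\<^sub>i B c. \<forall>\<Gamma>. path_curve A \<tau>\<^sub>i (Omega A \<tau>\<^sub>i B q1 q2) c w \<Gamma> \<longrightarrow>
        ((\<lambda>s. action A L \<tau>\<^sub>i z0 (\<Gamma> s)) has_real_derivative 0) (at 0))"

text \<open>The derivative with respect to \<open>t = ct \<tau>\<close> of a function of \<open>\<tau>\<close>.\<close>

definition time_deriv :: "(real \<Rightarrow> real) \<Rightarrow> (real \<Rightarrow> real) \<Rightarrow> real \<Rightarrow> real" where
  "time_deriv ct f \<tau> =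
     vector_derivative f (at \<tau> within {0..1}) / vector_derivative ct (at \<tau> within {0..1})"

end

(*
Along a smooth piece of the path let P be the momentum paired with the variation field u, E the
energy and delta the variation of time. The variation W of Z satisfies a linear equation; with its
integrating factor mu, the function mu (W - P + E delta) has a derivative involving only the
Euler-Lagrange expressions, paired with u - delta * velocity. If these vanish, the function is
constant on both pieces, and since u and delta vanish at the ends, the derivative of the action is
a positive multiple of the jump of E delta - P at the impact: this is the momentum and energy
condition, tested with variations that move the impact point along a curve in the boundary and with
the time variation t (1 - t). Conversely, if an Euler-Lagrange expression is nonzero somewhere, then
a variation supported nearby in one chart makes the function monotone and not constant although its
end values agree. The energy balance follows from the Euler-Lagrange equations by contraction with
the velocity.
*)
theory Submission
  imports Defs
begin

text \<open>Three features of the definitions shape the proof. \<open>critical_point\<close> asks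
  for a derivative of the action along every curve of paths, and the action is read off a solution
  picked by choice. The scalar equation of Z may have no solution for a distant path, so existence
  for nearby paths, uniqueness, and differentiability in the parameter all have to be obtained
  around the given solution. Next, the velocity jumps at the impact and the equation of Z is not
  imposed there. Hence each closed piece is treated by itself with derivatives within its interval,
  the variation of Z at the end of the first piece is the initial variation on the second, and
  equations found at interior times reach the ends 0 and 1 by continuity. Finally, a path need not
  fit into one chart. Derivatives are computed chart by chart, then stated in a form that no longer
  mentions the chart and glued. Since paths are only C^2, the variation of the velocity is exchanged
  with the derivative of the variation through equality of mixed partials, with one-sided time
  derivatives at the ends of a piece.\<close>

section \<open>Calculus of \<open>Ck_on\<close>\<close>

text \<open>The sets on which \<open>frechet_derivative_unique_within\<close> gives uniqueness of derivatives.\<close>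

definition thick :: "'a::euclidean_space set \<Rightarrow> bool" where
  "thick S \<longleftrightarrow> (\<forall>x\<in>S. \<forall>i\<in>Basis. \<forall>e>0. \<exists>d. 0 < \<bar>d\<bar> \<and> \<bar>d\<bar> < e \<and> x + d *\<^sub>R i \<in> S)"

lemma thick_open_Int:
  assumes "thick T" "open U"
  shows "thick (T \<inter> U)"
  unfolding thick_def
proof (intro ballI allI impI)
  fix x i :: 'a and e :: real
  assume x: "x \<in> T \<inter> U" and i: "i \<in> Basis" and e: "e > 0"
  obtain r where r: "r > 0" "ball x r \<subseteq> U"
    using assms(2) x openE by blast
  obtain d where d: "0 < \<bar>d\<bar>" "\<bar>d\<bar> < min e r" "x + d *\<^sub>R i \<in> T"
    using assms(1) x i e r by (metis IntD1 min_less_iff_conj thick_def)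
  have "x + d *\<^sub>R i \<in> ball x r"
    using d i by (simp add: dist_norm)
  then show "\<exists>d. 0 < \<bar>d\<bar> \<and> \<bar>d\<bar> < e \<and> x + d *\<^sub>R i \<in> T \<inter> U"
    using d r by auto
qed

lemma thick_UNIV: "thick UNIV"
  unfolding thick_def by (metis UNIV_I abs_of_pos field_lbound_gt_zero)

lemma thick_open: "open S \<Longrightarrow> thick S"
  using thick_open_Int[OF thick_UNIV] by simp

lemma thick_openin:
  assumes "thick T" "openin (top_of_set T) S"
  shows "thick S"
  using assms thick_open_Int by (metis openin_open)

lemma thick_Icc:
  fixes a b :: real
  assumes "a < b"
  shows "thick {a..b}"
  unfolding thick_def
proof (intro ballI allI impI)
  fix x i e :: real
  assume x: "x \<in> {a..b}" and i: "i \<in> Basis" and e: "e > 0"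
  have i1: "i = 1"
    using i by simp
  show "\<exists>d. 0 < \<bar>d\<bar> \<and> \<bar>d\<bar> < e \<and> x + d *\<^sub>R i \<in> {a..b}"
  proof (cases "x < b")
    case True
    then show ?thesis
      using x e i1 by (intro exI[of _ "min (e/2) (b - x)"]) auto
  next
    case False
    then show ?thesis
      using x e i1 assms by (intro exI[of _ "- min (e/2) (b - a)"]) auto
  qed
qed

lemma thick_Times:
  assumes "thick S" "thick T"
  shows "thick (S \<times> T)"
  unfolding thick_def
proof (intro ballI allI impI)
  fix x i :: "'a \<times> 'b" and e :: real
  assume x: "x \<in> S \<times> T" and i: "i \<in> Basis" and e: "e > 0"
  consider j where "j \<in> Basis" "i = (j, 0)" | j where "j \<in> Basis" "i = (0, j)"
    using i by (auto simp: Basis_prod_def)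
  then show "\<exists>d. 0 < \<bar>d\<bar> \<and> \<bar>d\<bar> < e \<and> x + d *\<^sub>R i \<in> S \<times> T"
  proof cases
    case 1
    then obtain d where "0 < \<bar>d\<bar>" "\<bar>d\<bar> < e" "fst x + d *\<^sub>R j \<in> S"
      using assms(1) x e unfolding thick_def by (metis mem_Times_iff)
    then show ?thesis
      using 1 x by (intro exI[of _ d]) (auto simp: mem_Times_iff)
  next
    case 2
    then obtain d where "0 < \<bar>d\<bar>" "\<bar>d\<bar> < e" "snd x + d *\<^sub>R j \<in> T"
      using assms(2) x e unfolding thick_def by (metis mem_Times_iff)
    then show ?thesis
      using 2 x by (intro exI[of _ d]) (auto simp: mem_Times_iff)
  qed
qed

lemma frechet_derivative_thick:
  assumes "thick S" "x \<in> S" "(f has_derivative D) (at x within S)"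
  shows "frechet_derivative f (at x within S) = D"
proof (rule frechet_derivative_unique_within)
  show "(f has_derivative frechet_derivative f (at x within S)) (at x within S)"
    using assms(3) differentiable_def frechet_derivative_works by blast
  show "\<exists>d. 0 < \<bar>d\<bar> \<and> \<bar>d\<bar> < e \<and> x + d *\<^sub>R i \<in> S" if "i \<in> Basis" "e > 0" for i e
    using assms(1,2) that unfolding thick_def by blast
qed (rule assms(3))

lemma has_derivative_within_cong:
  assumes "\<And>x. x \<in> S \<Longrightarrow> f x = g x" "x \<in> S"
  shows "(f has_derivative D) (at x within S) \<longleftrightarrow> (g has_derivative D) (at x within S)"
  using has_derivative_transform[OF assms(2), of f g] has_derivative_transform[OF assms(2), of g f] assms(1)
  by auto

lemma frechet_derivative_within_cong:
  assumes "\<And>x. x \<in> S \<Longrightarrow> f x = g x" "x \<in> S"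
  shows "frechet_derivative f (at x within S) = frechet_derivative g (at x within S)"
  unfolding frechet_derivative_def using has_derivative_within_cong[OF assms] by simp

lemma Ck_on_cong:
  assumes "\<And>x. x \<in> S \<Longrightarrow> f x = g x"
  shows "Ck_on k f S \<longleftrightarrow> Ck_on k g S"
  using assms
proof (induction k arbitrary: f g)
  case 0
  then show ?case by (simp cong: continuous_on_cong)
next
  case (Suc k)
  have "f differentiable_on S \<longleftrightarrow> g differentiable_on S"
    unfolding differentiable_on_def differentiable_def
    using has_derivative_within_cong[of S f g] Suc.prems by auto
  moreover have "Ck_on k (\<lambda>x. frechet_derivative f (at x within S) v) S \<longleftrightarrow>
      Ck_on k (\<lambda>x. frechet_derivative g (at x within S) v) S" for v
    by (rule Suc.IH) (use frechet_derivative_within_cong[of S f g] Suc.prems in auto)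
  ultimately show ?case by simp
qed

lemma Ck_on_SucD: "Ck_on (Suc k) f S \<Longrightarrow> Ck_on k f S"
proof (induction k arbitrary: f)
  case 0
  then show ?case by (simp add: differentiable_imp_continuous_on)
next
  case (Suc k)
  then show ?case by (metis Ck_on.simps(2))
qed

lemma Ck_on_mono: "Ck_on m f S \<Longrightarrow> k \<le> m \<Longrightarrow> Ck_on k f S"
  by (induction m) (auto simp: le_Suc_eq dest: Ck_on_SucD simp del: Ck_on.simps(2))

lemma Ck_on_imp_continuous_on: "Ck_on k f S \<Longrightarrow> continuous_on S f"
  using Ck_on_mono[of k f S 0] by simp

text \<open>\<open>frechet_derivative\<close> within a set is a choice; on a thick set the choice is
  forced, so any explicit family \<open>D\<close> of derivatives may replace it in the
  recursion.\<close>

lemma Ck_on_SucI: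
  assumes "thick S" "\<And>x. x \<in> S \<Longrightarrow> (f has_derivative D x) (at x within S)"
    and "\<And>v. Ck_on k (\<lambda>x. D x v) S"
  shows "Ck_on (Suc k) f S"
proof -
  have "Ck_on k (\<lambda>x. frechet_derivative f (at x within S) v) S" for v
    by (rule Ck_on_cong[THEN iffD2, OF _ assms(3)])
      (use assms frechet_derivative_thick in fastforce)
  then show ?thesis
    using assms(2) by (auto simp: differentiable_on_def differentiable_def)
qed

lemma Ck_on_SucE:
  assumes "Ck_on (Suc k) f S" "x \<in> S"
  shows "(f has_derivative frechet_derivative f (at x within S)) (at x within S)"
  using assms by (simp add: differentiable_on_def frechet_derivative_works)

text \<open>Shrinking the set could enlarge the family of admissible derivatives, so restriction
  needs an argument. The derivative within \<open>S\<close> is still one within \<open>T\<close>,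
  and thickness of \<open>T\<close> makes it the only one.\<close>

lemma Ck_on_subset:
  assumes "Ck_on k f S" "T \<subseteq> S" "thick T"
  shows "Ck_on k f T"
  using assms(1)
proof (induction k arbitrary: f)
  case 0
  then show ?case using assms(2) continuous_on_subset by auto
next
  case (Suc k)
  show ?case
  proof (rule Ck_on_SucI[OF assms(3)])
    show "(f has_derivative frechet_derivative f (at x within S)) (at x within T)" if "x \<in> T" for x
      using Ck_on_SucE[OF Suc.prems] that assms(2) has_derivative_subset by blast
    show "Ck_on k (\<lambda>x. frechet_derivative f (at x within S) v) T" for v
      using Suc.prems by (intro Suc.IH) simp
  qed
qed

text \<open>Regularity is computed chart by chart and glued here. For open \<open>U\<close> the
  filters at a point of \<open>U\<close> within \<open>S \<inter> U\<close> and within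
  \<open>S\<close> coincide, so the two derivatives are the same.\<close>

lemma Ck_on_local:
  assumes "\<And>x. x \<in> S \<Longrightarrow> \<exists>U. open U \<and> x \<in> U \<and> Ck_on k f (S \<inter> U)"
  shows "Ck_on k f S"
  using assms
proof (induction k arbitrary: f)
  case 0
  show ?case
    unfolding Ck_on.simps continuous_on_eq_continuous_within
  proof
    fix x assume "x \<in> S"
    then obtain U where U: "open U" "x \<in> U" "Ck_on 0 f (S \<inter> U)"
      using 0 by blast
    then have "continuous (at x within S \<inter> U) f"
      using \<open>x \<in> S\<close> by (simp add: continuous_on_eq_continuous_within)
    then show "continuous (at x within S) f"
      using U at_within_nhd[of x U S "S \<inter> U"] by auto
  qed
next
  case (Suc k)
  have eq: "at x within S \<inter> U = at x within S" if "open U" "x \<in> U" for x :: 'a and U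
    using at_within_nhd[of x U S "S \<inter> U"] that by auto
  have "f differentiable_on S"
    unfolding differentiable_on_def
  proof
    fix x assume "x \<in> S"
    then show "f differentiable at x within S"
      using Suc.prems eq by (metis Ck_on.simps(2) IntI differentiable_on_def)
  qed
  moreover have "Ck_on k (\<lambda>x. frechet_derivative f (at x within S) v) S" for v
  proof (rule Suc.IH)
    fix x assume "x \<in> S"
    then obtain U where U: "open U" "x \<in> U" "Ck_on (Suc k) f (S \<inter> U)"
      using Suc.prems by blast
    then have "Ck_on k (\<lambda>x. frechet_derivative f (at x within S \<inter> U) v) (S \<inter> U)"
      by simp
    then have "Ck_on k (\<lambda>x. frechet_derivative f (at x within S) v) (S \<inter> U)"
      by (rule Ck_on_cong[THEN iffD1, rotated]) (use U eq in auto)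
    then show "\<exists>U. open U \<and> x \<in> U \<and> Ck_on k (\<lambda>x. frechet_derivative f (at x within S) v) (S \<inter> U)"
      using U by blast
  qed
  ultimately show ?case by simp
qed

lemma Ck_on_const: "thick S \<Longrightarrow> Ck_on k (\<lambda>x. c) S"
proof (induction k arbitrary: c)
  case (Suc k)
  then show ?case by (intro Ck_on_SucI[where D="\<lambda>x v. 0"]) auto
qed simp

section \<open>Closure properties of C^k functions\<close>

lemma Ck_on_bounded_linear:
  assumes "bounded_linear f" "thick S"
  shows "Ck_on k f S"
proof (cases k)
  case 0
  then show ?thesis
    using assms by (simp add: linear_continuous_on)
next
  case (Suc m)
  show ?thesis
    unfolding Suc
    by (intro Ck_on_SucI[where D="\<lambda>x. f"] assms bounded_linear_imp_has_derivative Ck_on_const)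
qed

lemma Ck_on_bounded_linear_compose:
  assumes "bounded_linear h" "thick S" "Ck_on k f S"
  shows "Ck_on k (\<lambda>x. h (f x)) S"
  using assms(3)
proof (induction k arbitrary: f)
  case 0
  then show ?case using assms(1) by (simp add: bounded_linear.continuous_on)
next
  case (Suc k)
  show ?case
  proof (rule Ck_on_SucI[OF assms(2)])
    show "((\<lambda>x. h (f x)) has_derivative (\<lambda>v. h (frechet_derivative f (at x within S) v))) (at x within S)"
      if "x \<in> S" for x
      using Ck_on_SucE[OF Suc.prems that] bounded_linear.has_derivative[OF assms(1)] by blast
    show "Ck_on k (\<lambda>x. h (frechet_derivative f (at x within S) v)) S" for v
      using Suc by auto
  qed
qed

lemma Ck_on_add:
  assumes "thick S" "Ck_on k f S" "Ck_on k g S"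
  shows "Ck_on k (\<lambda>x. f x + g x) S"
  using assms(2,3)
proof (induction k arbitrary: f g)
  case 0
  then show ?case by (simp add: continuous_on_add)
next
  case (Suc k)
  show ?case
  proof (rule Ck_on_SucI[OF assms(1)])
    show "((\<lambda>x. f x + g x) has_derivative
        (\<lambda>v. frechet_derivative f (at x within S) v + frechet_derivative g (at x within S) v)) (at x within S)"
      if "x \<in> S" for x
      using Suc.prems[THEN Ck_on_SucE] that by (intro has_derivative_add) auto
  qed (use Suc in auto)
qed

lemma Ck_on_sum:
  assumes "thick S" "finite I" "\<And>i. i \<in> I \<Longrightarrow> Ck_on k (f i) S"
  shows "Ck_on k (\<lambda>x. \<Sum>i\<in>I. f i x) S"
  using assms(2,3)
proof (induction I rule: finite_induct)
  case (insert j I)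
  then show ?case
    using Ck_on_add[OF assms(1), of k "f j" "\<lambda>x. \<Sum>i\<in>I. f i x"] by simp
qed (simp add: Ck_on_const assms(1))

lemma Ck_on_scaleR:
  fixes f :: "'a::euclidean_space \<Rightarrow> real"
  assumes "thick S" "Ck_on k f S" "Ck_on k g S"
  shows "Ck_on k (\<lambda>x. f x *\<^sub>R g x) S"
  using assms(2,3)
proof (induction k arbitrary: f g)
  case 0
  then show ?case by (simp add: continuous_on_scaleR)
next
  case (Suc k)
  show ?case
  proof (rule Ck_on_SucI[OF assms(1)])
    show "((\<lambda>x. f x *\<^sub>R g x) has_derivative
        (\<lambda>v. f x *\<^sub>R frechet_derivative g (at x within S) v + frechet_derivative f (at x within S) v *\<^sub>R g x))
        (at x within S)"
      if "x \<in> S" for x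
      using Suc.prems[THEN Ck_on_SucE] that by (intro has_derivative_scaleR) auto
    show "Ck_on k (\<lambda>x. f x *\<^sub>R frechet_derivative g (at x within S) v +
        frechet_derivative f (at x within S) v *\<^sub>R g x) S" for v
      using Suc.prems[THEN Ck_on_SucD] Suc.prems by (intro Ck_on_add[OF assms(1)] Suc.IH) auto
  qed
qed

lemma Ck_on_mult:
  fixes f :: "'a::euclidean_space \<Rightarrow> real"
  assumes "thick S" "Ck_on k f S" "Ck_on k g S"
  shows "Ck_on k (\<lambda>x. f x * g x) S"
  using Ck_on_scaleR[OF assms] by simp

lemma linear_basis_expansion:
  fixes D :: "'a::euclidean_space \<Rightarrow> 'b::real_vector"
  assumes "linear D"
  shows "D v = (\<Sum>b\<in>Basis. (v \<bullet> b) *\<^sub>R D b)"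
proof -
  have "D v = D (\<Sum>b\<in>Basis. (v \<bullet> b) *\<^sub>R b)"
    by (simp add: euclidean_representation)
  then show ?thesis
    by (simp add: linear_sum[OF assms] linear_scale[OF assms])
qed

text \<open>\<open>Ck_on\<close> controls the derivative only in fixed directions, while the chain
  rule applies the derivative of \<open>f\<close> to a moving direction. Expanding that direction in
  the basis gives a sum of products of C^k functions, and the induction hypothesis applies to the
  partial derivatives of \<open>f\<close> composed with \<open>g\<close>.\<close>

lemma Ck_on_compose:
  fixes f :: "'b::euclidean_space \<Rightarrow> 'c::real_normed_vector"
  assumes "thick S" "g ` S \<subseteq> T" "Ck_on k f T" "Ck_on k g S"
  shows "Ck_on k (\<lambda>x. f (g x)) S"
  using assms(3,4)
proof (induction k arbitrary: f)
  case 0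
  then show ?case using assms(2) by (auto intro: continuous_on_compose2)
next
  case (Suc k)
  let ?Df = "\<lambda>y. frechet_derivative f (at y within T)"
  let ?Dg = "\<lambda>x. frechet_derivative g (at x within S)"
  have hf: "(f has_derivative ?Df y) (at y within T)" if "y \<in> T" for y
    using Ck_on_SucE[OF Suc.prems(1) that] .
  have hg: "(g has_derivative ?Dg x) (at x within S)" if "x \<in> S" for x
    using Ck_on_SucE[OF Suc.prems(2) that] .
  have eq: "?Df (g x) (?Dg x v) = (\<Sum>b\<in>Basis. (?Dg x v \<bullet> b) *\<^sub>R ?Df (g x) b)" if "x \<in> S" for x v
  proof -
    have "linear (?Df (g x))"
      using hf[of "g x"] assms(2) that has_derivative_linear by blast
    then show ?thesis
      by (rule linear_basis_expansion)
  qed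
  show ?case
  proof (rule Ck_on_SucI[OF assms(1)])
    show "((\<lambda>x. f (g x)) has_derivative (\<lambda>v. \<Sum>b\<in>Basis. (?Dg x v \<bullet> b) *\<^sub>R ?Df (g x) b)) (at x within S)"
      if "x \<in> S" for x
    proof -
      have "(f has_derivative ?Df (g x)) (at (g x) within g ` S)"
        using hf that assms(2) has_derivative_subset by blast
      then have "(f \<circ> g has_derivative ?Df (g x) \<circ> ?Dg x) (at x within S)"
        using hg[OF that] by (rule diff_chain_within[rotated])
      then show ?thesis
        using eq[OF that] by (simp add: o_def)
    qed
    show "Ck_on k (\<lambda>x. \<Sum>b\<in>Basis. (?Dg x v \<bullet> b) *\<^sub>R ?Df (g x) b) S" for v
      using Suc.prems Ck_on_SucD[OF Suc.prems(2)]
      by (intro Ck_on_sum Ck_on_scaleR Suc.IH assms(1)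
          Ck_on_bounded_linear_compose[OF bounded_linear_inner_left]) auto
  qed
qed

lemma Ck_on_Pair:
  assumes "thick S" "Ck_on k f S" "Ck_on k g S"
  shows "Ck_on k (\<lambda>x. (f x, g x)) S"
proof -
  have "bounded_linear (\<lambda>x. (x, 0))" "bounded_linear (\<lambda>x. (0, x))"
    by (auto intro: bounded_linear_Pair bounded_linear_ident bounded_linear_zero)
  then have "Ck_on k (\<lambda>x. (f x, 0) + (0, g x)) S"
    using assms by (intro Ck_on_add) (auto intro: Ck_on_bounded_linear_compose)
  then show ?thesis by simp
qed

lemma Ck_on_power:
  fixes f :: "'a::euclidean_space \<Rightarrow> real"
  assumes "thick S" "Ck_on k f S"
  shows "Ck_on k (\<lambda>x. f x ^ n) S"
  by (induction n) (auto intro: Ck_on_const Ck_on_mult assms)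

lemma Ck_on_real_SucI:
  fixes f :: "real \<Rightarrow> 'b::real_normed_vector"
  assumes "thick S" "\<And>x. x \<in> S \<Longrightarrow> (f has_vector_derivative f' x) (at x within S)" "Ck_on k f' S"
  shows "Ck_on (Suc k) f S"
proof (rule Ck_on_SucI[OF assms(1)])
  show "(f has_derivative (\<lambda>v. v *\<^sub>R f' x)) (at x within S)" if "x \<in> S" for x
    using assms(2)[OF that] by (simp add: has_vector_derivative_def)
qed (use assms in \<open>auto intro: Ck_on_scaleR Ck_on_const\<close>)

text \<open>The direction \<open>v p\<close> moves along with the base point; expanding it in the
  basis reduces the claim to continuity in each fixed direction.\<close>

lemma continuous_on_frechet_derivative:
  fixes F :: "'b::euclidean_space \<Rightarrow> 'c::real_normed_vector"
  assumes "Ck_on (Suc k) F U" "open U" "continuous_on S \<xi>" "continuous_on S v" "\<xi> ` S \<subseteq> U"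
  shows "continuous_on S (\<lambda>p. frechet_derivative F (at (\<xi> p)) (v p))"
proof -
  have lin: "linear (frechet_derivative F (at y))" if "y \<in> U" for y
    using Ck_on_SucE[OF assms(1) that] assms(2) that at_within_open has_derivative_linear by metis
  have "continuous_on U (\<lambda>y. frechet_derivative F (at y within U) b)" for b
    using assms(1) Ck_on_imp_continuous_on by auto
  then have "continuous_on U (\<lambda>y. frechet_derivative F (at y) b)" for b
    using at_within_open[OF _ assms(2)] by (simp cong: continuous_on_cong)
  then have "continuous_on S (\<lambda>p. frechet_derivative F (at (\<xi> p)) b)" for b
    by (rule continuous_on_compose2[OF _ assms(3,5)])
  then have "continuous_on S (\<lambda>p. \<Sum>b\<in>Basis. (v p \<bullet> b) *\<^sub>R frechet_derivative F (at (\<xi> p)) b)"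
    using assms(4) by (intro continuous_on_sum continuous_on_scaleR continuous_on_inner continuous_on_const)
  then show ?thesis
  proof (rule continuous_on_eq)
    fix p assume "p \<in> S"
    then have "\<xi> p \<in> U"
      using assms(5) by blast
    then show "(\<Sum>b\<in>Basis. (v p \<bullet> b) *\<^sub>R frechet_derivative F (at (\<xi> p)) b) =
        frechet_derivative F (at (\<xi> p)) (v p)"
      by (rule linear_basis_expansion[OF lin, symmetric])
  qed
qed

lemma Ck_on_open_has_derivative:
  assumes "Ck_on (Suc k) F U" "open U" "x \<in> U"
  shows "(F has_derivative frechet_derivative F (at x)) (at x)"
  using Ck_on_SucE[OF assms(1,3)] assms(2,3) at_within_open by metis

lemma Ck_on_frechet_derivative_open:
  assumes "Ck_on (Suc k) F U" "open U"
  shows "Ck_on k (\<lambda>x. frechet_derivative F (at x) v) U"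
proof -
  have "Ck_on k (\<lambda>x. frechet_derivative F (at x within U) v) U"
    using assms by simp
  moreover have "frechet_derivative F (at x within U) v = frechet_derivative F (at x) v" if "x \<in> U" for x
    using at_within_open[OF that assms(2)] by simp
  ultimately show ?thesis
    using Ck_on_cong[of U "\<lambda>x. frechet_derivative F (at x within U) v" "\<lambda>x. frechet_derivative F (at x) v"]
    by blast
qed

section \<open>Two-parameter families and mixed partial derivatives\<close>

text \<open>The mixed partial derivatives agree by differentiation under the integral sign.\<close>

lemma mixed_partials_eq:
  fixes f :: "real \<Rightarrow> real \<Rightarrow> 'b::banach"
  assumes S: "convex S" "open S" and cd: "c < d"
    and fs: "\<And>s t. s \<in> S \<Longrightarrow> t \<in> {c..d} \<Longrightarrow> ((\<lambda>s. f s t) has_vector_derivative fs s t) (at s)"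
    and ft: "\<And>s t. s \<in> S \<Longrightarrow> t \<in> {c..d} \<Longrightarrow> (f s has_vector_derivative ft s t) (at t within {c..d})"
    and fts: "\<And>s t. s \<in> S \<Longrightarrow> t \<in> {c..d} \<Longrightarrow> ((\<lambda>s. ft s t) has_vector_derivative fts s t) (at s)"
    and cont_ft: "continuous_on (S \<times> {c..d}) (\<lambda>(s, t). ft s t)"
    and cont_fts: "continuous_on (S \<times> {c..d}) (\<lambda>(s, t). fts s t)"
    and s0: "s0 \<in> S" and t0: "t0 \<in> {c..d}"
  shows "(fs s0 has_vector_derivative fts s0 t0) (at t0 within {c..d})"
proof -
  have cs: "continuous_on {c..d} (ft s)" if "s \<in> S" for s
  proof -
    have "continuous_on {c..d} (\<lambda>t. (\<lambda>(s, t). ft s t) (s, t))"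
      by (rule continuous_on_compose2[OF cont_ft])
        (use that in \<open>auto intro!: continuous_on_Pair continuous_on_const continuous_on_id\<close>)
    then show ?thesis by simp
  qed
  have cs2: "continuous_on {c..d} (fts s0)"
  proof -
    have "continuous_on {c..d} (\<lambda>t. (\<lambda>(s, t). fts s t) (s0, t))"
      by (rule continuous_on_compose2[OF cont_fts])
        (use s0 in \<open>auto intro!: continuous_on_Pair continuous_on_const continuous_on_id\<close>)
    then show ?thesis by simp
  qed
  \<comment> \<open>Both sides are the derivative at \<open>s0\<close> of
    \<open>f s t - f s c\<close>: the left one termwise, the right one by writing the difference as
    the integral of \<open>ft s\<close> and differentiating inside.\<close>
  have "fs s0 t - fs s0 c = integral {c..t} (fts s0)" if t: "t \<in> {c..d}" for t
  proof -
    have sub: "{c..t} \<subseteq> {c..d}"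
      using t by auto
    have int: "integral {c..t} (ft s) = f s t - f s c" if "s \<in> S" for s
    proof (rule integral_unique, rule fundamental_theorem_of_calculus)
      show "(f s has_vector_derivative ft s x) (at x within {c..t})" if "x \<in> {c..t}" for x
        using ft[OF \<open>s \<in> S\<close>] that sub has_vector_derivative_within_subset by blast
    qed (use t in auto)
    have "((\<lambda>s. integral (cbox c t) (ft s)) has_vector_derivative integral (cbox c t) (fts s0))
        (at s0 within S)"
    proof (rule leibniz_rule_vector_derivative[OF _ _ _ s0 S(1)])
      show "((\<lambda>s. ft s x) has_vector_derivative fts s x) (at s within S)" if "s \<in> S" "x \<in> cbox c t" for s x
        using fts that sub has_vector_derivative_at_within by (metis box_real(2) subsetD)
      show "ft s integrable_on cbox c t" if "s \<in> S" for s
        using continuous_on_subset[OF cs[OF that] sub] by (simp add: integrable_continuous_real)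
      show "continuous_on (S \<times> cbox c t) (\<lambda>(s, t). fts s t)"
        by (rule continuous_on_subset[OF cont_fts]) (use sub in auto)
    qed
    then have "((\<lambda>s. integral (cbox c t) (ft s)) has_vector_derivative integral {c..t} (fts s0)) (at s0)"
      using at_within_open[OF s0 S(2)] by simp
    then have "((\<lambda>s. f s t - f s c) has_vector_derivative integral {c..t} (fts s0)) (at s0)"
      by (rule has_vector_derivative_transform_within_open[OF _ S(2) s0]) (simp add: int)
    moreover have "((\<lambda>s. f s t - f s c) has_vector_derivative fs s0 t - fs s0 c) (at s0)"
      using t cd by (intro has_vector_derivative_diff fs s0) auto
    ultimately show ?thesis
      using vector_derivative_unique_at by blast
  qed
  then have eq: "fs s0 t = fs s0 c + integral {c..t} (fts s0)" if "t \<in> {c..d}" for t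
    using that by (metis add.commute diff_add_cancel)
  have "((\<lambda>t. fs s0 c + integral {c..t} (fts s0)) has_vector_derivative 0 + fts s0 t0) (at t0 within {c..d})"
    by (intro has_vector_derivative_add has_vector_derivative_const integral_has_vector_derivative cs2 t0)
  from has_vector_derivative_transform[OF t0 eq this] show ?thesis
    by simp
qed

text \<open>\<open>s\<close> will be the deformation parameter and \<open>t\<close> the time. One
  function \<open>fst'\<close> is the \<open>s\<close>-derivative of the velocity \<open>ft\<close>
  and the \<open>t\<close>-derivative of the variation field \<open>fs\<close>; the first variation
  rests on this interchange. Derivatives in \<open>t\<close> are taken within \<open>{a..b}\<close>,
  so that they make sense at the impact.\<close>

lemma C2_family:
  fixes f :: "real \<times> real \<Rightarrow> 'b::banach"
  assumes W: "openin (top_of_set (S \<times> {a..b})) W" and S: "open S" and ab: "a < b" and f: "Ck_on 2 f W"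
  obtains fs ft fst' ftt where
    "continuous_on W fs" "continuous_on W ft" "continuous_on W fst'" "continuous_on W ftt"
    "\<And>s t. (s, t) \<in> W \<Longrightarrow> ((\<lambda>s. f (s, t)) has_vector_derivative fs (s, t)) (at s)"
    "\<And>s t. (s, t) \<in> W \<Longrightarrow> ((\<lambda>t. f (s, t)) has_vector_derivative ft (s, t)) (at t within {a..b})"
    "\<And>s t. (s, t) \<in> W \<Longrightarrow> ((\<lambda>s. ft (s, t)) has_vector_derivative fst' (s, t)) (at s)"
    "\<And>s t. (s, t) \<in> W \<Longrightarrow> ((\<lambda>t. ft (s, t)) has_vector_derivative ftt (s, t)) (at t within {a..b})"
    "\<And>s t. (s, t) \<in> W \<Longrightarrow> ((\<lambda>t. fs (s, t)) has_vector_derivative fst' (s, t)) (at t within {a..b})"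
proof -
  obtain N where N: "open N" "W = (S \<times> {a..b}) \<inter> N"
    using W by (auto simp: openin_open)
  have thW: "thick W"
    using thick_openin[OF thick_Times[OF thick_open[OF S] thick_Icc[OF ab]] W] .
  \<comment> \<open>Partial derivatives are taken along lines through the point, so \<open>W\<close>
    has to contain a product neighbourhood of it, cut off only in \<open>t\<close> at the ends of
    \<open>{a..b}\<close>.\<close>
  have box: "\<exists>r>0. {s - r<..<s + r} \<times> ({t - r..t + r} \<inter> {a..b}) \<subseteq> W \<and> {s - r<..<s + r} \<subseteq> S"
    if "(s, t) \<in> W" for s t
  proof -
    have o: "open (N \<inter> (S \<times> UNIV))"
      using N S by (intro open_Int open_Times) auto
    have m: "(s, t) \<in> N \<inter> (S \<times> UNIV)"
      using N that by auto
    obtain U V where "open U" "open V" "(s, t) \<in> U \<times> V" "U \<times> V \<subseteq> N \<inter> (S \<times> UNIV)"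
      using open_prod_elim[OF o m] .
    then have UV: "open U" "open V" "s \<in> U" "t \<in> V" "U \<times> V \<subseteq> N \<inter> (S \<times> UNIV)"
      by auto
    obtain r1 where r1: "r1 > 0" "ball s r1 \<subseteq> U"
      using UV openE by blast
    obtain r2 where r2: "r2 > 0" "cball t r2 \<subseteq> V"
      using UV open_contains_cball by blast
    have "{s - min r1 r2<..<s + min r1 r2} \<subseteq> U" "{t - min r1 r2..t + min r1 r2} \<subseteq> V"
      using r1 r2 by (auto simp: subset_iff dist_real_def)
    moreover have "U \<subseteq> S"
      using UV by auto
    ultimately have "{s - min r1 r2<..<s + min r1 r2} \<times> ({t - min r1 r2..t + min r1 r2} \<inter> {a..b}) \<subseteq> W"
      "{s - min r1 r2<..<s + min r1 r2} \<subseteq> S"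
      using UV(5) unfolding N(2) by blast+
    moreover have "0 < min r1 r2"
      using r1 r2 by simp
    ultimately show ?thesis
      by blast
  qed
  let ?D = "\<lambda>g p. frechet_derivative g (at p within W)"
  have ds: "((\<lambda>s. g (s, t)) has_vector_derivative ?D g (s, t) (1, 0)) (at s)"
    if p: "(s, t) \<in> W" and g: "Ck_on (Suc k) g W" for s t k and g :: "real \<times> real \<Rightarrow> 'b"
  proof -
    obtain r where r: "r > 0" "{s - r<..<s + r} \<times> ({t - r..t + r} \<inter> {a..b}) \<subseteq> W"
      using box[OF p] by blast
    have sub: "(\<lambda>s. (s, t)) ` {s - r<..<s + r} \<subseteq> W"
      by (rule subset_trans[OF _ r(2)]) (use r(1) p N in auto)
    have "(g has_derivative ?D g (s, t)) (at (s, t) within (\<lambda>s. (s, t)) ` {s - r<..<s + r})"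
      using Ck_on_SucE[OF g p] sub has_derivative_subset by blast
    from diff_chain_within[OF has_derivative_Pair[OF has_derivative_ident has_derivative_const] this]
    have "((\<lambda>s. g (s, t)) has_derivative (\<lambda>h. ?D g (s, t) (h, 0))) (at s within {s - r<..<s + r})"
      by (simp add: o_def)
    moreover have "(\<lambda>h. ?D g (s, t) (h, 0)) = (\<lambda>h. h *\<^sub>R ?D g (s, t) (1, 0))"
    proof
      fix h
      show "?D g (s, t) (h, 0) = h *\<^sub>R ?D g (s, t) (1, 0)"
        using linear_scale[OF has_derivative_linear[OF Ck_on_SucE[OF g p]], of h "(1, 0)"] by simp
    qed
    moreover have "at s within {s - r<..<s + r} = at s"
      using r(1) by (intro at_within_open) auto
    ultimately show ?thesis
      unfolding has_vector_derivative_def by metis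
  qed
  have dt: "((\<lambda>t. g (s, t)) has_vector_derivative ?D g (s, t) (0, 1)) (at t within {a..b})"
    if p: "(s, t) \<in> W" and g: "Ck_on (Suc k) g W" for s t k and g :: "real \<times> real \<Rightarrow> 'b"
  proof -
    obtain r where r: "r > 0" "{s - r<..<s + r} \<times> ({t - r..t + r} \<inter> {a..b}) \<subseteq> W"
      using box[OF p] by blast
    have sub: "Pair s ` ({t - r..t + r} \<inter> {a..b}) \<subseteq> W"
      using r by auto
    have eq: "at t within {t - r..t + r} \<inter> {a..b} = at t within {a..b}"
      by (rule at_within_nhd[of t "{t - r<..<t + r}"]) (use r(1) in auto)
    have "(g has_derivative ?D g (s, t)) (at (s, t) within Pair s ` ({t - r..t + r} \<inter> {a..b}))"
      using Ck_on_SucE[OF g p] sub has_derivative_subset by blast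
    from diff_chain_within[OF has_derivative_Pair[OF has_derivative_const has_derivative_ident] this]
    have "((\<lambda>t. g (s, t)) has_derivative (\<lambda>h. ?D g (s, t) (0, h))) (at t within {a..b})"
      unfolding eq by (simp add: o_def)
    moreover have "(\<lambda>h. ?D g (s, t) (0, h)) = (\<lambda>h. h *\<^sub>R ?D g (s, t) (0, 1))"
    proof
      fix h
      show "?D g (s, t) (0, h) = h *\<^sub>R ?D g (s, t) (0, 1)"
        using linear_scale[OF has_derivative_linear[OF Ck_on_SucE[OF g p]], of h "(0, 1)"] by simp
    qed
    ultimately show ?thesis
      unfolding has_vector_derivative_def by metis
  qed
  define fs where "fs = (\<lambda>p. ?D f p (1, 0))"
  define ft where "ft = (\<lambda>p. ?D f p (0, 1))"
  define fts where "fts = (\<lambda>p. ?D ft p (1, 0))"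
  define ftt where "ftt = (\<lambda>p. ?D ft p (0, 1))"
  have f1: "Ck_on (Suc 1) f W"
    using f by (simp add: numeral_2_eq_2)
  then have fs1: "Ck_on (Suc 0) fs W" and ft1: "Ck_on (Suc 0) ft W"
    unfolding fs_def ft_def by simp_all
  then have c: "continuous_on W fs" "continuous_on W ft" "continuous_on W fts" "continuous_on W ftt"
    unfolding fts_def ftt_def by (auto dest: Ck_on_imp_continuous_on simp del: Ck_on.simps(2))
      (use ft1 in simp_all)
  have d: "((\<lambda>s. f (s, t)) has_vector_derivative fs (s, t)) (at s)"
    "((\<lambda>t. f (s, t)) has_vector_derivative ft (s, t)) (at t within {a..b})"
    "((\<lambda>s. ft (s, t)) has_vector_derivative fts (s, t)) (at s)"
    "((\<lambda>t. ft (s, t)) has_vector_derivative ftt (s, t)) (at t within {a..b})" if "(s, t) \<in> W" for s t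
    unfolding fts_def ftt_def using ds[OF that f1] dt[OF that f1] ds[OF that ft1] dt[OF that ft1]
    by (simp_all add: fs_def ft_def)
  have d': "((\<lambda>t. fs (s, t)) has_vector_derivative fts (s, t)) (at t within {a..b})" if p: "(s, t) \<in> W" for s t
  proof -
    obtain r where r: "r > 0" "{s - r<..<s + r} \<times> ({t - r..t + r} \<inter> {a..b}) \<subseteq> W"
      using box[OF p] by blast
    \<comment> \<open>\<open>mixed_partials_eq\<close> works on a full rectangle. The time interval
      is cut down to the part of \<open>{a..b}\<close> inside the box; near \<open>t\<close> the two
      intervals coincide, so the derivative at \<open>t\<close> is unchanged.\<close>
    define c1 where "c1 = max a (t - r)"
    define d1 where "d1 = min b (t + r)"
    have t: "t \<in> {a..b}"
      using p N by auto
    have cd: "c1 < d1" "t \<in> {c1..d1}" "{c1..d1} = {t - r..t + r} \<inter> {a..b}"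
      using r(1) t ab by (auto simp: c1_def d1_def)
    have sub: "{s - r<..<s + r} \<times> {c1..d1} \<subseteq> W"
      using r cd by auto
    have eq: "at t within {c1..d1} = at t within {a..b}"
      unfolding cd(3) by (rule at_within_nhd[of t "{t - r<..<t + r}"]) (use r(1) in auto)
    have "((\<lambda>t. fs (s, t)) has_vector_derivative fts (s, t)) (at t within {c1..d1})"
    proof (rule mixed_partials_eq[of "{s - r<..<s + r}" c1 d1 "\<lambda>s t. f (s, t)" "\<lambda>s t. fs (s, t)"
          "\<lambda>s t. ft (s, t)" "\<lambda>s t. fts (s, t)"])
      fix s' t' assume st: "s' \<in> {s - r<..<s + r}" "t' \<in> {c1..d1}"
      then have p': "(s', t') \<in> W"
        using sub by auto
      show "((\<lambda>s. f (s, t')) has_vector_derivative fs (s', t')) (at s')"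
        "((\<lambda>s. ft (s, t')) has_vector_derivative fts (s', t')) (at s')"
        by (rule d[OF p'])+
      show "((\<lambda>t. f (s', t)) has_vector_derivative ft (s', t')) (at t' within {c1..d1})"
        using d(2)[OF p'] by (rule has_vector_derivative_within_subset) (use cd in auto)
    next
      show "continuous_on ({s - r<..<s + r} \<times> {c1..d1}) (\<lambda>(s, t). ft (s, t))"
        "continuous_on ({s - r<..<s + r} \<times> {c1..d1}) (\<lambda>(s, t). fts (s, t))"
        using c sub by (auto intro: continuous_on_subset)
    qed (use r cd in auto)
    then show ?thesis
      unfolding eq .
  qed
  show thesis
    by (rule that[OF c d d'])
qed

section \<open>Scalar differential equations\<close>

text \<open>Banach's fixed point theorem in the norm weighted by \<open>exp (- 2 * K * (t - a))\<close>.\<close>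

lemma lipschitz_ode_solution_exists:
  fixes f :: "real \<Rightarrow> real \<Rightarrow> real"
  assumes ab: "a \<le> b" and cont: "continuous_on ({a..b} \<times> UNIV) (\<lambda>(t, z). f t z)"
    and lip: "\<And>t z z'. t \<in> {a..b} \<Longrightarrow> \<bar>f t z - f t z'\<bar> \<le> K * \<bar>z - z'\<bar>" and K: "K > 0"
  shows "\<exists>Z. Z a = z0 \<and> (\<forall>t\<in>{a..b}. (Z has_real_derivative f t (Z t)) (at t within {a..b}))"
proof -
  \<comment> \<open>The rate \<open>2 * K\<close> of the weight makes the contraction constant
    \<open>K / M\<close> equal to 1/2.\<close>
  define M where "M = 2 * K"
  have M: "M > 0"
    using K by (simp add: M_def)
  \<comment> \<open>The unknown is \<open>y t = exp (- (M * (t - a))) * Z t\<close>, so that the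
    weighted norm of \<open>Z\<close> is the plain sup norm of \<open>y\<close>; \<open>G\<close> is
    the Picard operator written for \<open>y\<close>.\<close>
  define G where "G y t = exp (- (M * (t - a))) * (z0 + integral {a..t} (\<lambda>r. f r (exp (M * (r - a)) * y r)))" for y t
  \<comment> \<open>Bounded continuous functions live on the whole line. Clamping the time to
    \<open>{a..b}\<close> extends \<open>G y\<close> to such a function, constant beyond the
    ends.\<close>
  define T where "T y = Bcontfun (\<lambda>t. G (apply_bcontfun y) (max a (min b t)))" for y :: "real \<Rightarrow>\<^sub>C real"
  have ci: "continuous_on {a..b} (\<lambda>r. f r (exp (M * (r - a)) * y r))" if "continuous_on {a..b} y" for y
  proof -
    have "continuous_on {a..b} (\<lambda>r. (\<lambda>(t, z). f t z) (r, exp (M * (r - a)) * y r))"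
      by (rule continuous_on_compose2[OF cont]) (auto intro!: continuous_intros that)
    then show ?thesis by simp
  qed
  have cG: "continuous_on {a..b} (G y)" if "continuous_on {a..b} y" for y
    unfolding G_def
    by (intro continuous_intros indefinite_integral_continuous_1 integrable_continuous_real ci that)
  have T: "apply_bcontfun (T y) = (\<lambda>t. G (apply_bcontfun y) (max a (min b t)))" for y
  proof -
    have c: "continuous_on UNIV (\<lambda>t. G (apply_bcontfun y) (max a (min b t)))"
      by (rule continuous_on_compose2[OF cG]) (use ab in \<open>auto intro!: continuous_intros\<close>)
    have "compact (G (apply_bcontfun y) ` {a..b})"
      by (intro compact_continuous_image cG) auto
    then have "bounded (G (apply_bcontfun y) ` {a..b})"
      by (rule compact_imp_bounded)
    then have "bounded (range (\<lambda>t. G (apply_bcontfun y) (max a (min b t))))"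
      by (rule bounded_subset) (use ab in auto)
    then show ?thesis
      unfolding T_def using c by (intro Bcontfun_inverse) (simp add: bcontfun_def)
  qed
  have GG: "\<bar>G y t - G y' t\<bar> \<le> B / 2"
    if cy: "continuous_on {a..b} y" "continuous_on {a..b} y'" and B: "\<And>t. \<bar>y t - y' t\<bar> \<le> B"
      and t: "t \<in> {a..b}" for y y' t B
  proof -
    let ?F = "\<lambda>y r. f r (exp (M * (r - a)) * y r)"
    have sub: "{a..t} \<subseteq> {a..b}"
      using t by auto
    have int: "?F y integrable_on {a..t}" if "continuous_on {a..b} y" for y
      by (intro integrable_continuous_real continuous_on_subset[OF ci[OF that] sub])
    have exi: "((\<lambda>r. K * B * exp (M * (r - a))) has_integral
        K * B / M * exp (M * (t - a)) - K * B / M * exp (M * (a - a))) {a..t}"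
    proof (rule fundamental_theorem_of_calculus)
      show "((\<lambda>r. K * B / M * exp (M * (r - a))) has_vector_derivative K * B * exp (M * (r - a))) (at r within {a..t})" for r
        unfolding has_real_derivative_iff_has_vector_derivative[symmetric]
        using M by (auto intro!: derivative_eq_intros)
    qed (use t in auto)
    have "\<bar>integral {a..t} (?F y) - integral {a..t} (?F y')\<bar> = \<bar>integral {a..t} (\<lambda>r. ?F y r - ?F y' r)\<bar>"
      using cy by (simp add: integral_diff int)
    also have "\<dots> \<le> integral {a..t} (\<lambda>r. K * B * exp (M * (r - a)))"
    proof (rule integral_norm_bound_integral[where 'a=real, unfolded real_norm_def])
      show "(\<lambda>r. ?F y r - ?F y' r) integrable_on {a..t}"
        by (intro integrable_diff int cy)
      show "(\<lambda>r. K * B * exp (M * (r - a))) integrable_on {a..t}"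
        using exi by blast
      fix r assume r: "r \<in> {a..t}"
      have "\<bar>?F y r - ?F y' r\<bar> \<le> K * \<bar>exp (M * (r - a)) * y r - exp (M * (r - a)) * y' r\<bar>"
        using r sub by (intro lip) auto
      also have "\<dots> = K * exp (M * (r - a)) * \<bar>y r - y' r\<bar>"
        by (simp add: right_diff_distrib[symmetric] abs_mult)
      also have "\<dots> \<le> K * exp (M * (r - a)) * B"
        using K B by (intro mult_left_mono) auto
      finally show "\<bar>?F y r - ?F y' r\<bar> \<le> K * B * exp (M * (r - a))"
        by (simp add: mult_ac)
    qed
    also have "\<dots> = B / 2 * (exp (M * (t - a)) - 1)"
      using integral_unique[OF exi] K by (simp add: M_def field_simps)
    also have "\<dots> \<le> B / 2 * exp (M * (t - a))"
      using B[of t] by (intro mult_left_mono) auto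
    finally have *: "\<bar>integral {a..t} (?F y) - integral {a..t} (?F y')\<bar> \<le> B / 2 * exp (M * (t - a))" .
    have "\<bar>G y t - G y' t\<bar> = exp (- (M * (t - a))) * \<bar>integral {a..t} (?F y) - integral {a..t} (?F y')\<bar>"
      unfolding G_def by (simp add: right_diff_distrib[symmetric] abs_mult)
    also have "\<dots> \<le> exp (- (M * (t - a))) * (B / 2 * exp (M * (t - a)))"
      using * by (intro mult_left_mono) auto
    also have "\<dots> = B / 2"
      by (simp add: exp_minus)
    finally show ?thesis .
  qed
  have "\<exists>!y. T y = y"
  proof (rule banach_fix_type[of "1/2"])
    show "\<forall>y y'. dist (T y) (T y') \<le> 1 / 2 * dist y y'"
    proof (intro allI dist_bound)
      fix y y' t
      have "\<bar>G (apply_bcontfun y) (max a (min b t)) - G (apply_bcontfun y') (max a (min b t))\<bar> \<le> dist y y' / 2"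
        using ab dist_bounded[of y _ y'] by (intro GG) (auto simp: dist_real_def)
      then show "dist (apply_bcontfun (T y) t) (apply_bcontfun (T y') t) \<le> 1 / 2 * dist y y'"
        unfolding T by (simp add: dist_real_def)
    qed
  qed auto
  then obtain y where y: "T y = y" by blast
  have cy: "continuous_on {a..b} (apply_bcontfun y)" by simp
  define Z where "Z t = z0 + integral {a..t} (\<lambda>r. f r (exp (M * (r - a)) * apply_bcontfun y r))" for t
  have Zy: "exp (M * (t - a)) * apply_bcontfun y t = Z t" if "t \<in> {a..b}" for t
  proof -
    have "apply_bcontfun y t = G (apply_bcontfun y) t"
      using fun_cong[OF T, of y t] that y by simp
    then show ?thesis
      by (simp add: G_def Z_def exp_minus)
  qed
  have "(Z has_real_derivative f t (Z t)) (at t within {a..b})" if t: "t \<in> {a..b}" for t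
  proof -
    have "((\<lambda>t. z0 + integral {a..t} (\<lambda>r. f r (exp (M * (r - a)) * apply_bcontfun y r))) has_vector_derivative
        0 + f t (exp (M * (t - a)) * apply_bcontfun y t)) (at t within {a..b})"
      by (intro has_vector_derivative_add has_vector_derivative_const
          integral_has_vector_derivative ci cy t)
    then show ?thesis
      unfolding Zy[OF t] Z_def[symmetric] by (simp add: has_real_derivative_iff_has_vector_derivative)
  qed
  moreover have "Z a = z0"
    by (simp add: Z_def)
  ultimately show ?thesis by blast
qed

section \<open>Comparison of solutions\<close>

lemma continuous_on_Icc_bounded:
  fixes f :: "real \<Rightarrow> real"
  assumes "continuous_on {a..b} f"
  shows "\<exists>B. \<forall>t\<in>{a..b}. \<bar>f t\<bar> \<le> B"
proof -
  have "bounded (f ` {a..b})"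
    using assms by (auto intro: compact_imp_bounded compact_continuous_image)
  then show ?thesis
    unfolding bounded_iff by simp
qed

lemma mvt_segment:
  fixes f :: "real \<Rightarrow> real"
  assumes "\<And>x. x \<in> closed_segment u v \<Longrightarrow> (f has_real_derivative f' x) (at x)"
  shows "\<exists>x\<in>closed_segment u v. f v - f u = f' x * (v - u)"
proof (cases u v rule: linorder_cases)
  case less
  then show ?thesis
    using MVT2[of u v f f'] assms by (fastforce simp: closed_segment_eq_real_ivl mult.commute)
next
  case greater
  then obtain x where "v < x" "x < u" "f u - f v = (u - v) * f' x"
    using MVT2[of v u f f'] assms by (fastforce simp: closed_segment_eq_real_ivl)
  then show ?thesis
    by (intro bexI[of _ x]) (auto simp: closed_segment_eq_real_ivl algebra_simps)
qed auto

lemma nondecreasing_openI: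
  fixes f :: "real \<Rightarrow> real"
  assumes "a \<le> b" "continuous_on {a..b} f"
    and "\<And>x. a < x \<Longrightarrow> x < b \<Longrightarrow> \<exists>y. (f has_real_derivative y) (at x) \<and> 0 \<le> y"
  shows "f a \<le> f b"
proof (cases "a < b")
  case True
  have "f differentiable (at x)" if "a < x" "x < b" for x
    using assms(3)[OF that] real_differentiable_def by blast
  then obtain l z where z: "a < z" "z < b" "(f has_real_derivative l) (at z)" "f b - f a = (b - a) * l"
    using MVT[OF True assms(2)] by blast
  then have "0 \<le> l"
    using assms(3) DERIV_unique by blast
  then show ?thesis
    using z(4) True by (metis diff_ge_0_iff_ge less_imp_le mult_nonneg_nonneg)
qed (use assms(1) in simp)

text \<open>Squaring avoids differentiating an absolute value. The inhomogeneous term is absorbed by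
  2 |D| m \<le> D^2 + m^2, which accounts for the rate 2 K + 1; then exp (- (2 K + 1) (t - a)) D^2 -
  m^2 (t - a) is nonincreasing. Derivatives enter at interior times only, because at the impact no
  equation is imposed on Z.\<close>

lemma gronwall_square:
  fixes D D' :: "real \<Rightarrow> real"
  assumes K: "0 \<le> K" and cont: "continuous_on {a..b} D"
    and der: "\<And>t. t \<in> {a<..<b} \<Longrightarrow> (D has_real_derivative D' t) (at t)"
    and le: "\<And>t. t \<in> {a<..<b} \<Longrightarrow> \<bar>D' t\<bar> \<le> K * \<bar>D t\<bar> + m"
    and t: "t \<in> {a..b}"
  shows "(D t)\<^sup>2 \<le> exp ((2 * K + 1) * (b - a)) * ((D a)\<^sup>2 + m\<^sup>2 * (b - a))"
proof -
  define M where "M = 2 * K + 1"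
  have M: "M > 0"
    using K by (simp add: M_def)
  define E where "E t = exp (- (M * (t - a))) * (D t)\<^sup>2 - m\<^sup>2 * (t - a)" for t
  have "- E a \<le> - E t"
  proof (rule nondecreasing_openI[where f = "\<lambda>t. - E t"])
    show "a \<le> t" using t by simp
    show "continuous_on {a..t} (\<lambda>t. - E t)"
      unfolding E_def using t by (intro continuous_intros continuous_on_subset[OF cont]) auto
    fix x assume x: "a < x" "x < t"
    then have x': "x \<in> {a<..<b}"
      using t by auto
    define e where "e = exp (- (M * (x - a)))"
    have e: "0 < e" "e \<le> 1"
      using x M by (auto simp: e_def)
    have d: "(E has_real_derivative e * (2 * D x * D' x - M * (D x)\<^sup>2) - m\<^sup>2) (at x)"
      unfolding E_def e_def
      by (rule derivative_eq_intros der[OF x'] refl)+ (simp add: algebra_simps power2_eq_square)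
    have "2 * D x * D' x \<le> 2 * \<bar>D x\<bar> * \<bar>D' x\<bar>"
      by (metis abs_ge_self abs_mult abs_numeral)
    also have "\<dots> \<le> 2 * \<bar>D x\<bar> * (K * \<bar>D x\<bar> + m)"
      using le[OF x'] by (intro mult_left_mono) auto
    also have "\<dots> = 2 * K * (D x)\<^sup>2 + 2 * \<bar>D x\<bar> * m"
      by (simp add: algebra_simps power2_eq_square)
    also have "\<dots> \<le> 2 * K * (D x)\<^sup>2 + ((D x)\<^sup>2 + m\<^sup>2)"
      using sum_squares_bound[of "\<bar>D x\<bar>" m] by simp
    finally have "2 * D x * D' x - M * (D x)\<^sup>2 \<le> m\<^sup>2"
      by (simp add: M_def algebra_simps)
    then have "e * (2 * D x * D' x - M * (D x)\<^sup>2) \<le> e * m\<^sup>2"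
      using e by (intro mult_left_mono) auto
    also have "\<dots> \<le> m\<^sup>2"
      using e by (simp add: mult_left_le_one_le)
    finally show "\<exists>y. ((\<lambda>t. - E t) has_real_derivative y) (at x) \<and> 0 \<le> y"
      using DERIV_minus[OF d] by (intro exI conjI) auto
  qed
  then have "exp (- (M * (t - a))) * (D t)\<^sup>2 \<le> (D a)\<^sup>2 + m\<^sup>2 * (t - a)"
    by (simp add: E_def)
  also have "\<dots> \<le> (D a)\<^sup>2 + m\<^sup>2 * (b - a)"
    using t by (intro add_left_mono mult_left_mono) auto
  finally have *: "exp (- (M * (t - a))) * (D t)\<^sup>2 \<le> (D a)\<^sup>2 + m\<^sup>2 * (b - a)" .
  have "(D t)\<^sup>2 = exp (M * (t - a)) * (exp (- (M * (t - a))) * (D t)\<^sup>2)"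
    by (simp add: exp_minus)
  also have "\<dots> \<le> exp (M * (t - a)) * ((D a)\<^sup>2 + m\<^sup>2 * (b - a))"
    using * by (intro mult_left_mono) auto
  also have "\<dots> \<le> exp (M * (b - a)) * ((D a)\<^sup>2 + m\<^sup>2 * (b - a))"
    using t M by (intro mult_right_mono) auto
  finally show ?thesis
    by (simp add: M_def)
qed

text \<open>Both solutions stay in a compact interval \<open>{-R..R}\<close>, over which
  \<open>fz\<close> is bounded by some \<open>K\<close> even if it is unbounded globally. The mean
  value theorem then gives the hypothesis of \<open>gronwall_square\<close> with
  \<open>m = 0\<close> for the difference.\<close>

lemma ode_solution_unique:
  fixes f fz :: "real \<Rightarrow> real \<Rightarrow> real"
  assumes fz: "\<And>t z. t \<in> {a<..<b} \<Longrightarrow> (f t has_real_derivative fz t z) (at z)"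
    and cont: "continuous_on ({a..b} \<times> UNIV) (\<lambda>(t, z). fz t z)"
    and Y: "continuous_on {a..b} Y" "\<And>t. t \<in> {a<..<b} \<Longrightarrow> (Y has_real_derivative f t (Y t)) (at t)"
    and Z: "continuous_on {a..b} Z" "\<And>t. t \<in> {a<..<b} \<Longrightarrow> (Z has_real_derivative f t (Z t)) (at t)"
    and init: "Y a = Z a" and t: "t \<in> {a..b}"
  shows "Y t = Z t"
proof -
  obtain R1 R2 where "\<forall>t\<in>{a..b}. \<bar>Y t\<bar> \<le> R1" "\<forall>t\<in>{a..b}. \<bar>Z t\<bar> \<le> R2"
    using Y(1) Z(1) continuous_on_Icc_bounded by meson
  then have R: "\<bar>Y t\<bar> \<le> max R1 R2" "\<bar>Z t\<bar> \<le> max R1 R2" if "t \<in> {a..b}" for t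
    using that by (auto simp: le_max_iff_disj)
  define R where "R = max R1 R2"
  note R = R[folded R_def]
  have "compact ({a..b} \<times> {-R..R})"
    by (intro compact_Times) auto
  then have "compact ((\<lambda>(t, z). fz t z) ` ({a..b} \<times> {-R..R}))"
    by (rule compact_continuous_image[rotated]) (auto intro: continuous_on_subset[OF cont])
  then have "bounded ((\<lambda>(t, z). fz t z) ` ({a..b} \<times> {-R..R}))"
    by (rule compact_imp_bounded)
  then obtain K where "\<forall>x\<in>(\<lambda>(t, z). fz t z) ` ({a..b} \<times> {-R..R}). norm x \<le> K"
    unfolding bounded_iff by blast
  then have K: "\<bar>fz t z\<bar> \<le> K" if "t \<in> {a..b}" "z \<in> {-R..R}" for t z
    using that by (auto simp: image_iff)
  have K0: "0 \<le> K"
    using K[OF t, of "Y t"] R(1)[OF t] by fastforce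
  have "(Y t - Z t)\<^sup>2 \<le> exp ((2 * K + 1) * (b - a)) * ((Y a - Z a)\<^sup>2 + 0\<^sup>2 * (b - a))"
  proof (rule gronwall_square[OF K0 _ _ _ t])
    show "continuous_on {a..b} (\<lambda>t. Y t - Z t)"
      by (intro continuous_intros Y Z)
    fix r assume r: "r \<in> {a<..<b}"
    show "((\<lambda>t. Y t - Z t) has_real_derivative f r (Y r) - f r (Z r)) (at r)"
      by (intro DERIV_diff Y Z r)
    obtain x where x: "x \<in> closed_segment (Z r) (Y r)" "f r (Y r) - f r (Z r) = fz r x * (Y r - Z r)"
      using mvt_segment[of "Z r" "Y r" "f r" "fz r"] fz[OF r] by blast
    have "x \<in> {-R..R}"
      using x(1) R(1)[of r] R(2)[of r] r by (auto simp: closed_segment_eq_real_ivl split: if_splits)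
    then have "\<bar>fz r x\<bar> \<le> K"
      using K r by auto
    then show "\<bar>f r (Y r) - f r (Z r)\<bar> \<le> K * \<bar>Y r - Z r\<bar> + 0"
      unfolding x(2) abs_mult by (simp add: mult_right_mono)
  qed
  then show ?thesis
    by (simp add: init)
qed

text \<open>The difference quotient minus \<open>W\<close> satisfies a linear differential
  inequality whose error term tends to 0 uniformly in time, so Gronwall carries the convergence of
  the initial values over to time \<open>b\<close>. The initial value \<open>\<zeta> s\<close>
  varies with \<open>s\<close> because the second piece of a path starts from the varied end value
  of the first. The base solution \<open>Z0\<close> is tied to the equation only at interior times,
  in accordance with the impact.\<close>

lemma ode_differentiable_in_parameter:
  fixes g gs gz :: "real \<Rightarrow> real \<Rightarrow> real \<Rightarrow> real"
  assumes \<epsilon>: "0 < \<epsilon>" and ab: "a < b"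
    and cg: "continuous_on ({-\<epsilon><..<\<epsilon>} \<times> {a..b} \<times> UNIV) (\<lambda>(s, t, z). g s t z)"
    and cgs: "continuous_on ({-\<epsilon><..<\<epsilon>} \<times> {a..b} \<times> UNIV) (\<lambda>(s, t, z). gs s t z)"
    and cgz: "continuous_on ({-\<epsilon><..<\<epsilon>} \<times> {a..b} \<times> UNIV) (\<lambda>(s, t, z). gz s t z)"
    and gs: "\<And>s t z. s \<in> {-\<epsilon><..<\<epsilon>} \<Longrightarrow> t \<in> {a..b} \<Longrightarrow> ((\<lambda>s. g s t z) has_real_derivative gs s t z) (at s)"
    and gz: "\<And>s t z. s \<in> {-\<epsilon><..<\<epsilon>} \<Longrightarrow> t \<in> {a..b} \<Longrightarrow> (g s t has_real_derivative gz s t z) (at z)"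
    and Z0: "continuous_on {a..b} Z0" "\<And>t. t \<in> {a<..<b} \<Longrightarrow> (Z0 has_real_derivative g 0 t (Z0 t)) (at t)"
    and \<zeta>: "(\<zeta> has_real_derivative \<zeta>') (at 0)" "\<zeta> 0 = Z0 a"
  obtains r Z W where "0 < r" "r \<le> \<epsilon>"
    "\<And>s. s \<in> {-r<..<r} \<Longrightarrow> Z s a = \<zeta> s"
    "\<And>s t. s \<in> {-r<..<r} \<Longrightarrow> t \<in> {a..b} \<Longrightarrow> (Z s has_real_derivative g s t (Z s t)) (at t within {a..b})"
    "\<And>t. t \<in> {a..b} \<Longrightarrow> Z 0 t = Z0 t"
    "W a = \<zeta>'"
    "\<And>t. t \<in> {a..b} \<Longrightarrow>
       (W has_real_derivative gz 0 t (Z0 t) * W t + gs 0 t (Z0 t)) (at t within {a..b})"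
    "((\<lambda>s. Z s b) has_real_derivative W b) (at 0)"
proof -
  \<comment> \<open>Halving \<epsilon> leaves a compact parameter interval, so that \<open>Q\<close>
    below is compact and \<open>gs\<close> and \<open>gz\<close> are bounded and uniformly
    continuous on it.\<close>
  define h where "h = \<epsilon> / 2"
  have h: "0 < h" "h < \<epsilon>" "{-h..h} \<subseteq> {-\<epsilon><..<\<epsilon>}"
    using \<epsilon> by (auto simp: h_def)
  obtain B0 where B0: "\<And>t. t \<in> {a..b} \<Longrightarrow> \<bar>Z0 t\<bar> \<le> B0"
    using continuous_on_Icc_bounded[OF Z0(1)] by blast
  \<comment> \<open>The tube of radius 1 around \<open>Z0\<close> lies in the band
    \<open>{-B..B}\<close>.\<close>
  define B where "B = B0 + 1"
  define Q where "Q = {-h..h} \<times> {a..b} \<times> {-B..B}"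
  have cQ: "compact Q"
    unfolding Q_def by (intro compact_Times) auto
  have Q: "Q \<subseteq> {-\<epsilon><..<\<epsilon>} \<times> {a..b} \<times> UNIV"
    using h(3) by (auto simp: Q_def)
  have bnd: "\<exists>K>0. \<forall>s\<in>{-h..h}. \<forall>t\<in>{a..b}. \<forall>z\<in>{-B..B}. \<bar>u s t z\<bar> \<le> K"
    if "continuous_on ({-\<epsilon><..<\<epsilon>} \<times> {a..b} \<times> UNIV) (\<lambda>(s, t, z). u s t z)" for u :: "real \<Rightarrow> real \<Rightarrow> real \<Rightarrow> real"
  proof -
    have "compact ((\<lambda>(s, t, z). u s t z) ` Q)"
      by (intro compact_continuous_image cQ continuous_on_subset[OF that Q])
    then obtain K where "K > 0" "\<forall>x\<in>(\<lambda>(s, t, z). u s t z) ` Q. norm x \<le> K"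
      using compact_imp_bounded bounded_pos by meson
    then show ?thesis
      unfolding Q_def by (intro exI[of _ K]) auto
  qed
  obtain K where K: "K > 0" "\<And>s t z. s \<in> {-h..h} \<Longrightarrow> t \<in> {a..b} \<Longrightarrow> z \<in> {-B..B} \<Longrightarrow> \<bar>gz s t z\<bar> \<le> K"
    using bnd[OF cgz] by blast
  obtain M where M: "M > 0" "\<And>s t z. s \<in> {-h..h} \<Longrightarrow> t \<in> {a..b} \<Longrightarrow> z \<in> {-B..B} \<Longrightarrow> \<bar>gs s t z\<bar> \<le> M"
    using bnd[OF cgs] by blast
  \<comment> \<open>Clamping the unknown to a tube around \<open>Z0\<close> makes the right-hand side globally Lipschitz;
    for small \<open>s\<close> the solution stays in the tube, where the clamp is inactive.\<close>
  define cl where "cl t z = max (Z0 t - 1) (min (Z0 t + 1) z)" for t z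
  have cl: "\<bar>cl t z - Z0 t\<bar> \<le> \<bar>z - Z0 t\<bar>" "\<bar>cl t z - cl t z'\<bar> \<le> \<bar>z - z'\<bar>" for t z z'
    unfolding cl_def by auto
  have cl_id: "cl t z = z" if "\<bar>z - Z0 t\<bar> \<le> 1" for t z
    using that unfolding cl_def by auto
  have clB: "cl t z \<in> {-B..B}" if "t \<in> {a..b}" for t z
    using B0[OF that] unfolding cl_def B_def by auto
  have Z0B: "Z0 t \<in> {-B..B}" if "t \<in> {a..b}" for t
    using B0[OF that] unfolding B_def by auto
  have seg: "closed_segment x y \<subseteq> {-B..B}" if "x \<in> {-B..B}" "y \<in> {-B..B}" for x y
    using that by (auto simp: closed_segment_eq_real_ivl split: if_splits)
  have gz_diff: "\<exists>x\<in>closed_segment z z'. g s t z' - g s t z = gz s t x * (z' - z)"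
    if "s \<in> {-h..h}" "t \<in> {a..b}" for s t z z'
    by (rule mvt_segment) (use gz that h(3) in blast)
  have gz_lip: "\<bar>g s t z' - g s t z\<bar> \<le> K * \<bar>z' - z\<bar>"
    if st: "s \<in> {-h..h}" "t \<in> {a..b}" and z: "z \<in> {-B..B}" "z' \<in> {-B..B}" for s t z z'
  proof -
    obtain x where x: "x \<in> closed_segment z z'" "g s t z' - g s t z = gz s t x * (z' - z)"
      using gz_diff[OF st] by blast
    then have "\<bar>gz s t x\<bar> \<le> K"
      using K(2)[OF st] seg[OF z] by blast
    then show ?thesis
      unfolding x(2) abs_mult by (rule mult_right_mono) simp
  qed
  have gs_diff: "\<exists>x\<in>closed_segment 0 s. g s t z - g 0 t z = gs x t z * s"
    if "s \<in> {-h..h}" "t \<in> {a..b}" for s t z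
  proof -
    have "x \<in> {-\<epsilon><..<\<epsilon>}" if "x \<in> closed_segment 0 s" for x
      using that \<open>s \<in> {-h..h}\<close> h by (auto simp: closed_segment_eq_real_ivl split: if_splits)
    then show ?thesis
      using mvt_segment[of 0 s "\<lambda>s. g s t z" "\<lambda>s. gs s t z"] gs that(2) by simp
  qed
  have "\<exists>Z. Z a = \<zeta> s \<and> (\<forall>t\<in>{a..b}. (Z has_real_derivative g s t (cl t (Z t))) (at t within {a..b}))"
    if s: "s \<in> {-h..h}" for s
  proof (rule lipschitz_ode_solution_exists)
    have "continuous_on ({a..b} \<times> UNIV) (\<lambda>p. (\<lambda>(s, t, z). g s t z) (s, fst p, cl (fst p) (snd p)))"
      unfolding cl_def by (rule continuous_on_compose2[OF cg])
        (use s h in \<open>auto intro!: continuous_intros continuous_on_compose2[OF Z0(1)]\<close>)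
    then show "continuous_on ({a..b} \<times> UNIV) (\<lambda>(t, z). g s t (cl t z))"
      by (simp add: case_prod_unfold)
    show "\<bar>g s t (cl t z) - g s t (cl t z')\<bar> \<le> K * \<bar>z - z'\<bar>" if t: "t \<in> {a..b}" for t z z'
      using gz_lip[OF s t clB[OF t, of z'] clB[OF t, of z]] cl(2)[of t z z'] K(1)
      by (meson mult_left_mono order_trans less_imp_le)
  qed (use ab K in auto)
  then obtain Z where Za: "\<And>s. s \<in> {-h..h} \<Longrightarrow> Z s a = \<zeta> s"
    and Zd: "\<And>s t. s \<in> {-h..h} \<Longrightarrow> t \<in> {a..b} \<Longrightarrow>
      (Z s has_real_derivative g s t (cl t (Z s t))) (at t within {a..b})"
    by metis
  have inner: "at t within {a..b} = at t" if "t \<in> {a<..<b}" for t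
    using that by (intro at_within_interior) auto
  have cZ: "continuous_on {a..b} (Z s)" if "s \<in> {-h..h}" for s
    by (rule DERIV_continuous_on[OF Zd[OF that]])
  define C where "C = exp ((2 * K + 1) * (b - a))"
  have C: "C > 0"
    by (simp add: C_def)
  \<comment> \<open>The right-hand side at \<open>Z0\<close> changes by at most
    \<open>M * \<bar>s\<bar>\<close> when the parameter moves from 0 to \<open>s\<close>, so
    Gronwall bounds the distance by the change of the initial value and by \<open>s\<close>. This
    serves twice: for the distance 1 at which the clamp is inactive, and for the uniform convergence
    used in the difference quotient.\<close>
  have close: "(Z s t - Z0 t)\<^sup>2 \<le> C * ((\<zeta> s - \<zeta> 0)\<^sup>2 + (M * \<bar>s\<bar>)\<^sup>2 * (b - a))"
    if s: "s \<in> {-h..h}" and t: "t \<in> {a..b}" for s t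
  proof -
    have "(Z s t - Z0 t)\<^sup>2 \<le> C * ((Z s a - Z0 a)\<^sup>2 + (M * \<bar>s\<bar>)\<^sup>2 * (b - a))"
      unfolding C_def
    proof (rule gronwall_square[OF _ _ _ _ t])
      show "continuous_on {a..b} (\<lambda>t. Z s t - Z0 t)"
        by (intro continuous_intros cZ[OF s] Z0)
      fix r assume r: "r \<in> {a<..<b}"
      then have r': "r \<in> {a..b}" by auto
      show "((\<lambda>t. Z s t - Z0 t) has_real_derivative g s r (cl r (Z s r)) - g 0 r (Z0 r)) (at r)"
        using Zd[OF s r'] inner[OF r] by (intro DERIV_diff Z0 r) simp
      obtain x where x: "x \<in> closed_segment 0 s" "g s r (Z0 r) - g 0 r (Z0 r) = gs x r (Z0 r) * s"
        using gs_diff[OF s r'] by blast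
      have "x \<in> {-h..h}"
        using x(1) s h by (auto simp: closed_segment_eq_real_ivl split: if_splits)
      then have "\<bar>g s r (Z0 r) - g 0 r (Z0 r)\<bar> \<le> M * \<bar>s\<bar>"
        unfolding x(2) abs_mult using M(2)[OF _ r' Z0B[OF r']] by (intro mult_right_mono) auto
      moreover have "\<bar>g s r (cl r (Z s r)) - g s r (Z0 r)\<bar> \<le> K * \<bar>Z s r - Z0 r\<bar>"
        using gz_lip[OF s r' Z0B[OF r'] clB[OF r', of "Z s r"]] cl(1)[of r "Z s r"] K(1)
        by (meson mult_left_mono order_trans less_imp_le)
      ultimately show "\<bar>g s r (cl r (Z s r)) - g 0 r (Z0 r)\<bar> \<le> K * \<bar>Z s r - Z0 r\<bar> + M * \<bar>s\<bar>"
        by linarith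
    qed (use K in auto)
    then show ?thesis
      by (simp add: Za[OF s] \<zeta>(2))
  qed
  have cont\<zeta>: "(\<zeta> \<longlongrightarrow> \<zeta> 0) (at 0)"
    using DERIV_isCont[OF \<zeta>(1)] by (simp add: isCont_def)
  have lim: "((\<lambda>s. C * ((\<zeta> s - \<zeta> 0)\<^sup>2 + (M * \<bar>s\<bar>)\<^sup>2 * (b - a))) \<longlongrightarrow> 0) (at 0)"
    by (rule tendsto_eq_intros cont\<zeta> refl)+ simp
  have small: "\<exists>d>0. d \<le> h \<and> (\<forall>s\<in>{-d<..<d}. \<forall>t\<in>{a..b}. \<bar>Z s t - Z0 t\<bar> \<le> e)" if e: "e > 0" for e
  proof -
    have "eventually (\<lambda>s. C * ((\<zeta> s - \<zeta> 0)\<^sup>2 + (M * \<bar>s\<bar>)\<^sup>2 * (b - a)) < e\<^sup>2) (at 0)"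
      using order_tendstoD(2)[OF lim, of "e\<^sup>2"] e by simp
    then obtain d where d: "d > 0" "\<And>s. s \<noteq> 0 \<Longrightarrow> \<bar>s\<bar> < d \<Longrightarrow>
        C * ((\<zeta> s - \<zeta> 0)\<^sup>2 + (M * \<bar>s\<bar>)\<^sup>2 * (b - a)) < e\<^sup>2"
      unfolding eventually_at by (auto simp: dist_real_def)
    have "\<bar>Z s t - Z0 t\<bar> \<le> e" if s: "s \<in> {-min d h<..<min d h}" and t: "t \<in> {a..b}" for s t
    proof -
      have "(Z s t - Z0 t)\<^sup>2 \<le> e\<^sup>2"
      proof (cases "s = 0")
        case True
        then show ?thesis
          using close[OF _ t, of 0] h e by (simp add: power2_eq_square) (meson less_imp_le mult_nonneg_nonneg order_trans)
      next
        case False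
        have "(Z s t - Z0 t)\<^sup>2 \<le> C * ((\<zeta> s - \<zeta> 0)\<^sup>2 + (M * \<bar>s\<bar>)\<^sup>2 * (b - a))"
          using s t by (intro close) auto
        also have "\<dots> \<le> e\<^sup>2"
          using d(2)[OF False] s by (intro less_imp_le) auto
        finally show ?thesis .
      qed
      then show ?thesis
        using e by (simp add: abs_le_square_iff[symmetric])
    qed
    then show ?thesis
      using d h by (intro exI[of _ "min d h"]) auto
  qed
  obtain r where r: "r > 0" "r \<le> h" "\<And>s t. s \<in> {-r<..<r} \<Longrightarrow> t \<in> {a..b} \<Longrightarrow> \<bar>Z s t - Z0 t\<bar> \<le> 1"
    using small[of 1] by auto
  have rh: "s \<in> {-h..h}" if "s \<in> {-r<..<r}" for s
    using that r by auto
  have Zd': "(Z s has_real_derivative g s t (Z s t)) (at t within {a..b})"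
    if "s \<in> {-r<..<r}" "t \<in> {a..b}" for s t
    using Zd[OF rh[OF that(1)] that(2)] cl_id[OF r(3)[OF that]] by simp
  have Z00: "Z 0 t = Z0 t" if t: "t \<in> {a..b}" for t
    using close[OF _ t, of 0] h by simp
  \<comment> \<open>The linearised equation is globally Lipschitz with the bound \<open>K\<close> of
    \<open>gz\<close> as constant, so it has a solution on all of \<open>{a..b}\<close>.\<close>
  have "\<exists>W. W a = \<zeta>' \<and> (\<forall>t\<in>{a..b}. (W has_real_derivative gz 0 t (Z0 t) * W t + gs 0 t (Z0 t)) (at t within {a..b}))"
  proof (rule lipschitz_ode_solution_exists)
    have "continuous_on {a..b} (\<lambda>t. (\<lambda>(s, t, z). gz s t z) (0, t, Z0 t))"
      by (rule continuous_on_compose2[OF cgz]) (use \<epsilon> in \<open>auto intro!: continuous_intros Z0\<close>)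
    moreover have "continuous_on {a..b} (\<lambda>t. (\<lambda>(s, t, z). gs s t z) (0, t, Z0 t))"
      by (rule continuous_on_compose2[OF cgs]) (use \<epsilon> in \<open>auto intro!: continuous_intros Z0\<close>)
    ultimately have c: "continuous_on {a..b} (\<lambda>t. gz 0 t (Z0 t))" "continuous_on {a..b} (\<lambda>t. gs 0 t (Z0 t))"
      by auto
    show "continuous_on ({a..b} \<times> UNIV) (\<lambda>(t, z). gz 0 t (Z0 t) * z + gs 0 t (Z0 t))"
      unfolding case_prod_unfold
      by (intro continuous_intros continuous_on_compose2[OF c(1)] continuous_on_compose2[OF c(2)]) auto
    show "\<bar>(gz 0 t (Z0 t) * z + gs 0 t (Z0 t)) - (gz 0 t (Z0 t) * z' + gs 0 t (Z0 t))\<bar> \<le> K * \<bar>z - z'\<bar>"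
      if t: "t \<in> {a..b}" for t z z'
    proof -
      have "\<bar>gz 0 t (Z0 t)\<bar> * \<bar>z - z'\<bar> \<le> K * \<bar>z - z'\<bar>"
        using K(2)[OF _ t Z0B[OF t]] h by (intro mult_right_mono) auto
      then show ?thesis
        by (simp add: right_diff_distrib[symmetric] abs_mult)
    qed
  qed (use ab K in auto)
  then obtain W where Wa: "W a = \<zeta>'" and Wd: "\<And>t. t \<in> {a..b} \<Longrightarrow>
      (W has_real_derivative gz 0 t (Z0 t) * W t + gs 0 t (Z0 t)) (at t within {a..b})"
    by blast
  have cW: "continuous_on {a..b} W"
    by (rule DERIV_continuous_on[OF Wd])
  obtain N where N: "\<And>t. t \<in> {a..b} \<Longrightarrow> \<bar>W t\<bar> \<le> N"
    using continuous_on_Icc_bounded[OF cW] by blast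
  have N0: "0 \<le> N"
    using N[of a] ab by auto
  have unif: "\<exists>d>0. \<forall>s\<in>{-h..h}. \<forall>t\<in>{a..b}. \<forall>z\<in>{-B..B}. \<bar>s\<bar> < d \<longrightarrow> \<bar>z - Z0 t\<bar> < d \<longrightarrow> \<bar>u s t z - u 0 t (Z0 t)\<bar> \<le> e"
    if u: "continuous_on ({-\<epsilon><..<\<epsilon>} \<times> {a..b} \<times> UNIV) (\<lambda>(s, t, z). u s t z)" and e: "e > 0"
    for u :: "real \<Rightarrow> real \<Rightarrow> real \<Rightarrow> real" and e
  proof -
    have "uniformly_continuous_on Q (\<lambda>(s, t, z). u s t z)"
      by (intro compact_uniformly_continuous continuous_on_subset[OF u Q] cQ)
    then obtain d where d: "d > 0" "\<And>p q. p \<in> Q \<Longrightarrow> q \<in> Q \<Longrightarrow> dist q p < d \<Longrightarrow>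
        dist ((\<lambda>(s, t, z). u s t z) q) ((\<lambda>(s, t, z). u s t z) p) < e"
      using e unfolding uniformly_continuous_on_def by metis
    have "\<bar>u s t z - u 0 t (Z0 t)\<bar> \<le> e"
      if "s \<in> {-h..h}" "t \<in> {a..b}" "z \<in> {-B..B}" "\<bar>s\<bar> < d / 2" "\<bar>z - Z0 t\<bar> < d / 2" for s t z
    proof -
      have "dist (s, t, z) (0, t, Z0 t) = sqrt (\<bar>s\<bar>\<^sup>2 + \<bar>z - Z0 t\<bar>\<^sup>2)"
        by (simp add: dist_Pair_Pair dist_real_def)
      also have "\<dots> \<le> \<bar>s\<bar> + \<bar>z - Z0 t\<bar>"
        by (rule sqrt_sum_squares_le_sum) auto
      finally have "dist (s, t, z) (0, t, Z0 t) < d"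
        using that by simp
      then show ?thesis
        using d(2)[of "(0, t, Z0 t)" "(s, t, z)"] that Z0B h by (auto simp: Q_def dist_real_def)
    qed
    then show ?thesis
      using d(1) by (intro exI[of _ "d / 2"]) auto
  qed
  have lim2: "((\<lambda>s. (Z s b - Z0 b) / s - W b) \<longlongrightarrow> 0) (at 0)"
  proof (rule tendstoI)
    fix e :: real assume e: "e > 0"
    \<comment> \<open>\<eta> will bound the oscillation of \<open>gs\<close> and \<open>gz\<close>.
      Its value is solved from the Gronwall bound: twice the contribution of the error stays below
      \<open>e\<^sup>2\<close>, leaving the other half to the initial values. The \<open>1 +\<close>
      makes the denominator positive and the inequality strict.\<close>
    define \<eta> where "\<eta> = e / (1 + sqrt (2 * C * (1 + N)\<^sup>2 * (b - a)))"
    have den: "0 < 1 + sqrt (2 * C * (1 + N)\<^sup>2 * (b - a))"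
      using C ab by (intro add_pos_nonneg) auto
    have \<eta>: "\<eta> > 0"
      using e den by (simp add: \<eta>_def)
    have \<eta>2: "2 * (C * ((\<eta> * (1 + N))\<^sup>2 * (b - a))) < e\<^sup>2"
    proof -
      define w where "w = sqrt (2 * C * (1 + N)\<^sup>2 * (b - a))"
      have w: "0 \<le> w" "w\<^sup>2 = 2 * C * (1 + N)\<^sup>2 * (b - a)"
        using C ab by (auto simp: w_def)
      have "2 * (C * ((\<eta> * (1 + N))\<^sup>2 * (b - a))) = (\<eta> * w)\<^sup>2"
        by (simp add: power_mult_distrib w(2))
      also have "\<dots> < (\<eta> * (1 + w))\<^sup>2"
        using \<eta> w by (intro power_strict_mono mult_strict_left_mono mult_nonneg_nonneg) auto
      also have "\<eta> * (1 + w) = e"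
        using den by (simp add: \<eta>_def w_def)
      finally show ?thesis .
    qed
    obtain d1 where d1: "d1 > 0" "\<And>s t z. s \<in> {-h..h} \<Longrightarrow> t \<in> {a..b} \<Longrightarrow> z \<in> {-B..B} \<Longrightarrow>
        \<bar>s\<bar> < d1 \<Longrightarrow> \<bar>z - Z0 t\<bar> < d1 \<Longrightarrow> \<bar>gs s t z - gs 0 t (Z0 t)\<bar> \<le> \<eta>"
      using unif[OF cgs \<eta>] by blast
    obtain d2 where d2: "d2 > 0" "\<And>s t z. s \<in> {-h..h} \<Longrightarrow> t \<in> {a..b} \<Longrightarrow> z \<in> {-B..B} \<Longrightarrow>
        \<bar>s\<bar> < d2 \<Longrightarrow> \<bar>z - Z0 t\<bar> < d2 \<Longrightarrow> \<bar>gz s t z - gz 0 t (Z0 t)\<bar> \<le> \<eta>"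
      using unif[OF cgz \<eta>] by blast
    obtain d3 where d3: "d3 > 0" "\<And>s t. s \<in> {-d3<..<d3} \<Longrightarrow> t \<in> {a..b} \<Longrightarrow> \<bar>Z s t - Z0 t\<bar> \<le> d2 / 2"
      using small[of "d2 / 2"] d2(1) by auto
    have key: "((Z s b - Z0 b) / s - W b)\<^sup>2 \<le>
        C * (((\<zeta> s - \<zeta> 0) / s - \<zeta>')\<^sup>2 + (\<eta> * (1 + N))\<^sup>2 * (b - a))"
      if s: "s \<noteq> 0" "\<bar>s\<bar> < r" "\<bar>s\<bar> < d1" "\<bar>s\<bar> < d2" "\<bar>s\<bar> < d3" for s
    proof -
      have sr: "s \<in> {-r<..<r}" and sh: "s \<in> {-h..h}" and sd3: "s \<in> {-d3<..<d3}"
        using s r by auto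
      have "((Z s b - Z0 b) / s - W b)\<^sup>2 \<le>
          C * (((Z s a - Z0 a) / s - W a)\<^sup>2 + (\<eta> * (1 + N))\<^sup>2 * (b - a))"
        unfolding C_def
      proof (rule gronwall_square[where D = "\<lambda>t. (Z s t - Z0 t) / s - W t"])
        show "continuous_on {a..b} (\<lambda>t. (Z s t - Z0 t) / s - W t)"
          using s by (intro continuous_intros cZ[OF sh] Z0 cW) auto
        fix t assume t: "t \<in> {a<..<b}"
        then have t': "t \<in> {a..b}" by auto
        let ?D' = "(g s t (Z s t) - g 0 t (Z0 t)) / s - (gz 0 t (Z0 t) * W t + gs 0 t (Z0 t))"
        show "((\<lambda>t. (Z s t - Z0 t) / s - W t) has_real_derivative ?D') (at t)"
          using Zd'[OF sr t'] Wd[OF t'] inner[OF t] by (intro DERIV_diff DERIV_cdivide Z0 t) auto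
        have ZB: "Z s t \<in> {-B..B}"
          using clB[OF t', of "Z s t"] cl_id[OF r(3)[OF sr t']] by simp
        obtain x where x: "x \<in> closed_segment 0 s" "g s t (Z0 t) - g 0 t (Z0 t) = gs x t (Z0 t) * s"
          using gs_diff[OF sh t'] by blast
        obtain y where y: "y \<in> closed_segment (Z0 t) (Z s t)" "g s t (Z s t) - g s t (Z0 t) = gz s t y * (Z s t - Z0 t)"
          using gz_diff[OF sh t'] by blast
        have yB: "y \<in> {-B..B}"
          using seg[OF Z0B[OF t'] ZB] y(1) by blast
        have xh: "x \<in> {-h..h}" "\<bar>x\<bar> < d1"
          using x(1) sh s h by (auto simp: closed_segment_eq_real_ivl split: if_splits)
        have "\<bar>y - Z0 t\<bar> \<le> \<bar>Z s t - Z0 t\<bar>"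
          using y(1) by (auto simp: closed_segment_eq_real_ivl split: if_splits)
        also have "\<dots> < d2"
          using d3(2)[OF sd3 t'] d2(1) by linarith
        finally have yd: "\<bar>y - Z0 t\<bar> < d2" .
        have e1: "\<bar>gs x t (Z0 t) - gs 0 t (Z0 t)\<bar> \<le> \<eta>"
          using d1 xh t' Z0B[OF t'] by auto
        have e2: "\<bar>gz s t y - gz 0 t (Z0 t)\<bar> \<le> \<eta>"
          using d2 sh t' yB yd s by auto
        \<comment> \<open>A mean value in \<open>s\<close> at fixed \<open>Z0 t\<close> and one in
          \<open>z\<close> at fixed \<open>s\<close> split the derivative into errors of size at
          most \<eta> and \<open>\<eta> * N\<close>, and a multiple, with factor at most
          \<open>K\<close>, of the function that is being estimated.\<close>
        have D'_eq: "?D' = (gs x t (Z0 t) - gs 0 t (Z0 t)) + (gz s t y - gz 0 t (Z0 t)) * W t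
            + gz s t y * ((Z s t - Z0 t) / s - W t)"
        proof -
          have "(g s t (Z s t) - g 0 t (Z0 t)) / s = gs x t (Z0 t) + gz s t y * ((Z s t - Z0 t) / s)"
            using x(2) y(2) s(1) by (simp add: field_simps)
          then show ?thesis
            by (simp add: algebra_simps)
        qed
        have "\<bar>?D'\<bar> \<le> \<bar>gs x t (Z0 t) - gs 0 t (Z0 t)\<bar> + \<bar>gz s t y - gz 0 t (Z0 t)\<bar> * \<bar>W t\<bar>
            + \<bar>gz s t y\<bar> * \<bar>(Z s t - Z0 t) / s - W t\<bar>"
          unfolding abs_mult[symmetric] D'_eq by linarith
        also have "\<dots> \<le> \<eta> + \<eta> * N + K * \<bar>(Z s t - Z0 t) / s - W t\<bar>"
          using e1 e2 N[OF t'] K(2)[OF sh t' yB] \<eta> by (intro add_mono mult_mono) auto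
        finally show "\<bar>?D'\<bar> \<le> K * \<bar>(Z s t - Z0 t) / s - W t\<bar> + \<eta> * (1 + N)"
          by (simp add: algebra_simps)
      qed (use K ab in auto)
      then show ?thesis
        by (simp add: Za[OF sh] \<zeta>(2) Wa)
    qed
    have "((\<lambda>s. (\<zeta> s - \<zeta> 0) / s) \<longlongrightarrow> \<zeta>') (at 0)"
      using \<zeta>(1) by (simp add: has_field_derivative_iff)
    then have "((\<lambda>s. 2 * (C * ((\<zeta> s - \<zeta> 0) / s - \<zeta>')\<^sup>2)) \<longlongrightarrow> 2 * (C * (\<zeta>' - \<zeta>')\<^sup>2)) (at 0)"
      by (intro tendsto_intros)
    then have "eventually (\<lambda>s. 2 * (C * ((\<zeta> s - \<zeta> 0) / s - \<zeta>')\<^sup>2) < e\<^sup>2) (at 0)"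
      using e by (intro order_tendstoD(2)) auto
    moreover have "eventually (\<lambda>s. \<bar>s\<bar> < min (min r d1) (min d2 d3) \<and> s \<noteq> 0) (at (0::real))"
      unfolding eventually_at using r(1) d1(1) d2(1) d3(1)
      by (intro exI[of _ "min (min r d1) (min d2 d3)"]) (auto simp: dist_real_def)
    ultimately show "eventually (\<lambda>s. dist ((Z s b - Z0 b) / s - W b) 0 < e) (at 0)"
    proof eventually_elim
      case (elim s)
      have "((Z s b - Z0 b) / s - W b)\<^sup>2 \<le>
          C * (((\<zeta> s - \<zeta> 0) / s - \<zeta>')\<^sup>2 + (\<eta> * (1 + N))\<^sup>2 * (b - a))"
        using elim(2) by (intro key) auto
      also have "\<dots> = C * ((\<zeta> s - \<zeta> 0) / s - \<zeta>')\<^sup>2 + C * ((\<eta> * (1 + N))\<^sup>2 * (b - a))"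
        by (rule distrib_left)
      also have "\<dots> < e\<^sup>2"
        using elim(1) \<eta>2 by linarith
      finally have "\<bar>(Z s b - Z0 b) / s - W b\<bar>\<^sup>2 < e\<^sup>2"
        by simp
      then have "\<bar>(Z s b - Z0 b) / s - W b\<bar> < e"
        by (rule power_less_imp_less_base) (use e in simp)
      then show ?case
        by (simp add: dist_real_def)
    qed
  qed
  have "((\<lambda>s. (Z s b - Z 0 b) / (s - 0)) \<longlongrightarrow> W b) (at 0)"
    using LIM_zero_cancel[OF lim2] Z00[of b] ab by simp
  then have "((\<lambda>s. Z s b) has_real_derivative W b) (at 0)"
    by (simp add: has_field_derivative_iff)
  then show thesis
    using that[of r Z W] r h Za rh Zd' Z00 Wa Wd by simp
qed

section \<open>Tangent vectors in charts\<close>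

abbreviation transition_deriv :: "('q, 'n::finite) chart \<Rightarrow> ('q, 'n) chart \<Rightarrow> real ^ 'n \<Rightarrow> real ^ 'n \<Rightarrow> real ^ 'n" where
  "transition_deriv \<phi> \<psi> x \<equiv> frechet_derivative (snd \<psi> \<circ> chart_inv \<phi>) (at x)"

locale smooth_mfd =
  fixes A :: "('q::{t2_space, second_countable_topology}, 'n::finite) chart set"
  assumes atlas: "smooth_structure A"
begin

lemma chart:
  assumes "\<phi> \<in> A"
  shows "open (fst \<phi>)" "open (snd \<phi> ` fst \<phi>)"
    "homeomorphism (fst \<phi>) (snd \<phi> ` fst \<phi>) (snd \<phi>) (chart_inv \<phi>)"
  using assms atlas by (auto simp: smooth_structure_def is_chart_def)

lemma chart_inv_chart [simp]: "\<phi> \<in> A \<Longrightarrow> p \<in> fst \<phi> \<Longrightarrow> chart_inv \<phi> (snd \<phi> p) = p"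
  using chart(3) by (blast intro: homeomorphism_apply1)

lemma chart_chart_inv:
  assumes "\<phi> \<in> A" "x \<in> snd \<phi> ` fst \<phi>"
  shows "snd \<phi> (chart_inv \<phi> x) = x" "chart_inv \<phi> x \<in> fst \<phi>"
  using assms by auto

lemma continuous_on_chart: "\<phi> \<in> A \<Longrightarrow> continuous_on (fst \<phi>) (snd \<phi>)"
  using chart(3) by (simp add: homeomorphism_def)

lemma continuous_on_chart_inv: "\<phi> \<in> A \<Longrightarrow> continuous_on (snd \<phi> ` fst \<phi>) (chart_inv \<phi>)"
  using chart(3) by (simp add: homeomorphism_def)

lemma chart_cover: "\<exists>\<phi>\<in>A. p \<in> fst \<phi>"
  using atlas unfolding smooth_structure_def by blast

lemma open_overlap:
  assumes "\<phi> \<in> A" "\<psi> \<in> A"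
  shows "open (snd \<phi> ` (fst \<phi> \<inter> fst \<psi>))"
proof -
  have "openin (top_of_set (fst \<phi>)) (fst \<phi> \<inter> fst \<psi>)"
    using chart(1)[OF assms(2)] by (simp add: openin_open_Int)
  then have "openin (top_of_set (snd \<phi> ` fst \<phi>)) (snd \<phi> ` (fst \<phi> \<inter> fst \<psi>))"
    using homeomorphism_imp_open_map[OF chart(3)[OF assms(1)]] by blast
  then show ?thesis
    using chart(2)[OF assms(1)] openin_open_trans by blast
qed

lemma Ck_on_transition:
  assumes "\<phi> \<in> A" "\<psi> \<in> A"
  shows "Ck_on k (snd \<psi> \<circ> chart_inv \<phi>) (snd \<phi> ` (fst \<phi> \<inter> fst \<psi>))"
  using assms atlas unfolding smooth_structure_def compatible_def smooth_on_def by blast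

lemma transition_has_derivative:
  assumes "\<phi> \<in> A" "\<psi> \<in> A" "p \<in> fst \<phi>" "p \<in> fst \<psi>"
  shows "(snd \<psi> \<circ> chart_inv \<phi> has_derivative transition_deriv \<phi> \<psi> (snd \<phi> p)) (at (snd \<phi> p))"
  using Ck_on_open_has_derivative[OF Ck_on_transition open_overlap] assms by blast

lemma linear_transition_deriv:
  assumes "\<phi> \<in> A" "\<psi> \<in> A" "p \<in> fst \<phi>" "p \<in> fst \<psi>"
  shows "linear (transition_deriv \<phi> \<psi> (snd \<phi> p))"
  using transition_has_derivative[OF assms] by (rule has_derivative_linear)

text \<open>A coordinate map is arbitrary off its domain, so continuity at \<open>t\<close> has to
  keep the curve in the domain of \<phi> near \<open>t\<close> before the chain rule can be applied
  to the transition map.\<close>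

lemma chart_curve_change:
  fixes \<gamma> :: "real \<Rightarrow> 'q"
  assumes cont: "continuous (at t within I) \<gamma>" and t: "t \<in> I"
    and \<phi>: "\<phi> \<in> A" "\<gamma> t \<in> fst \<phi>" and \<psi>: "\<psi> \<in> A" "\<gamma> t \<in> fst \<psi>"
    and der: "(snd \<phi> \<circ> \<gamma> has_vector_derivative v) (at t within I)"
  shows "(snd \<psi> \<circ> \<gamma> has_vector_derivative transition_deriv \<phi> \<psi> (snd \<phi> (\<gamma> t)) v) (at t within I)"
proof -
  let ?J = "transition_deriv \<phi> \<psi> (snd \<phi> (\<gamma> t))"
  have "open (fst \<phi>)" using chart(1)[OF \<phi>(1)] .
  then have "eventually (\<lambda>t'. \<gamma> t' \<in> fst \<phi>) (at t within I)"
    using cont \<phi>(2) topological_tendstoD unfolding continuous_within by blast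
  then obtain d where d: "d > 0" "\<And>t'. t' \<in> I \<Longrightarrow> dist t' t < d \<Longrightarrow> \<gamma> t' \<in> fst \<phi>"
    unfolding eventually_at using \<phi>(2) by metis
  have lin: "linear ?J"
    by (rule linear_transition_deriv) (use \<phi> \<psi> in auto)
  have "((snd \<psi> \<circ> chart_inv \<phi>) \<circ> (snd \<phi> \<circ> \<gamma>) has_derivative ?J \<circ> (\<lambda>h. h *\<^sub>R v)) (at t within I)"
    using der transition_has_derivative[OF \<phi>(1) \<psi>(1) \<phi>(2) \<psi>(2)]
    unfolding has_vector_derivative_def
    by (intro diff_chain_within) (auto intro: has_derivative_at_withinI)
  then have "(snd \<psi> \<circ> \<gamma> has_derivative ?J \<circ> (\<lambda>h. h *\<^sub>R v)) (at t within I)"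
    by (rule has_derivative_transform_within[OF _ d(1) t]) (use d(2) \<phi>(1) in auto)
  moreover have "?J \<circ> (\<lambda>h. h *\<^sub>R v) = (\<lambda>h. h *\<^sub>R ?J v)"
    using linear_scale[OF lin] by (intro ext) simp
  ultimately show ?thesis
    unfolding has_vector_derivative_def by simp
qed

text \<open>\<open>velocity\<close> lists the components in all charts; by
  \<open>chart_curve_change\<close> those in one chart determine the others. Through this identity
  computations with velocities are moved into a single chart.\<close>

lemma velocity_eq_tvec_of:
  fixes \<gamma> :: "real \<Rightarrow> 'q"
  assumes cont: "continuous (at t within I) \<gamma>" and t: "t \<in> I" and nb: "at t within I \<noteq> bot"
    and \<phi>: "\<phi> \<in> A" "\<gamma> t \<in> fst \<phi>"
    and der: "(snd \<phi> \<circ> \<gamma> has_vector_derivative v) (at t within I)"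
  shows "velocity A \<gamma> I t = tvec_of A \<phi> (snd \<phi> (\<gamma> t)) v"
proof -
  have "vector_derivative (snd \<psi> \<circ> \<gamma>) (at t within I) = transition_deriv \<phi> \<psi> (snd \<phi> (\<gamma> t)) v"
    if "\<psi> \<in> A" "\<gamma> t \<in> fst \<psi>" for \<psi>
    using vector_derivative_within[OF nb chart_curve_change[OF cont t \<phi> that der]] .
  then have "(if \<psi> \<in> A \<and> \<gamma> t \<in> fst \<psi> then vector_derivative (snd \<psi> \<circ> \<gamma>) (at t within I) else 0) =
      (if \<psi> \<in> A \<and> \<gamma> t \<in> fst \<psi> then transition_deriv \<phi> \<psi> (snd \<phi> (\<gamma> t)) v else 0)" for \<psi>
    by presburger
  then show ?thesis
    unfolding velocity_def tvec_of_def Let_def chart_inv_chart[OF \<phi>] by simp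
qed

lemma velocity_in_tangent_bundle:
  fixes \<gamma> :: "real \<Rightarrow> 'q"
  assumes cont: "continuous (at t within I) \<gamma>" and t: "t \<in> I" and nb: "at t within I \<noteq> bot"
    and \<phi>: "\<phi> \<in> A" "\<gamma> t \<in> fst \<phi>"
    and der: "(snd \<phi> \<circ> \<gamma> has_vector_derivative v) (at t within I)"
  shows "velocity A \<gamma> I t \<in> tangent_bundle A"
proof -
  have d: "(snd \<psi> \<circ> \<gamma> has_vector_derivative vector_derivative (snd \<psi> \<circ> \<gamma>) (at t within I)) (at t within I)"
    if "\<psi> \<in> A" "\<gamma> t \<in> fst \<psi>" for \<psi>
    using chart_curve_change[OF cont t \<phi> that der] vector_derivative_within[OF nb] by metis
  have e: "vector_derivative (snd \<theta> \<circ> \<gamma>) (at t within I) =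
      transition_deriv \<psi> \<theta> (snd \<psi> (\<gamma> t)) (vector_derivative (snd \<psi> \<circ> \<gamma>) (at t within I))"
    if "\<psi> \<in> A" "\<gamma> t \<in> fst \<psi>" "\<theta> \<in> A" "\<gamma> t \<in> fst \<theta>" for \<psi> \<theta>
    by (rule vector_derivative_within[OF nb chart_curve_change[OF cont t that d[OF that(1,2)]]])
  have h: "(if \<theta> \<in> A \<and> \<gamma> t \<in> fst \<theta> then vector_derivative (snd \<theta> \<circ> \<gamma>) (at t within I) else 0) =
      transition_deriv \<psi> \<theta> (snd \<psi> (\<gamma> t))
        (if \<psi> \<in> A \<and> \<gamma> t \<in> fst \<psi> then vector_derivative (snd \<psi> \<circ> \<gamma>) (at t within I) else 0)"
    if "\<psi> \<in> A" "\<theta> \<in> A" "\<gamma> t \<in> fst \<psi> \<inter> fst \<theta>" for \<psi> \<theta>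
  proof -
    have m: "\<gamma> t \<in> fst \<psi>" "\<gamma> t \<in> fst \<theta>"
      using that(3) by blast+
    show ?thesis
      unfolding if_P[OF conjI[OF that(1) m(1)]] if_P[OF conjI[OF that(2) m(2)]]
      by (rule e[OF that(1) m(1) that(2) m(2)])
  qed
  show ?thesis
    unfolding velocity_def tangent_bundle_def mem_Collect_eq case_prod_conv
  proof (rule conjI)
    show "\<forall>\<psi>. \<not> (\<psi> \<in> A \<and> \<gamma> t \<in> fst \<psi>) \<longrightarrow>
        (if \<psi> \<in> A \<and> \<gamma> t \<in> fst \<psi> then vector_derivative (snd \<psi> \<circ> \<gamma>) (at t within I) else 0) = 0"
      by (intro allI impI) (rule if_not_P)
  qed (intro ballI impI h)
qed

lemma tangent_vector_eq_tvec_of: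
  assumes "w \<in> tangent_bundle A" "\<phi> \<in> A" "fst w \<in> fst \<phi>"
  shows "w = tvec_of A \<phi> (snd \<phi> (fst w)) (snd w \<phi>)"
proof (rule prod_eqI)
  obtain p v where w: "w = (p, v)"
    by (rule prod.exhaust)
  have p\<phi>: "p \<in> fst \<phi>"
    using assms(3) unfolding w fst_conv .
  have p: "chart_inv \<phi> (snd \<phi> p) = p"
    by (rule chart_inv_chart[OF assms(2) p\<phi>])
  have "v \<psi> = (if \<psi> \<in> A \<and> p \<in> fst \<psi> then transition_deriv \<phi> \<psi> (snd \<phi> p) (v \<phi>) else 0)" for \<psi>
  proof (cases "\<psi> \<in> A \<and> p \<in> fst \<psi>")
    case True
    have "\<forall>\<phi>\<in>A. \<forall>\<psi>\<in>A. p \<in> fst \<phi> \<inter> fst \<psi> \<longrightarrow> v \<psi> = transition_deriv \<phi> \<psi> (snd \<phi> p) (v \<phi>)"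
      using assms(1) unfolding w tangent_bundle_def mem_Collect_eq case_prod_conv by (rule conjunct2)
    then have "v \<psi> = transition_deriv \<phi> \<psi> (snd \<phi> p) (v \<phi>)"
      using True assms(2) p\<phi> by blast
    then show ?thesis
      using True by presburger
  next
    case False
    have "\<forall>\<phi>. \<not> (\<phi> \<in> A \<and> p \<in> fst \<phi>) \<longrightarrow> v \<phi> = 0"
      using assms(1) unfolding w tangent_bundle_def mem_Collect_eq case_prod_conv by (rule conjunct1)
    then show ?thesis
      using False by presburger
  qed
  then show "snd w = snd (tvec_of A \<phi> (snd \<phi> (fst w)) (snd w \<phi>))"
    unfolding w tvec_of_def Let_def fst_conv snd_conv p by (rule ext)
  show "fst w = fst (tvec_of A \<phi> (snd \<phi> (fst w)) (snd w \<phi>))"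
    unfolding w tvec_of_def Let_def fst_conv p ..
qed

lemma zero_in_tangent_bundle: "(p, \<lambda>_. 0) \<in> tangent_bundle A"
  unfolding tangent_bundle_def using linear_0[OF linear_transition_deriv] by auto

lemma tvec_of_add_scale:
  assumes \<phi>: "\<phi> \<in> A" and x: "x \<in> snd \<phi> ` fst \<phi>"
  shows "(fst (tvec_of A \<phi> x y), \<lambda>\<psi>. snd (tvec_of A \<phi> x y) \<psi> + r *\<^sub>R snd (tvec_of A \<phi> x y') \<psi>) =
    tvec_of A \<phi> x (y + r *\<^sub>R y')"
proof -
  have "linear (transition_deriv \<phi> \<psi> x)" if "\<psi> \<in> A" "chart_inv \<phi> x \<in> fst \<psi>" for \<psi>
    using linear_transition_deriv[OF \<phi> that(1), of "chart_inv \<phi> x"] that chart_chart_inv[OF \<phi> x] by simp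
  then have "(if \<psi> \<in> A \<and> chart_inv \<phi> x \<in> fst \<psi> then transition_deriv \<phi> \<psi> x y else 0) +
      r *\<^sub>R (if \<psi> \<in> A \<and> chart_inv \<phi> x \<in> fst \<psi> then transition_deriv \<phi> \<psi> x y' else 0) =
      (if \<psi> \<in> A \<and> chart_inv \<phi> x \<in> fst \<psi> then transition_deriv \<phi> \<psi> x (y + r *\<^sub>R y') else 0)" for \<psi>
    by (cases "\<psi> \<in> A \<and> chart_inv \<phi> x \<in> fst \<psi>") (simp_all only: linear_add linear_scale if_True if_False simp_thms add_0 scaleR_zero_right)
  then show ?thesis
    by (simp add: tvec_of_def Let_def)
qed

lemma tscale_tvec_of:
  assumes \<phi>: "\<phi> \<in> A" and x: "x \<in> snd \<phi> ` fst \<phi>"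
  shows "tscale r (tvec_of A \<phi> x y) = tvec_of A \<phi> x (r *\<^sub>R y)"
proof -
  have "linear (transition_deriv \<phi> \<psi> x)" if "\<psi> \<in> A" "chart_inv \<phi> x \<in> fst \<psi>" for \<psi>
    using linear_transition_deriv[OF \<phi> that(1), of "chart_inv \<phi> x"] that chart_chart_inv[OF \<phi> x] by simp
  then have "r *\<^sub>R (if \<psi> \<in> A \<and> chart_inv \<phi> x \<in> fst \<psi> then transition_deriv \<phi> \<psi> x y else 0) =
      (if \<psi> \<in> A \<and> chart_inv \<phi> x \<in> fst \<psi> then transition_deriv \<phi> \<psi> x (r *\<^sub>R y) else 0)" for \<psi>
    by (cases "\<psi> \<in> A \<and> chart_inv \<phi> x \<in> fst \<psi>") (simp_all only: linear_scale if_True if_False simp_thms add_0 scaleR_zero_right)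
  then show ?thesis
    by (simp add: tvec_of_def tscale_def Let_def)
qed

lemma openin_chart_preimage:
  assumes "continuous_on S f" "\<phi> \<in> A"
  shows "openin (top_of_set S) (S \<inter> f -` fst \<phi>)"
  using continuous_openin_preimage_gen[OF assms(1) chart(1)[OF assms(2)]] .

end

section \<open>Fibre derivatives of the Lagrangian\<close>

text \<open>
  Momentum and energy are expressed through this chart-free derivative, so that they can be compared
  along the whole path although every computation takes place in a single chart.
\<close>

definition fibre_deriv ::
  "(('q, 'n::finite) tvec \<times> real \<Rightarrow> real) \<Rightarrow> ('q, 'n) tvec \<Rightarrow> ('q, 'n) tvec \<Rightarrow> real \<Rightarrow> real" where
  "fibre_deriv L w w' z = deriv (\<lambda>r. L ((fst w, \<lambda>\<psi>. snd w \<psi> + r *\<^sub>R snd w' \<psi>), z)) 0"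

lemma vec_eq_sum_axis: "(v :: real ^ 'n) = (\<Sum>j\<in>UNIV. v $ j *\<^sub>R axis j 1)"
  by (simp add: vec_eq_iff axis_def if_distrib cong: if_cong)

lemma linear_vec_expansion:
  fixes D :: "real ^ 'n \<Rightarrow> real"
  assumes "linear D"
  shows "D v = (\<Sum>j\<in>UNIV. D (axis j 1) * v $ j)"
proof -
  have "D v = D (\<Sum>j\<in>UNIV. v $ j *\<^sub>R axis j 1)"
    using vec_eq_sum_axis[of v] by simp
  then show ?thesis
    by (simp add: linear_sum[OF assms] linear_scale[OF assms] mult.commute)
qed

locale lagrangian_mfd = smooth_mfd A
  for A :: "('q::{t2_space, second_countable_topology}, 'n::finite) chart set" +
  fixes L :: "('q, 'n) tvec \<times> real \<Rightarrow> real"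
  assumes smooth: "smooth_lagrangian A L"
begin

lemma local_rep_apply: "local_rep A L \<phi> (x, y, z) = L (tvec_of A \<phi> x y, z)"
  by (simp add: local_rep_def)

abbreviation chart_dom :: "('q, 'n) chart \<Rightarrow> ((real ^ 'n) \<times> (real ^ 'n) \<times> real) set" where
  "chart_dom \<phi> \<equiv> (snd \<phi> ` fst \<phi>) \<times> UNIV \<times> UNIV"

lemma open_chart_dom: "\<phi> \<in> A \<Longrightarrow> open (chart_dom \<phi>)"
  using chart(2) by (intro open_Times) auto

lemma Ck_on_local_rep: "\<phi> \<in> A \<Longrightarrow> Ck_on k (local_rep A L \<phi>) (chart_dom \<phi>)"
  using smooth by (auto simp: smooth_lagrangian_def smooth_on_def)

lemma local_rep_has_derivative:
  assumes "\<phi> \<in> A" "\<xi> \<in> chart_dom \<phi>"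
  shows "(local_rep A L \<phi> has_derivative frechet_derivative (local_rep A L \<phi>) (at \<xi>)) (at \<xi>)"
  using Ck_on_open_has_derivative[OF Ck_on_local_rep open_chart_dom] assms by blast

lemma continuous_on_local_rep: "\<phi> \<in> A \<Longrightarrow> continuous_on (chart_dom \<phi>) (local_rep A L \<phi>)"
  using Ck_on_local_rep[of \<phi> 0] by simp

lemma continuous_on_local_rep_deriv:
  assumes "\<phi> \<in> A" "continuous_on S \<xi>" "continuous_on S v" "\<xi> ` S \<subseteq> chart_dom \<phi>"
  shows "continuous_on S (\<lambda>p. frechet_derivative (local_rep A L \<phi>) (at (\<xi> p)) (v p))"
  using continuous_on_frechet_derivative[OF Ck_on_local_rep open_chart_dom] assms by blast

lemma local_rep_deriv_expand:
  assumes "\<phi> \<in> A" "\<xi> \<in> chart_dom \<phi>"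
  shows "frechet_derivative (local_rep A L \<phi>) (at \<xi>) (x, y, z) =
    (\<Sum>j\<in>UNIV. D_q (local_rep A L \<phi>) j \<xi> * x $ j) + (\<Sum>j\<in>UNIV. D_v (local_rep A L \<phi>) j \<xi> * y $ j)
    + D_z (local_rep A L \<phi>) \<xi> * z"
proof -
  let ?D = "frechet_derivative (local_rep A L \<phi>) (at \<xi>)"
  have lin: "linear ?D"
    using local_rep_has_derivative[OF assms] by (rule has_derivative_linear)
  have "?D (x, y, z) = ?D ((x, 0, 0) + ((0, y, 0) + (0, 0, z)))"
    by simp
  also have "\<dots> = ?D (x, 0, 0) + (?D (0, y, 0) + ?D (0, 0, z))"
    by (simp only: linear_add[OF lin])
  also have "?D (x, 0, 0) = (\<Sum>j\<in>UNIV. D_q (local_rep A L \<phi>) j \<xi> * x $ j)"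
    unfolding D_q_def
    by (rule linear_vec_expansion, rule linearI)
      (simp_all add: linear_add[OF lin, symmetric] linear_scale[OF lin, symmetric] flip: real_scaleR_def)
  also have "?D (0, y, 0) = (\<Sum>j\<in>UNIV. D_v (local_rep A L \<phi>) j \<xi> * y $ j)"
    unfolding D_v_def
    by (rule linear_vec_expansion, rule linearI)
      (simp_all add: linear_add[OF lin, symmetric] linear_scale[OF lin, symmetric] flip: real_scaleR_def)
  also have "?D (0, 0, z) = D_z (local_rep A L \<phi>) \<xi> * z"
  proof -
    have "?D (0, 0, z) = ?D (z *\<^sub>R (0, 0, 1))"
      by simp
    also have "\<dots> = z *\<^sub>R ?D (0, 0, 1)"
      by (rule linear_scale[OF lin])
    finally show ?thesis
      by (simp add: D_z_def mult.commute)
  qed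
  finally show ?thesis
    by simp
qed

text \<open>Coordinate changes act linearly on fibres. Hence adding a multiple of a tangent vector
  in all charts at once is the straight line \<open>y + r *\<^sub>R y'\<close> in the coordinates of
  \<phi>, and the chain rule applies to that line.\<close>

lemma fibre_deriv_tvec_of:
  assumes \<phi>: "\<phi> \<in> A" and x: "x \<in> snd \<phi> ` fst \<phi>"
  shows "fibre_deriv L (tvec_of A \<phi> x y) (tvec_of A \<phi> x y') z =
    (\<Sum>j\<in>UNIV. D_v (local_rep A L \<phi>) j (x, y, z) * y' $ j)"
proof -
  let ?F = "local_rep A L \<phi>"
  let ?D = "frechet_derivative ?F (at (x, y, z))"
  have dom: "(x, y, z) \<in> chart_dom \<phi>"
    using x by simp
  have "((\<lambda>r. (x, y + r *\<^sub>R y', z)) has_derivative (\<lambda>r. (0, r *\<^sub>R y', 0))) (at 0)"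
    by (auto intro!: derivative_eq_intros)
  moreover have "(?F has_derivative ?D) (at (x, y + 0 *\<^sub>R y', z))"
    using local_rep_has_derivative[OF \<phi> dom] by simp
  ultimately have "(?F \<circ> (\<lambda>r. (x, y + r *\<^sub>R y', z)) has_derivative ?D \<circ> (\<lambda>r. (0, r *\<^sub>R y', 0))) (at 0)"
    by (rule diff_chain_at)
  moreover have "?D \<circ> (\<lambda>r. (0, r *\<^sub>R y', 0)) = (*) (\<Sum>j\<in>UNIV. D_v ?F j (x, y, z) * y' $ j)"
    by (intro ext) (simp add: local_rep_deriv_expand[OF \<phi> dom] sum_distrib_left mult_ac)
  ultimately have "((\<lambda>r. ?F (x, y + r *\<^sub>R y', z)) has_real_derivative
      (\<Sum>j\<in>UNIV. D_v ?F j (x, y, z) * y' $ j)) (at 0)"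
    by (simp add: has_field_derivative_def o_def)
  moreover have "(\<lambda>r. L ((fst (tvec_of A \<phi> x y), \<lambda>\<psi>. snd (tvec_of A \<phi> x y) \<psi> +
      r *\<^sub>R snd (tvec_of A \<phi> x y') \<psi>), z)) = (\<lambda>r. ?F (x, y + r *\<^sub>R y', z))"
    unfolding tvec_of_add_scale[OF \<phi> x] local_rep_apply ..
  ultimately show ?thesis
    unfolding fibre_deriv_def by (simp only: DERIV_imp_deriv)
qed

text \<open>Contracting the momentum with the velocity is the fibre derivative in the direction of
  the vector itself, which gives the energy a form independent of the chart.\<close>

lemma energy_tvec_of:
  assumes \<phi>: "\<phi> \<in> A" and x: "x \<in> snd \<phi> ` fst \<phi>"
  shows "fibre_deriv L (tvec_of A \<phi> x y) (tvec_of A \<phi> x y) z - L (tvec_of A \<phi> x y, z) =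
    energy (local_rep A L \<phi>) (x, y, z)"
  unfolding fibre_deriv_tvec_of[OF assms] energy_def by (simp add: local_rep_apply mult.commute)

end

section \<open>The equations of motion along a smooth piece of a path\<close>

lemma at_within_openin:
  assumes "openin (top_of_set S) T" "t \<in> T"
  shows "at t within T = at t within S"
proof -
  obtain U where U: "open U" "T = S \<inter> U"
    using assms(1) by (auto simp: openin_open)
  show ?thesis
    by (rule at_within_nhd[of t U]) (use U assms(2) in auto)
qed

lemma at_within_Icc_nonbot:
  fixes a b :: real
  assumes "a < b" "t \<in> {a..b}"
  shows "at t within {a..b} \<noteq> bot"
  using assms by (simp add: trivial_limit_within islimpt_Icc)

text \<open>\<open>J\<close> will be the set of times that a path spends in a chart. Derivatives are
  taken within \<open>{a..b}\<close> instead, so that they do not refer to the chart; relative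
  openness of \<open>J\<close> makes both filters equal.\<close>

lemma C2_curve:
  fixes f :: "real \<Rightarrow> 'b::real_normed_vector"
  assumes J: "openin (top_of_set {a..b}) J" and ab: "a < b" and f: "Ck_on 2 f J"
  obtains f2 where
    "\<And>t. t \<in> J \<Longrightarrow> (f has_vector_derivative vector_derivative f (at t within {a..b})) (at t within {a..b})"
    "\<And>t. t \<in> J \<Longrightarrow> ((\<lambda>t. vector_derivative f (at t within {a..b})) has_vector_derivative f2 t) (at t within {a..b})"
    "continuous_on J (\<lambda>t. vector_derivative f (at t within {a..b}))" "continuous_on J f2"
proof -
  let ?D = "\<lambda>g t. frechet_derivative g (at t within J) 1"
  have sub: "J \<subseteq> {a..b}"
    using J by (rule openin_imp_subset)
  have d: "(g has_vector_derivative ?D g t) (at t within {a..b})"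
    if g: "Ck_on (Suc k) g J" and t: "t \<in> J" for g :: "real \<Rightarrow> 'b" and k t
  proof -
    have "(g has_derivative frechet_derivative g (at t within J)) (at t within {a..b})"
      using Ck_on_SucE[OF g t] at_within_openin[OF J t] by simp
    moreover have "frechet_derivative g (at t within J) = (\<lambda>h. h *\<^sub>R ?D g t)"
    proof
      fix h
      show "frechet_derivative g (at t within J) h = h *\<^sub>R ?D g t"
        using linear_scale[OF has_derivative_linear[OF Ck_on_SucE[OF g t]], of h 1] by simp
    qed
    ultimately show ?thesis
      unfolding has_vector_derivative_def by metis
  qed
  have f1: "Ck_on (Suc 1) f J"
    using f by (simp add: numeral_2_eq_2)
  then have f2: "Ck_on (Suc 0) (?D f) J"
    by simp
  have eq: "vector_derivative f (at t within {a..b}) = ?D f t" if "t \<in> J" for t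
    using vector_derivative_within[OF at_within_Icc_nonbot[OF ab] d[OF f1 that]] sub that by blast
  show thesis
  proof
    show "(f has_vector_derivative vector_derivative f (at t within {a..b})) (at t within {a..b})"
      if "t \<in> J" for t
      using d[OF f1 that] eq[OF that] by simp
    show "continuous_on J (\<lambda>t. vector_derivative f (at t within {a..b}))"
      using Ck_on_imp_continuous_on[OF f2] eq by (simp cong: continuous_on_cong)
    show "continuous_on J (?D (?D f))"
      using f2 by simp
    show "((\<lambda>t. vector_derivative f (at t within {a..b})) has_vector_derivative ?D (?D f) t) (at t within {a..b})"
      if "t \<in> J" for t
    proof -
      have "(?D f has_vector_derivative ?D (?D f) t) (at t within J)"
        using d[OF f2 that] at_within_openin[OF J that] by simp
      from has_vector_derivative_transform[OF that eq this] show ?thesis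
        using at_within_openin[OF J that] by simp
    qed
  qed
qed

lemma integrating_factor:
  fixes c :: "real \<Rightarrow> real"
  assumes "continuous_on {a..b} c"
  shows "\<exists>\<mu>. \<mu> a = 1 \<and> (\<forall>t. 0 < \<mu> t) \<and>
    (\<forall>t\<in>{a..b}. (\<mu> has_real_derivative - c t * \<mu> t) (at t within {a..b}))"
proof -
  have "((\<lambda>t. exp (- integral {a..t} c)) has_real_derivative - c t * exp (- integral {a..t} c)) (at t within {a..b})"
    if "t \<in> {a..b}" for t
  proof -
    have "((\<lambda>t. integral {a..t} c) has_real_derivative c t) (at t within {a..b})"
      using integral_has_vector_derivative[OF assms that]
      by (simp add: has_real_derivative_iff_has_vector_derivative)
    then show ?thesis
      by (auto intro!: derivative_eq_intros)
  qed
  then show ?thesis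
    by (intro exI[of _ "\<lambda>t. exp (- integral {a..t} c)"]) simp
qed

lemma has_real_derivative_compose:
  fixes G :: "'a::real_normed_vector \<Rightarrow> real"
  assumes "(G has_derivative G') (at (\<xi> t))" "(\<xi> has_vector_derivative \<xi>') (at t within S)"
  shows "((\<lambda>t. G (\<xi> t)) has_real_derivative G' \<xi>') (at t within S)"
proof -
  have "(G \<circ> \<xi> has_derivative G' \<circ> (\<lambda>h. h *\<^sub>R \<xi>')) (at t within S)"
    using assms unfolding has_vector_derivative_def
    by (intro diff_chain_within) (auto intro: has_derivative_at_withinI)
  moreover have "G' \<circ> (\<lambda>h. h *\<^sub>R \<xi>') = (*) (G' \<xi>')"
    using linear_scale[OF has_derivative_linear[OF assms(1)]] by (intro ext) (simp add: mult.commute)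
  ultimately show ?thesis
    by (simp add: has_field_derivative_def o_def)
qed

text \<open>One smooth piece of a path, ends included. \<theta> stands for the derivative of the
  time component, so division by it turns parameter derivatives into time derivatives. Only
  continuity of \<open>Z\<close> is built in: its equation is supplied at the times where it is
  used, because it is not imposed at the impact.\<close>

locale curve_piece = lagrangian_mfd A L
  for A :: "('q::{t2_space, second_countable_topology}, 'n::finite) chart set"
    and L :: "('q, 'n) tvec \<times> real \<Rightarrow> real" +
  fixes a b :: real and q :: "real \<Rightarrow> 'q" and \<theta> \<theta>' Z :: "real \<Rightarrow> real"
  assumes ab: "a < b" and q: "manifold_Ck A 2 q {a..b}"
    and \<theta>_pos: "t \<in> {a..b} \<Longrightarrow> 0 < \<theta> t"
    and \<theta>_der: "t \<in> {a..b} \<Longrightarrow> (\<theta> has_real_derivative \<theta>' t) (at t within {a..b})"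
    and \<theta>'_cont: "continuous_on {a..b} \<theta>'"
    and Z_cont: "continuous_on {a..b} Z"
begin

definition J :: "('q, 'n) chart \<Rightarrow> real set" where
  "J \<phi> = {a..b} \<inter> q -` fst \<phi>"

definition ydot :: "('q, 'n) chart \<Rightarrow> real \<Rightarrow> real ^ 'n" where
  "ydot \<phi> t = (1 / \<theta> t) *\<^sub>R vector_derivative (snd \<phi> \<circ> q) (at t within {a..b})"

definition \<xi> :: "('q, 'n) chart \<Rightarrow> real \<Rightarrow> (real ^ 'n) \<times> (real ^ 'n) \<times> real" where
  "\<xi> \<phi> t = (snd \<phi> (q t), ydot \<phi> t, Z t)"

definition lift :: "real \<Rightarrow> ('q, 'n) tvec" where
  "lift t = tscale (1 / \<theta> t) (velocity A q {a..b} t)"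

definition rate :: "real \<Rightarrow> real" where
  "rate t = L (lift t, Z t) * \<theta> t"

definition mom :: "('q, 'n) chart \<Rightarrow> 'n \<Rightarrow> real \<Rightarrow> real" where
  "mom \<phi> j t = D_v (local_rep A L \<phi>) j (\<xi> \<phi> t)"

text \<open>The left-hand side of the Herglotz equation with index \<open>j\<close>: the
  Euler-Lagrange expression with a time derivative, corrected by the dependence of L on
  \<open>z\<close>.\<close>

definition el :: "('q, 'n) chart \<Rightarrow> 'n \<Rightarrow> real \<Rightarrow> real" where
  "el \<phi> j t = D_q (local_rep A L \<phi>) j (\<xi> \<phi> t) - vector_derivative (mom \<phi> j) (at t within {a..b}) / \<theta> t +
     mom \<phi> j t * D_z (local_rep A L \<phi>) (\<xi> \<phi> t)"

definition En :: "real \<Rightarrow> real" where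
  "En t = fibre_deriv L (lift t) (lift t) (Z t) - L (lift t, Z t)"

lemma q_cont: "continuous_on {a..b} q"
  using q by (simp add: manifold_Ck_def)

lemma J_openin: "\<phi> \<in> A \<Longrightarrow> openin (top_of_set {a..b}) (J \<phi>)"
  unfolding J_def by (rule openin_chart_preimage[OF q_cont])

lemma \<theta>_cont: "continuous_on {a..b} \<theta>"
  by (rule DERIV_continuous_on[OF \<theta>_der])

lemma curve_derivs:
  assumes \<phi>: "\<phi> \<in> A"
  obtains yd where
    "\<And>t. t \<in> J \<phi> \<Longrightarrow> (snd \<phi> \<circ> q has_vector_derivative \<theta> t *\<^sub>R ydot \<phi> t) (at t within {a..b})"
    "\<And>t. t \<in> J \<phi> \<Longrightarrow> (ydot \<phi> has_vector_derivative yd t) (at t within {a..b})"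
    "continuous_on (J \<phi>) (ydot \<phi>)" "continuous_on (J \<phi>) yd"
proof -
  let ?x = "\<lambda>t. vector_derivative (snd \<phi> \<circ> q) (at t within {a..b})"
  have "Ck_on 2 (snd \<phi> \<circ> q) (J \<phi>)"
    using q \<phi> by (simp add: manifold_Ck_def J_def)
  then obtain x2 where x2:
    "\<And>t. t \<in> J \<phi> \<Longrightarrow> (snd \<phi> \<circ> q has_vector_derivative ?x t) (at t within {a..b})"
    "\<And>t. t \<in> J \<phi> \<Longrightarrow> (?x has_vector_derivative x2 t) (at t within {a..b})"
    "continuous_on (J \<phi>) ?x" "continuous_on (J \<phi>) x2"
    using C2_curve[OF J_openin[OF \<phi>] ab] by blast
  have sub: "J \<phi> \<subseteq> {a..b}"
    by (auto simp: J_def)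
  have nz: "\<theta> t \<noteq> 0" if "t \<in> J \<phi>" for t
    using \<theta>_pos sub that by fastforce
  have c: "continuous_on (J \<phi>) \<theta>" "continuous_on (J \<phi>) \<theta>'"
    using \<theta>_cont \<theta>'_cont sub continuous_on_subset by auto
  define yd where "yd t = (1 / \<theta> t) *\<^sub>R x2 t + (- \<theta>' t / (\<theta> t)\<^sup>2) *\<^sub>R ?x t" for t
  show thesis
  proof
    show "(snd \<phi> \<circ> q has_vector_derivative \<theta> t *\<^sub>R ydot \<phi> t) (at t within {a..b})" if "t \<in> J \<phi>" for t
      using x2(1)[OF that] nz[OF that] by (simp add: ydot_def)
    show "(ydot \<phi> has_vector_derivative yd t) (at t within {a..b})" if "t \<in> J \<phi>" for t
    proof -
      have "((\<lambda>t. 1 / \<theta> t) has_real_derivative - \<theta>' t / (\<theta> t)\<^sup>2) (at t within {a..b})"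
        using \<theta>_der[of t] nz[OF that] sub that
        by (auto intro!: derivative_eq_intros simp: power2_eq_square)
      from has_vector_derivative_scaleR[OF this x2(2)[OF that]] show ?thesis
        unfolding ydot_def yd_def .
    qed
    show "continuous_on (J \<phi>) (ydot \<phi>)"
      unfolding ydot_def using nz by (intro continuous_intros x2 c) auto
    show "continuous_on (J \<phi>) yd"
      unfolding yd_def using nz by (intro continuous_intros x2 c) auto
  qed
qed

lemma \<xi>_in_chart_dom: "t \<in> J \<phi> \<Longrightarrow> \<xi> \<phi> t \<in> chart_dom \<phi>"
  by (auto simp: J_def \<xi>_def)

lemma continuous_on_\<xi>: 
  assumes "\<phi> \<in> A"
  shows "continuous_on (J \<phi>) (\<xi> \<phi>)"
proof -
  have "J \<phi> \<subseteq> {a..b}"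
    by (auto simp: J_def)
  moreover have "continuous_on (J \<phi>) (ydot \<phi>)"
    using curve_derivs[OF assms] by blast
  moreover have "continuous_on (J \<phi>) (\<lambda>t. snd \<phi> (q t))"
    by (rule continuous_on_compose2[OF continuous_on_chart[OF assms] continuous_on_subset[OF q_cont]])
      (auto simp: J_def)
  ultimately show ?thesis
    unfolding \<xi>_def using Z_cont by (intro continuous_on_Pair) (auto intro: continuous_on_subset)
qed

lemma lift_eq:
  assumes \<phi>: "\<phi> \<in> A" and t: "t \<in> J \<phi>"
  shows "lift t = tvec_of A \<phi> (snd \<phi> (q t)) (ydot \<phi> t)"
proof -
  have t': "t \<in> {a..b}" "q t \<in> fst \<phi>"
    using t by (auto simp: J_def)
  have "continuous (at t within {a..b}) q"
    using q_cont t' by (simp add: continuous_on_eq_continuous_within)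
  moreover have "(snd \<phi> \<circ> q has_vector_derivative \<theta> t *\<^sub>R ydot \<phi> t) (at t within {a..b})"
    using curve_derivs[OF \<phi>] t by blast
  ultimately have "velocity A q {a..b} t = tvec_of A \<phi> (snd \<phi> (q t)) (\<theta> t *\<^sub>R ydot \<phi> t)"
    by (intro velocity_eq_tvec_of t' \<phi> at_within_Icc_nonbot ab)
  then show ?thesis
    using \<theta>_pos[OF t'(1)] t' by (simp add: lift_def tscale_tvec_of[OF \<phi>])
qed

lemma coords_lift: "t \<in> J \<phi> \<Longrightarrow> \<phi> \<in> A \<Longrightarrow> coords \<phi> (lift t, Z t) = \<xi> \<phi> t"
  by (simp add: coords_def lift_def tscale_def velocity_def \<xi>_def ydot_def J_def)

lemma rate_eq:
  assumes "\<phi> \<in> A" "t \<in> J \<phi>"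
  shows "rate t = local_rep A L \<phi> (\<xi> \<phi> t) * \<theta> t"
  using lift_eq[OF assms] by (simp add: rate_def \<xi>_def local_rep_apply)

lemma En_eq:
  assumes "\<phi> \<in> A" "t \<in> J \<phi>"
  shows "En t = energy (local_rep A L \<phi>) (\<xi> \<phi> t)"
    "En t = (\<Sum>j\<in>UNIV. ydot \<phi> t $ j * mom \<phi> j t) - local_rep A L \<phi> (\<xi> \<phi> t)"
proof -
  have "q t \<in> fst \<phi>"
    using assms(2) by (simp add: J_def)
  then show "En t = energy (local_rep A L \<phi>) (\<xi> \<phi> t)"
    using lift_eq[OF assms] energy_tvec_of[OF assms(1)] by (simp add: En_def \<xi>_def)
  then show "En t = (\<Sum>j\<in>UNIV. ydot \<phi> t $ j * mom \<phi> j t) - local_rep A L \<phi> (\<xi> \<phi> t)"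
    by (simp add: energy_def \<xi>_def mom_def)
qed

lemma Ck_on_D_v: "\<phi> \<in> A \<Longrightarrow> Ck_on k (D_v (local_rep A L \<phi>) j) (chart_dom \<phi>)"
  unfolding D_v_def by (rule Ck_on_frechet_derivative_open[OF Ck_on_local_rep open_chart_dom])

lemma continuous_on_D_z: "\<phi> \<in> A \<Longrightarrow> continuous_on (chart_dom \<phi>) (D_z (local_rep A L \<phi>))"
  unfolding D_z_def
  by (rule Ck_on_imp_continuous_on[OF Ck_on_frechet_derivative_open[OF Ck_on_local_rep open_chart_dom]])

lemma continuous_on_D_q: "\<phi> \<in> A \<Longrightarrow> continuous_on (chart_dom \<phi>) (D_q (local_rep A L \<phi>) j)"
  unfolding D_q_def
  by (rule Ck_on_imp_continuous_on[OF Ck_on_frechet_derivative_open[OF Ck_on_local_rep open_chart_dom]])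

lemma continuous_on_mom:
  assumes "\<phi> \<in> A"
  shows "continuous_on (J \<phi>) (mom \<phi> j)"
  unfolding mom_def
  by (rule continuous_on_compose2[OF Ck_on_imp_continuous_on[OF Ck_on_D_v[OF assms]] continuous_on_\<xi>[OF assms]])
    (use \<xi>_in_chart_dom in blast)

lemma continuous_on_En: "continuous_on {a..b} En"
proof -
  have "Ck_on 0 En {a..b}"
  proof (rule Ck_on_local)
    fix t assume t: "t \<in> {a..b}"
    obtain \<phi> where \<phi>: "\<phi> \<in> A" "q t \<in> fst \<phi>"
      using chart_cover by blast
    obtain U where U: "open U" "J \<phi> = {a..b} \<inter> U"
      using J_openin[OF \<phi>(1)] by (auto simp: openin_open)
    have "continuous_on (J \<phi>) (\<lambda>t. (\<Sum>j\<in>UNIV. ydot \<phi> t $ j * mom \<phi> j t) - local_rep A L \<phi> (\<xi> \<phi> t))"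
    proof (intro continuous_intros continuous_on_mom \<phi>)
      show "continuous_on (J \<phi>) (ydot \<phi>)"
        using curve_derivs[OF \<phi>(1)] by blast
      show "continuous_on (J \<phi>) (\<lambda>t. local_rep A L \<phi> (\<xi> \<phi> t))"
        by (rule continuous_on_compose2[OF continuous_on_local_rep[OF \<phi>(1)] continuous_on_\<xi>[OF \<phi>(1)]])
          (use \<xi>_in_chart_dom in blast)
    qed
    then have "continuous_on (J \<phi>) En"
      by (rule continuous_on_eq) (use En_eq(2)[OF \<phi>(1)] in simp)
    then have "Ck_on 0 En ({a..b} \<inter> U)"
      unfolding U(2) by simp
    moreover have "t \<in> {a..b} \<inter> U"
      unfolding U(2)[symmetric] J_def using t \<phi>(2) by blast
    ultimately show "\<exists>U. open U \<and> t \<in> U \<and> Ck_on 0 En ({a..b} \<inter> U)"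
      using U(1) by blast
  qed
  then show ?thesis by simp
qed

text \<open>The last component of \<open>d\<close> is the right-hand side of the equation of
  \<open>Z\<close>, so \<open>d\<close> is continuous on all of \<open>J \<phi>\<close> without
  appeal to that equation. It is the derivative of \<open>\<xi> \<phi>\<close> at the times where
  the equation holds.\<close>

lemma \<xi>_derivative:
  assumes \<phi>: "\<phi> \<in> A"
  obtains d where "continuous_on (J \<phi>) d"
    "\<And>t. fst (d t) = \<theta> t *\<^sub>R ydot \<phi> t" "\<And>t. snd (snd (d t)) = local_rep A L \<phi> (\<xi> \<phi> t) * \<theta> t"
    "\<And>t. t \<in> J \<phi> \<Longrightarrow> (ydot \<phi> has_vector_derivative fst (snd (d t))) (at t within {a..b})"
    "\<And>t. t \<in> J \<phi> \<Longrightarrow> (Z has_real_derivative rate t) (at t within {a..b}) \<Longrightarrow>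
      (\<xi> \<phi> has_vector_derivative d t) (at t within {a..b})"
proof -
  obtain yd where yd:
    "\<And>t. t \<in> J \<phi> \<Longrightarrow> (snd \<phi> \<circ> q has_vector_derivative \<theta> t *\<^sub>R ydot \<phi> t) (at t within {a..b})"
    "\<And>t. t \<in> J \<phi> \<Longrightarrow> (ydot \<phi> has_vector_derivative yd t) (at t within {a..b})"
    "continuous_on (J \<phi>) (ydot \<phi>)" "continuous_on (J \<phi>) yd"
    using curve_derivs[OF \<phi>] by blast
  have c: "continuous_on (J \<phi>) \<theta>"
    using \<theta>_cont by (rule continuous_on_subset) (auto simp: J_def)
  have cF: "continuous_on (J \<phi>) (\<lambda>t. local_rep A L \<phi> (\<xi> \<phi> t))"
    by (rule continuous_on_compose2[OF continuous_on_local_rep[OF \<phi>] continuous_on_\<xi>[OF \<phi>]])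
      (use \<xi>_in_chart_dom in blast)
  show thesis
  proof (rule that[of "\<lambda>t. (\<theta> t *\<^sub>R ydot \<phi> t, yd t, local_rep A L \<phi> (\<xi> \<phi> t) * \<theta> t)"])
    show "continuous_on (J \<phi>) (\<lambda>t. (\<theta> t *\<^sub>R ydot \<phi> t, yd t, local_rep A L \<phi> (\<xi> \<phi> t) * \<theta> t))"
      by (intro continuous_intros yd c cF)
    show "(\<xi> \<phi> has_vector_derivative (\<theta> t *\<^sub>R ydot \<phi> t, yd t, local_rep A L \<phi> (\<xi> \<phi> t) * \<theta> t)) (at t within {a..b})"
      if t: "t \<in> J \<phi>" and Z: "(Z has_real_derivative rate t) (at t within {a..b})" for t
    proof -
      have Zv: "(Z has_vector_derivative local_rep A L \<phi> (\<xi> \<phi> t) * \<theta> t) (at t within {a..b})"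
        using Z unfolding rate_eq[OF \<phi> t] has_real_derivative_iff_has_vector_derivative .
      have "\<xi> \<phi> = (\<lambda>t. ((snd \<phi> \<circ> q) t, ydot \<phi> t, Z t))"
        by (simp add: \<xi>_def fun_eq_iff)
      then show ?thesis
        using has_vector_derivative_Pair[OF yd(1)[OF t] has_vector_derivative_Pair[OF yd(2)[OF t] Zv]]
        by (simp only:)
    qed
  qed (use yd in auto)
qed

lemma mom_derivative:
  assumes \<phi>: "\<phi> \<in> A" and t: "t \<in> J \<phi>" and Z: "(Z has_real_derivative rate t) (at t within {a..b})"
  shows "(mom \<phi> j has_real_derivative vector_derivative (mom \<phi> j) (at t within {a..b})) (at t within {a..b})"
proof -
  obtain d where d: "(\<xi> \<phi> has_vector_derivative d t) (at t within {a..b})"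
    using \<xi>_derivative[OF \<phi>] t Z by metis
  have "(mom \<phi> j has_real_derivative frechet_derivative (D_v (local_rep A L \<phi>) j) (at (\<xi> \<phi> t)) (d t)) (at t within {a..b})"
    unfolding mom_def
    by (rule has_real_derivative_compose[OF Ck_on_open_has_derivative[OF Ck_on_D_v[OF \<phi>] open_chart_dom[OF \<phi>]] d])
      (rule \<xi>_in_chart_dom[OF t])
  then show ?thesis
    using vector_derivative_within[OF at_within_Icc_nonbot[OF ab]] t
    by (metis IntD1 J_def has_real_derivative_iff_has_vector_derivative)
qed

text \<open>Where the equation of \<open>Z\<close> holds, the chain rule expresses the derivative of
  the momentum through the candidate derivative of \<open>\<xi> \<phi>\<close>. That expression is
  continuous up to the ends of the piece, which allows limits in the equations of motion.\<close>

lemma el_continuous_extension: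
  assumes \<phi>: "\<phi> \<in> A"
  obtains e where "continuous_on (J \<phi>) e"
    "\<And>t. t \<in> J \<phi> \<Longrightarrow> (Z has_real_derivative rate t) (at t within {a..b}) \<Longrightarrow> el \<phi> j t = e t"
proof -
  let ?F = "local_rep A L \<phi>"
  obtain d where d: "continuous_on (J \<phi>) d"
    "\<And>t. t \<in> J \<phi> \<Longrightarrow> (Z has_real_derivative rate t) (at t within {a..b}) \<Longrightarrow>
      (\<xi> \<phi> has_vector_derivative d t) (at t within {a..b})"
    using \<xi>_derivative[OF \<phi>] by metis
  have nz: "\<theta> t \<noteq> 0" if "t \<in> J \<phi>" for t
    using \<theta>_pos[of t] that by (auto simp: J_def)
  have sub: "\<xi> \<phi> ` J \<phi> \<subseteq> chart_dom \<phi>"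
    using \<xi>_in_chart_dom by blast
  note c\<xi> = continuous_on_\<xi>[OF \<phi>]
  show thesis
  proof
    show "continuous_on (J \<phi>) (\<lambda>t. D_q ?F j (\<xi> \<phi> t) -
        frechet_derivative (D_v ?F j) (at (\<xi> \<phi> t)) (d t) / \<theta> t + mom \<phi> j t * D_z ?F (\<xi> \<phi> t))"
    proof (intro continuous_intros continuous_on_mom[OF \<phi>])
      show "continuous_on (J \<phi>) (\<lambda>t. D_q ?F j (\<xi> \<phi> t))"
        by (rule continuous_on_compose2[OF continuous_on_D_q[OF \<phi>] c\<xi> sub])
      show "continuous_on (J \<phi>) (\<lambda>t. D_z ?F (\<xi> \<phi> t))"
        by (rule continuous_on_compose2[OF continuous_on_D_z[OF \<phi>] c\<xi> sub])
      show "continuous_on (J \<phi>) (\<lambda>t. frechet_derivative (D_v ?F j) (at (\<xi> \<phi> t)) (d t))"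
        by (rule continuous_on_frechet_derivative[OF Ck_on_D_v[OF \<phi>] open_chart_dom[OF \<phi>] c\<xi> d(1) sub])
      show "continuous_on (J \<phi>) \<theta>"
        using \<theta>_cont by (rule continuous_on_subset) (auto simp: J_def)
    qed (use nz in auto)
    fix t assume t: "t \<in> J \<phi>" and Z: "(Z has_real_derivative rate t) (at t within {a..b})"
    have "(mom \<phi> j has_real_derivative frechet_derivative (D_v ?F j) (at (\<xi> \<phi> t)) (d t)) (at t within {a..b})"
      unfolding mom_def
      by (rule has_real_derivative_compose[OF Ck_on_open_has_derivative[OF Ck_on_D_v[OF \<phi>] open_chart_dom[OF \<phi>]] d(2)[OF t Z]])
        (rule \<xi>_in_chart_dom[OF t])
    then have "vector_derivative (mom \<phi> j) (at t within {a..b}) = frechet_derivative (D_v ?F j) (at (\<xi> \<phi> t)) (d t)"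
      using vector_derivative_within[OF at_within_Icc_nonbot[OF ab]] t
      by (metis IntD1 J_def has_real_derivative_iff_has_vector_derivative)
    then show "el \<phi> j t = D_q ?F j (\<xi> \<phi> t) - frechet_derivative (D_v ?F j) (at (\<xi> \<phi> t)) (d t) / \<theta> t
        + mom \<phi> j t * D_z ?F (\<xi> \<phi> t)"
      by (simp add: el_def)
  qed
qed

text \<open>The energy balance is a consequence of the Euler--Lagrange equations, by contraction with the velocity.\<close>

lemma En_derivative:
  assumes \<phi>: "\<phi> \<in> A" and t: "t \<in> J \<phi>" and Z: "(Z has_real_derivative rate t) (at t within {a..b})"
  shows "(En has_real_derivative \<theta> t * (D_z (local_rep A L \<phi>) (\<xi> \<phi> t) * En t - (\<Sum>j\<in>UNIV. el \<phi> j t * ydot \<phi> t $ j)))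
    (at t within {a..b})"
proof -
  let ?F = "local_rep A L \<phi>" and ?I = "at t within {a..b}"
  obtain d where d: "fst (d t) = \<theta> t *\<^sub>R ydot \<phi> t" "snd (snd (d t)) = ?F (\<xi> \<phi> t) * \<theta> t"
    "(ydot \<phi> has_vector_derivative fst (snd (d t))) ?I" "(\<xi> \<phi> has_vector_derivative d t) ?I"
    using \<xi>_derivative[OF \<phi>] t Z by metis
  define v where "v = fst (snd (d t))"
  have dt: "d t = (\<theta> t *\<^sub>R ydot \<phi> t, v, ?F (\<xi> \<phi> t) * \<theta> t)"
    using d(1,2) by (metis prod.collapse v_def)
  have th: "\<theta> t \<noteq> 0"
    using \<theta>_pos[of t] t by (auto simp: J_def)
  let ?p' = "\<lambda>j. vector_derivative (mom \<phi> j) ?I"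
  have y: "((\<lambda>t. ydot \<phi> t $ j) has_real_derivative v $ j) ?I" for j
    using bounded_linear.has_vector_derivative[OF bounded_linear_vec_nth d(3), of j]
    by (simp add: has_real_derivative_iff_has_vector_derivative v_def)
  have F: "((\<lambda>t. ?F (\<xi> \<phi> t)) has_real_derivative (\<Sum>j\<in>UNIV. D_q ?F j (\<xi> \<phi> t) * (\<theta> t * ydot \<phi> t $ j)) +
      (\<Sum>j\<in>UNIV. mom \<phi> j t * v $ j) + D_z ?F (\<xi> \<phi> t) * (?F (\<xi> \<phi> t) * \<theta> t)) ?I"
    using has_real_derivative_compose[OF local_rep_has_derivative[OF \<phi> \<xi>_in_chart_dom[OF t]] d(4)]
    unfolding dt local_rep_deriv_expand[OF \<phi> \<xi>_in_chart_dom[OF t]] by (simp add: mom_def)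
  have "((\<lambda>t. (\<Sum>j\<in>UNIV. ydot \<phi> t $ j * mom \<phi> j t) - ?F (\<xi> \<phi> t)) has_real_derivative
      (\<Sum>j\<in>UNIV. v $ j * mom \<phi> j t + ?p' j * ydot \<phi> t $ j) -
      ((\<Sum>j\<in>UNIV. D_q ?F j (\<xi> \<phi> t) * (\<theta> t * ydot \<phi> t $ j)) +
      (\<Sum>j\<in>UNIV. mom \<phi> j t * v $ j) + D_z ?F (\<xi> \<phi> t) * (?F (\<xi> \<phi> t) * \<theta> t))) ?I"
    by (intro DERIV_diff DERIV_sum DERIV_mult y mom_derivative[OF \<phi> t Z] F)
  moreover have "(\<Sum>j\<in>UNIV. v $ j * mom \<phi> j t + ?p' j * ydot \<phi> t $ j) -
      ((\<Sum>j\<in>UNIV. D_q ?F j (\<xi> \<phi> t) * (\<theta> t * ydot \<phi> t $ j)) +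
      (\<Sum>j\<in>UNIV. mom \<phi> j t * v $ j) + D_z ?F (\<xi> \<phi> t) * (?F (\<xi> \<phi> t) * \<theta> t)) =
      \<theta> t * (D_z ?F (\<xi> \<phi> t) * En t - (\<Sum>j\<in>UNIV. el \<phi> j t * ydot \<phi> t $ j))"
  proof -
    \<comment> \<open>The definition of \<open>el\<close>, solved for the derivative of the
      momentum. After substitution the acceleration terms \<open>v\<close> cancel, as in a Legendre
      transform, and so do the terms with \<open>D_q\<close>.\<close>
    have p': "?p' j = \<theta> t * (D_q ?F j (\<xi> \<phi> t) + mom \<phi> j t * D_z ?F (\<xi> \<phi> t) - el \<phi> j t)" for j
      using th by (simp add: el_def)
    show ?thesis
      unfolding p' En_eq(2)[OF \<phi> t]
      by (simp add: algebra_simps sum.distrib sum_subtractf sum_distrib_left)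
  qed
  ultimately have *: "((\<lambda>t. (\<Sum>j\<in>UNIV. ydot \<phi> t $ j * mom \<phi> j t) - ?F (\<xi> \<phi> t)) has_real_derivative
      \<theta> t * (D_z ?F (\<xi> \<phi> t) * En t - (\<Sum>j\<in>UNIV. el \<phi> j t * ydot \<phi> t $ j))) (at t within J \<phi>)"
    using at_within_openin[OF J_openin[OF \<phi>] t] by simp
  have "(En has_real_derivative \<theta> t * (D_z ?F (\<xi> \<phi> t) * En t - (\<Sum>j\<in>UNIV. el \<phi> j t * ydot \<phi> t $ j))) (at t within J \<phi>)"
    using * unfolding has_real_derivative_iff_has_vector_derivative
    by (rule has_vector_derivative_transform[OF t, rotated]) (rule En_eq(2)[OF \<phi>])
  then show ?thesis
    using at_within_openin[OF J_openin[OF \<phi>] t] by simp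
qed

end

section \<open>The first variation formula\<close>

text \<open>The right-hand side of the Herglotz equation for the member \<open>s\<close> of a family
  of paths, with \<open>z\<close> left free, so that it is a scalar equation depending on a
  parameter. \<open>\<Theta>\<close> is the rate of the time component.\<close>

definition family_rate ::
  "('q::topological_space, 'n::finite) chart set \<Rightarrow> (('q, 'n) tvec \<times> real \<Rightarrow> real) \<Rightarrow> real set \<Rightarrow>
    (real \<times> real \<Rightarrow> 'q) \<Rightarrow> (real \<times> real \<Rightarrow> real) \<Rightarrow> real \<Rightarrow> real \<Rightarrow> real \<Rightarrow> real" where
  "family_rate A L I Y \<Theta> s t z =
     L (tscale (1 / \<Theta> (s, t)) (velocity A (\<lambda>t. Y (s, t)) I t), z) * \<Theta> (s, t)"

lemma velocity_cong:
  assumes "\<And>t. t \<in> I \<Longrightarrow> \<gamma> t = \<gamma>' t" and t: "t \<in> I"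
  shows "velocity A \<gamma> I t = velocity A \<gamma>' I t"
proof -
  have "(snd \<psi> \<circ> \<gamma> has_vector_derivative v) (at t within I) \<longleftrightarrow> (snd \<psi> \<circ> \<gamma>' has_vector_derivative v) (at t within I)"
    for \<psi> :: "('a, 'b) chart" and v
    unfolding has_vector_derivative_def
    by (rule has_derivative_within_cong[OF _ t]) (simp add: assms(1))
  then have "vector_derivative (snd \<psi> \<circ> \<gamma>) (at t within I) = vector_derivative (snd \<psi> \<circ> \<gamma>') (at t within I)"
    for \<psi> :: "('a, 'b) chart"
    unfolding vector_derivative_def by simp
  then show ?thesis
    unfolding velocity_def assms(1)[OF t] by (simp only:)
qed

lemma continuous_on_cover:
  fixes f :: "'a::t2_space \<Rightarrow> 'b::topological_space"
  assumes "\<And>x. x \<in> S \<Longrightarrow> \<exists>U. open U \<and> x \<in> U \<and> continuous_on (S \<inter> U) f"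
  shows "continuous_on S f"
  unfolding continuous_on_eq_continuous_within
proof
  fix x assume "x \<in> S"
  then obtain U where U: "open U" "x \<in> U" "continuous_on (S \<inter> U) f"
    using assms by blast
  then have "continuous (at x within S \<inter> U) f"
    using \<open>x \<in> S\<close> by (simp add: continuous_on_eq_continuous_within)
  then show "continuous (at x within S) f"
    using U at_within_nhd[of x U S "S \<inter> U"] by auto
qed

context lagrangian_mfd
begin

text \<open>In a chart the velocity is \<open>ft\<close> divided by \<open>\<Theta>\<close>, so the
  derivative in \<open>s\<close> brings in the mixed derivative \<open>fst'\<close>. The last three
  conclusions use \<open>deriv\<close>, which does not mention the chart, so that they can be glued
  over all charts.\<close>

lemma family_rate_chart:
  fixes Y :: "real \<times> real \<Rightarrow> 'q" and \<Theta> \<Theta>s :: "real \<times> real \<Rightarrow> real"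
  assumes ab: "a < b" and S: "open S" and \<phi>: "\<phi> \<in> A"
    and Y: "manifold_Ck A 2 Y (S \<times> {a..b})"
    and \<Theta>: "continuous_on (S \<times> {a..b}) \<Theta>" "continuous_on (S \<times> {a..b}) \<Theta>s"
      "\<And>s t. s \<in> S \<Longrightarrow> t \<in> {a..b} \<Longrightarrow> 0 < \<Theta> (s, t)"
      "\<And>s t. s \<in> S \<Longrightarrow> t \<in> {a..b} \<Longrightarrow> ((\<lambda>s. \<Theta> (s, t)) has_real_derivative \<Theta>s (s, t)) (at s)"
  defines "g \<equiv> family_rate A L {a..b} Y \<Theta>" and "W \<equiv> (S \<times> {a..b}) \<inter> Y -` fst \<phi>"
  obtains fs ft fst' where
    "continuous_on W fs" "continuous_on W ft"
    "\<And>s t. (s, t) \<in> W \<Longrightarrow> ((\<lambda>s. snd \<phi> (Y (s, t))) has_vector_derivative fs (s, t)) (at s)"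
    "\<And>s t. (s, t) \<in> W \<Longrightarrow> ((\<lambda>t. snd \<phi> (Y (s, t))) has_vector_derivative ft (s, t)) (at t within {a..b})"
    "\<And>s t. (s, t) \<in> W \<Longrightarrow> ((\<lambda>t. fs (s, t)) has_vector_derivative fst' (s, t)) (at t within {a..b})"
    "\<And>s t z. (s, t) \<in> W \<Longrightarrow> g s t z =
      local_rep A L \<phi> (snd \<phi> (Y (s, t)), (1 / \<Theta> (s, t)) *\<^sub>R ft (s, t), z) * \<Theta> (s, t)"
    "\<And>s t z. (s, t) \<in> W \<Longrightarrow> ((\<lambda>s. g s t z) has_real_derivative
      frechet_derivative (local_rep A L \<phi>) (at (snd \<phi> (Y (s, t)), (1 / \<Theta> (s, t)) *\<^sub>R ft (s, t), z))
        (fs (s, t), (1 / \<Theta> (s, t)) *\<^sub>R fst' (s, t) + (- \<Theta>s (s, t) / (\<Theta> (s, t))\<^sup>2) *\<^sub>R ft (s, t), 0) * \<Theta> (s, t)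
      + \<Theta>s (s, t) * local_rep A L \<phi> (snd \<phi> (Y (s, t)), (1 / \<Theta> (s, t)) *\<^sub>R ft (s, t), z)) (at s)"
    "\<And>s t z. (s, t) \<in> W \<Longrightarrow> ((\<lambda>z. g s t z) has_real_derivative
      D_z (local_rep A L \<phi>) (snd \<phi> (Y (s, t)), (1 / \<Theta> (s, t)) *\<^sub>R ft (s, t), z) * \<Theta> (s, t)) (at z)"
    "continuous_on {p. (fst p, fst (snd p)) \<in> W} (\<lambda>(s, t, z). g s t z)"
    "continuous_on {p. (fst p, fst (snd p)) \<in> W} (\<lambda>(s, t, z). deriv (\<lambda>s. g s t z) s)"
    "continuous_on {p. (fst p, fst (snd p)) \<in> W} (\<lambda>(s, t, z). deriv (g s t) z)"
proof -
  let ?F = "local_rep A L \<phi>" and ?x = "\<lambda>p. snd \<phi> (Y p)"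
  have Yc: "continuous_on (S \<times> {a..b}) Y"
    using Y by (simp add: manifold_Ck_def)
  have W: "openin (top_of_set (S \<times> {a..b})) W"
    unfolding W_def by (rule openin_chart_preimage[OF Yc \<phi>])
  have "Ck_on 2 (snd \<phi> \<circ> Y) W"
    using Y \<phi> unfolding manifold_Ck_def W_def by blast
  then have C2: "Ck_on 2 ?x W"
    by (simp add: o_def)
  show thesis
  proof (rule C2_family[OF W S ab C2])
    fix fs ft fst' ftt assume f: "continuous_on W fs" "continuous_on W ft" "continuous_on W fst'" "continuous_on W ftt"
      "\<And>s t. (s, t) \<in> W \<Longrightarrow> ((\<lambda>s. ?x (s, t)) has_vector_derivative fs (s, t)) (at s)"
      "\<And>s t. (s, t) \<in> W \<Longrightarrow> ((\<lambda>t. ?x (s, t)) has_vector_derivative ft (s, t)) (at t within {a..b})"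
      "\<And>s t. (s, t) \<in> W \<Longrightarrow> ((\<lambda>s. ft (s, t)) has_vector_derivative fst' (s, t)) (at s)"
      "\<And>s t. (s, t) \<in> W \<Longrightarrow> ((\<lambda>t. ft (s, t)) has_vector_derivative ftt (s, t)) (at t within {a..b})"
      "\<And>s t. (s, t) \<in> W \<Longrightarrow> ((\<lambda>t. fs (s, t)) has_vector_derivative fst' (s, t)) (at t within {a..b})"
    have Wsub: "W \<subseteq> S \<times> {a..b}" and WY: "\<And>p. p \<in> W \<Longrightarrow> Y p \<in> fst \<phi>"
      unfolding W_def by blast+
    define y where "y p = (1 / \<Theta> p) *\<^sub>R ft p" for p
    have \<Theta>pos: "0 < \<Theta> p" if "p \<in> W" for p
      using \<Theta>(3)[of "fst p" "snd p"] Wsub that by auto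
    have dom: "(?x p, y p, z) \<in> chart_dom \<phi>" if "p \<in> W" for p z
      using WY[OF that] by blast
    have g: "g s t z = ?F (?x (s, t), y (s, t), z) * \<Theta> (s, t)" if p: "(s, t) \<in> W" for s t z
    proof -
      have st: "s \<in> S" "t \<in> {a..b}"
        using p Wsub by auto
      have "continuous_on {a..b} (\<lambda>t. Y (s, t))"
        by (rule continuous_on_compose2[OF Yc]) (use st in \<open>auto intro!: continuous_on_Pair continuous_on_const continuous_on_id\<close>)
      then have c: "continuous (at t within {a..b}) (\<lambda>t. Y (s, t))"
        using st(2) by (simp add: continuous_on_eq_continuous_within)
      have "velocity A (\<lambda>t. Y (s, t)) {a..b} t = tvec_of A \<phi> (?x (s, t)) (ft (s, t))"
        by (rule velocity_eq_tvec_of[OF c st(2) at_within_Icc_nonbot[OF ab st(2)] \<phi> WY[OF p]])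
          (use f(6)[OF p] in \<open>simp add: o_def\<close>)
      then show ?thesis
        unfolding g_def family_rate_def y_def
        by (simp add: tscale_tvec_of[OF \<phi> imageI[OF WY[OF p]]] local_rep_apply)
    qed
    define Gs where "Gs s t z = frechet_derivative ?F (at (?x (s, t), y (s, t), z))
        (fs (s, t), (1 / \<Theta> (s, t)) *\<^sub>R fst' (s, t) + (- \<Theta>s (s, t) / (\<Theta> (s, t))\<^sup>2) *\<^sub>R ft (s, t), 0) * \<Theta> (s, t)
      + \<Theta>s (s, t) * ?F (?x (s, t), y (s, t), z)" for s t z
    define Gz where "Gz s t z = D_z ?F (?x (s, t), y (s, t), z) * \<Theta> (s, t)" for s t z
    have gs: "((\<lambda>s. g s t z) has_real_derivative Gs s t z) (at s)" if p: "(s, t) \<in> W" for s t z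
    proof -
      have st: "s \<in> S" "t \<in> {a..b}"
        using p Wsub by auto
      have ds: "((\<lambda>s. 1 / \<Theta> (s, t)) has_real_derivative - \<Theta>s (s, t) / (\<Theta> (s, t))\<^sup>2) (at s)"
        using \<Theta>(4)[OF st] \<Theta>pos[OF p] by (auto intro!: derivative_eq_intros simp: power2_eq_square)
      have "((\<lambda>s. (?x (s, t), y (s, t), z)) has_vector_derivative
          (fs (s, t), (1 / \<Theta> (s, t)) *\<^sub>R fst' (s, t) + (- \<Theta>s (s, t) / (\<Theta> (s, t))\<^sup>2) *\<^sub>R ft (s, t), 0)) (at s)"
        unfolding y_def
        by (intro has_vector_derivative_Pair f(5)[OF p] has_vector_derivative_scaleR[OF ds f(7)[OF p]]
            has_vector_derivative_const)
      from DERIV_mult[OF has_real_derivative_compose[where \<xi> = "\<lambda>s. (?x (s, t), y (s, t), z)",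
            OF local_rep_has_derivative[OF \<phi> dom[OF p]] this] \<Theta>(4)[OF st]]
      have *: "((\<lambda>s. ?F (?x (s, t), y (s, t), z) * \<Theta> (s, t)) has_real_derivative Gs s t z) (at s)"
        unfolding Gs_def .
      have "continuous_on S (\<lambda>s. Y (s, t))"
        by (rule continuous_on_compose2[OF Yc]) (use st in \<open>auto intro!: continuous_on_Pair continuous_on_const continuous_on_id\<close>)
      then have O: "open (S \<inter> (\<lambda>s. Y (s, t)) -` fst \<phi>)"
        by (rule continuous_open_preimage[OF _ S chart(1)[OF \<phi>]])
      show ?thesis
        by (rule has_field_derivative_transform_within_open[OF * O])
          (use p st g in \<open>simp_all add: W_def\<close>)
    qed
    have gz: "(g s t has_real_derivative Gz s t z) (at z)" if p: "(s, t) \<in> W" for s t z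
    proof -
      have "((\<lambda>z. (?x (s, t), y (s, t), z)) has_vector_derivative (0, 0, 1)) (at z)"
        by (intro has_vector_derivative_Pair has_vector_derivative_const has_vector_derivative_id)
      from DERIV_cmult_right[OF has_real_derivative_compose[where \<xi> = "\<lambda>z. (?x (s, t), y (s, t), z)",
            OF local_rep_has_derivative[OF \<phi> dom[OF p]] this]]
      have "((\<lambda>z. ?F (?x (s, t), y (s, t), z) * \<Theta> (s, t)) has_real_derivative Gz s t z) (at z)"
        unfolding Gz_def D_z_def .
      moreover have "g s t = (\<lambda>z. ?F (?x (s, t), y (s, t), z) * \<Theta> (s, t))"
        using g[OF p] by (rule ext)
      ultimately show ?thesis
        by simp
    qed
    let ?V = "{p :: real \<times> real \<times> real. (fst p, fst (snd p)) \<in> W}"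
    have c: "continuous_on ?V (\<lambda>p. h (fst p, fst (snd p)))" if "continuous_on W h" for h :: "real \<times> real \<Rightarrow> 'z::topological_space"
      by (rule continuous_on_compose2[OF that]) (auto intro!: continuous_intros)
    have cY: "continuous_on W Y" "continuous_on W \<Theta>" "continuous_on W \<Theta>s"
      using Yc \<Theta>(1,2) Wsub by (auto intro: continuous_on_subset)
    have cx: "continuous_on W ?x"
      by (rule continuous_on_compose2[OF continuous_on_chart[OF \<phi>] cY(1)]) (use WY in blast)
    have nz: "\<Theta> p \<noteq> 0" if "p \<in> W" for p
      using \<Theta>pos[OF that] by simp
    have cy: "continuous_on W y"
      unfolding y_def by (intro continuous_intros cY f) (use nz in auto)
    have c3: "continuous_on W (\<lambda>p. (1 / \<Theta> p) *\<^sub>R fst' p)" "continuous_on W (\<lambda>p. (- \<Theta>s p / (\<Theta> p)\<^sup>2) *\<^sub>R ft p)"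
      by (intro continuous_intros cY f; use nz in auto)+
    have c\<xi>: "continuous_on ?V (\<lambda>p. (?x (fst p, fst (snd p)), y (fst p, fst (snd p)), snd (snd p)))"
      by (intro continuous_on_Pair c cx cy continuous_on_snd continuous_on_id)
    have d\<xi>: "(\<lambda>p. (?x (fst p, fst (snd p)), y (fst p, fst (snd p)), snd (snd p))) ` ?V \<subseteq> chart_dom \<phi>"
      using dom by blast
    have cF: "continuous_on ?V (\<lambda>p. ?F (?x (fst p, fst (snd p)), y (fst p, fst (snd p)), snd (snd p)))"
      by (rule continuous_on_compose2[OF continuous_on_local_rep[OF \<phi>] c\<xi> d\<xi>])
    have "continuous_on ?V (\<lambda>p. ?F (?x (fst p, fst (snd p)), y (fst p, fst (snd p)), snd (snd p)) * \<Theta> (fst p, fst (snd p)))"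
      by (intro continuous_on_mult cF c cY)
    then have cg: "continuous_on ?V (\<lambda>(s, t, z). g s t z)"
      by (rule continuous_on_eq) (auto simp: g)
    have "continuous_on ?V (\<lambda>p. Gs (fst p) (fst (snd p)) (snd (snd p)))"
      unfolding Gs_def
      by (intro continuous_on_add continuous_on_mult c[OF cY(2)] c[OF cY(3)] cF
          continuous_on_local_rep_deriv[OF \<phi> c\<xi> _ d\<xi>] continuous_on_Pair continuous_on_const c[OF f(1)]
          c[OF c3(1)] c[OF c3(2)])
    then have cgs: "continuous_on ?V (\<lambda>(s, t, z). deriv (\<lambda>s. g s t z) s)"
      by (rule continuous_on_eq) (auto simp: DERIV_imp_deriv[OF gs])
    have "continuous_on ?V (\<lambda>p. Gz (fst p) (fst (snd p)) (snd (snd p)))"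
      unfolding Gz_def D_z_def
      by (intro continuous_on_mult c[OF cY(2)] continuous_on_local_rep_deriv[OF \<phi> c\<xi> _ d\<xi>] continuous_on_const)
    then have cgz: "continuous_on ?V (\<lambda>(s, t, z). deriv (g s t) z)"
      by (rule continuous_on_eq) (auto simp: DERIV_imp_deriv[OF gz])
    show thesis
      by (rule that[OF f(1,2,5,6,9) g[unfolded y_def] gs[unfolded Gs_def y_def] gz[unfolded Gz_def y_def] cg cgs cgz])
  qed
qed

text \<open>The preimages of the charts under the family form a relatively open cover of the
  parameter rectangle. Continuity is local, so it follows from the statement in each chart.\<close>

lemma family_rate_continuously_differentiable:
  fixes Y :: "real \<times> real \<Rightarrow> 'q" and \<Theta> \<Theta>s :: "real \<times> real \<Rightarrow> real"
  assumes ab: "a < b" and S: "open S"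
    and Y: "manifold_Ck A 2 Y (S \<times> {a..b})"
    and \<Theta>: "continuous_on (S \<times> {a..b}) \<Theta>" "continuous_on (S \<times> {a..b}) \<Theta>s"
      "\<And>s t. s \<in> S \<Longrightarrow> t \<in> {a..b} \<Longrightarrow> 0 < \<Theta> (s, t)"
      "\<And>s t. s \<in> S \<Longrightarrow> t \<in> {a..b} \<Longrightarrow> ((\<lambda>s. \<Theta> (s, t)) has_real_derivative \<Theta>s (s, t)) (at s)"
  defines "g \<equiv> family_rate A L {a..b} Y \<Theta>"
  shows "continuous_on (S \<times> {a..b} \<times> UNIV) (\<lambda>(s, t, z). g s t z)"
    and "continuous_on (S \<times> {a..b} \<times> UNIV) (\<lambda>(s, t, z). deriv (\<lambda>s. g s t z) s)"
    and "continuous_on (S \<times> {a..b} \<times> UNIV) (\<lambda>(s, t, z). deriv (g s t) z)"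
    and "s \<in> S \<Longrightarrow> t \<in> {a..b} \<Longrightarrow> ((\<lambda>s. g s t z) has_real_derivative deriv (\<lambda>s. g s t z) s) (at s)"
    and "s \<in> S \<Longrightarrow> t \<in> {a..b} \<Longrightarrow> (g s t has_real_derivative deriv (g s t) z) (at z)"
proof -
  have Yc: "continuous_on (S \<times> {a..b}) Y"
    using Y by (simp add: manifold_Ck_def)
  note chart_facts = family_rate_chart[OF ab S _ Y \<Theta>, folded g_def]
  have cont: "continuous_on (S \<times> {a..b} \<times> UNIV) h"
    if h: "\<And>\<phi>. \<phi> \<in> A \<Longrightarrow> continuous_on {p. (fst p, fst (snd p)) \<in> (S \<times> {a..b}) \<inter> Y -` fst \<phi>} h"
    for h :: "real \<times> real \<times> real \<Rightarrow> real"
  proof (rule continuous_on_cover)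
    fix p :: "real \<times> real \<times> real" assume p: "p \<in> S \<times> {a..b} \<times> UNIV"
    obtain \<phi> where \<phi>: "\<phi> \<in> A" "Y (fst p, fst (snd p)) \<in> fst \<phi>"
      using chart_cover by blast
    obtain N where N: "open N" "(S \<times> {a..b}) \<inter> Y -` fst \<phi> = (S \<times> {a..b}) \<inter> N"
      using openin_chart_preimage[OF Yc \<phi>(1)] unfolding openin_open by blast
    let ?U = "(\<lambda>p :: real \<times> real \<times> real. (fst p, fst (snd p))) -` N"
    have "open ?U"
      by (intro open_vimage N continuous_intros)
    moreover have "(fst p, fst (snd p)) \<in> (S \<times> {a..b}) \<inter> N"
      unfolding N(2)[symmetric] using p \<phi>(2) by auto
    then have "p \<in> ?U"
      by simp
    moreover have "(S \<times> {a..b} \<times> UNIV) \<inter> ?U = {p. (fst p, fst (snd p)) \<in> (S \<times> {a..b}) \<inter> Y -` fst \<phi>}"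
      unfolding N(2) by (auto simp: mem_Times_iff)
    ultimately show "\<exists>U. open U \<and> p \<in> U \<and> continuous_on (S \<times> {a..b} \<times> UNIV \<inter> U) h"
      using h[OF \<phi>(1)] by (metis (no_types, lifting))
  qed
  show "continuous_on (S \<times> {a..b} \<times> UNIV) (\<lambda>(s, t, z). g s t z)"
    by (rule cont) (erule chart_facts, assumption)
  show "continuous_on (S \<times> {a..b} \<times> UNIV) (\<lambda>(s, t, z). deriv (\<lambda>s. g s t z) s)"
    by (rule cont) (erule chart_facts, assumption)
  show "continuous_on (S \<times> {a..b} \<times> UNIV) (\<lambda>(s, t, z). deriv (g s t) z)"
    by (rule cont) (erule chart_facts, assumption)
  assume st: "s \<in> S" "t \<in> {a..b}"
  obtain \<phi> where \<phi>: "\<phi> \<in> A" "Y (s, t) \<in> fst \<phi>"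
    using chart_cover by blast
  then have p: "(s, t) \<in> (S \<times> {a..b}) \<inter> Y -` fst \<phi>"
    using st by blast
  have "\<exists>d. ((\<lambda>s. g s t z) has_real_derivative d) (at s)" "\<exists>d. (g s t has_real_derivative d) (at z)"
    by (rule chart_facts[OF \<phi>(1)]; use p in blast)+
  then show "((\<lambda>s. g s t z) has_real_derivative deriv (\<lambda>s. g s t z) s) (at s)"
    "(g s t has_real_derivative deriv (g s t) z) (at z)"
    using DERIV_imp_deriv by metis+
qed

end

context curve_piece
begin

text \<open>
  The function \<open>H\<close> is \<open>\<mu> * (W + B)\<close>, where \<open>\<mu>\<close> is the integrating factor with \<open>\<mu> a = 1\<close> of the linear
  equation for the variation \<open>W\<close> of \<open>Z\<close>, and \<open>\<kappa> = \<mu> b\<close>.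
\<close>

lemma first_variation:
  fixes Y :: "real \<times> real \<Rightarrow> 'q" and \<Theta> \<Theta>s :: "real \<times> real \<Rightarrow> real" and \<delta> \<zeta> :: "real \<Rightarrow> real"
  assumes \<epsilon>: "0 < \<epsilon>"
    and Y: "manifold_Ck A 2 Y ({-\<epsilon><..<\<epsilon>} \<times> {a..b})" "\<And>t. t \<in> {a..b} \<Longrightarrow> Y (0, t) = q t"
    and \<Theta>: "continuous_on ({-\<epsilon><..<\<epsilon>} \<times> {a..b}) \<Theta>" "continuous_on ({-\<epsilon><..<\<epsilon>} \<times> {a..b}) \<Theta>s"
      "\<And>s t. s \<in> {-\<epsilon><..<\<epsilon>} \<Longrightarrow> t \<in> {a..b} \<Longrightarrow> 0 < \<Theta> (s, t)"
      "\<And>s t. s \<in> {-\<epsilon><..<\<epsilon>} \<Longrightarrow> t \<in> {a..b} \<Longrightarrow> ((\<lambda>s. \<Theta> (s, t)) has_real_derivative \<Theta>s (s, t)) (at s)"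
      "\<And>t. t \<in> {a..b} \<Longrightarrow> \<Theta> (0, t) = \<theta> t"
    and \<delta>: "\<And>t. t \<in> {a..b} \<Longrightarrow> (\<delta> has_real_derivative \<Theta>s (0, t)) (at t within {a..b})"
    and Zd: "\<And>t. t \<in> {a<..<b} \<Longrightarrow> (Z has_real_derivative rate t) (at t)"
    and \<zeta>: "(\<zeta> has_real_derivative \<zeta>') (at 0)" "\<zeta> 0 = Z a"
  defines "u \<equiv> \<lambda>t. velocity A (\<lambda>s. Y (s, t)) UNIV 0"
    and "g \<equiv> family_rate A L {a..b} Y \<Theta>"
  defines "B \<equiv> \<lambda>t. En t * \<delta> t - fibre_deriv L (lift t) (u t) (Z t)"
  obtains r Zs \<omega> H \<kappa> where "0 < r" "r \<le> \<epsilon>"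
    "\<And>s. s \<in> {-r<..<r} \<Longrightarrow> Zs s a = \<zeta> s"
    "\<And>s t. s \<in> {-r<..<r} \<Longrightarrow> t \<in> {a..b} \<Longrightarrow> (Zs s has_real_derivative g s t (Zs s t)) (at t within {a..b})"
    "\<And>t. t \<in> {a..b} \<Longrightarrow> Zs 0 t = Z t" "((\<lambda>s. Zs s b) has_real_derivative \<omega>) (at 0)"
    "continuous_on {a..b} H" "H a = \<zeta>' + B a" "0 < \<kappa>" "H b = \<kappa> * (\<omega> + B b)"
    "\<And>\<phi> t. \<phi> \<in> A \<Longrightarrow> t \<in> J \<phi> \<Longrightarrow> t \<in> {a<..<b} \<Longrightarrow> \<exists>m>0. (H has_real_derivative
       m * (\<Sum>j\<in>UNIV. el \<phi> j t * (snd (u t) \<phi> $ j - ydot \<phi> t $ j * \<delta> t))) (at t)"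
proof -
  let ?S = "{-\<epsilon><..<\<epsilon>}" and ?I = "{a..b}"
  have S: "open ?S" "0 \<in> ?S"
    using \<epsilon> by auto
  have Yc: "continuous_on (?S \<times> ?I) Y"
    using Y(1) by (simp add: manifold_Ck_def)
  note C1 = family_rate_continuously_differentiable[OF ab S(1) Y(1) \<Theta>(1-4), folded g_def]
  define gs where "gs s t z = deriv (\<lambda>s. g s t z) s" for s t z
  define gz where "gz s t z = deriv (g s t) z" for s t z
  note C1 = C1[folded gs_def gz_def]
  have vel0: "velocity A (\<lambda>t. Y (0, t)) ?I t = velocity A q ?I t" if "t \<in> ?I" for t
    by (rule velocity_cong[OF Y(2) that])
  have g0: "g 0 t (Z t) = rate t" if t: "t \<in> ?I" for t
    unfolding g_def family_rate_def rate_def lift_def vel0[OF t] \<Theta>(5)[OF t] ..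
  have Zd': "(Z has_real_derivative g 0 t (Z t)) (at t)" if "t \<in> {a<..<b}" for t
    using Zd[OF that] g0 that by simp
  show thesis
  proof (rule ode_differentiable_in_parameter[OF \<epsilon> ab C1(1-3) C1(4) C1(5) Z_cont Zd' \<zeta>])
    fix r Zs W
    assume r: "0 < r" "r \<le> \<epsilon>" and Zs: "\<And>s. s \<in> {-r<..<r} \<Longrightarrow> Zs s a = \<zeta> s"
      "\<And>s t. s \<in> {-r<..<r} \<Longrightarrow> t \<in> ?I \<Longrightarrow> (Zs s has_real_derivative g s t (Zs s t)) (at t within ?I)"
      and Z0: "\<And>t. t \<in> ?I \<Longrightarrow> Zs 0 t = Z t"
      and W: "W a = \<zeta>'"
      "\<And>t. t \<in> ?I \<Longrightarrow> (W has_real_derivative gz 0 t (Z t) * W t + gs 0 t (Z t)) (at t within ?I)"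
      and \<omega>: "((\<lambda>s. Zs s b) has_real_derivative W b) (at 0)"
    have cgz: "continuous_on ?I (\<lambda>t. gz 0 t (Z t))"
    proof -
      have "continuous_on ?I (\<lambda>t. (\<lambda>(s, t, z). gz s t z) (0, t, Z t))"
        by (rule continuous_on_compose2[OF C1(3)]) (use \<epsilon> in \<open>auto intro!: continuous_intros Z_cont\<close>)
      then show ?thesis by simp
    qed
    obtain \<mu> where \<mu>: "\<mu> a = 1" "\<And>t. 0 < \<mu> t"
      "\<And>t. t \<in> ?I \<Longrightarrow> (\<mu> has_real_derivative - gz 0 t (Z t) * \<mu> t) (at t within ?I)"
      using integrating_factor[OF cgz] by blast
    define P where "P t = fibre_deriv L (lift t) (u t) (Z t)" for t
    define H where "H t = \<mu> t * (W t + (En t * \<delta> t - P t))" for t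
    have chart_facts: "continuous_on (J \<phi>) P \<and> (\<forall>t\<in>J \<phi>. t \<in> {a<..<b} \<longrightarrow>
        (H has_real_derivative \<mu> t * \<theta> t *
          (\<Sum>j\<in>UNIV. el \<phi> j t * (snd (u t) \<phi> $ j - ydot \<phi> t $ j * \<delta> t))) (at t))"
      if \<phi>: "\<phi> \<in> A" for \<phi>
    proof (rule family_rate_chart[OF ab S(1) \<phi> Y(1) \<Theta>(1-4), folded g_def])
      let ?F = "local_rep A L \<phi>" and ?W = "(?S \<times> ?I) \<inter> Y -` fst \<phi>" and ?x = "\<lambda>p. snd \<phi> (Y p)"
      fix fs ft fst'
      assume cfs: "continuous_on ?W fs"
        and fs: "\<And>s t. (s, t) \<in> ?W \<Longrightarrow> ((\<lambda>s. ?x (s, t)) has_vector_derivative fs (s, t)) (at s)"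
        and ft: "\<And>s t. (s, t) \<in> ?W \<Longrightarrow> ((\<lambda>t. ?x (s, t)) has_vector_derivative ft (s, t)) (at t within ?I)"
        and fst': "\<And>s t. (s, t) \<in> ?W \<Longrightarrow> ((\<lambda>t. fs (s, t)) has_vector_derivative fst' (s, t)) (at t within ?I)"
        and ds: "\<And>s t z. (s, t) \<in> ?W \<Longrightarrow> ((\<lambda>s. g s t z) has_real_derivative
          frechet_derivative ?F (at (?x (s, t), (1 / \<Theta> (s, t)) *\<^sub>R ft (s, t), z))
            (fs (s, t), (1 / \<Theta> (s, t)) *\<^sub>R fst' (s, t) + (- \<Theta>s (s, t) / (\<Theta> (s, t))\<^sup>2) *\<^sub>R ft (s, t), 0) * \<Theta> (s, t)
          + \<Theta>s (s, t) * ?F (?x (s, t), (1 / \<Theta> (s, t)) *\<^sub>R ft (s, t), z)) (at s)"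
        and dz: "\<And>s t z. (s, t) \<in> ?W \<Longrightarrow> ((\<lambda>z. g s t z) has_real_derivative
          D_z ?F (?x (s, t), (1 / \<Theta> (s, t)) *\<^sub>R ft (s, t), z) * \<Theta> (s, t)) (at z)"
      have JW: "(0, t) \<in> ?W" "t \<in> ?I" "q t \<in> fst \<phi>" if "t \<in> J \<phi>" for t
        using that S(2) Y(2) by (auto simp: J_def)
      have pos: "0 < \<theta> t" if "t \<in> J \<phi>" for t
        using \<theta>_pos JW(2)[OF that] by blast
      have ft_eq: "ft (0, t) = \<theta> t *\<^sub>R ydot \<phi> t" if t: "t \<in> J \<phi>" for t
      proof -
        have "((\<lambda>t. snd \<phi> (q t)) has_vector_derivative ft (0, t)) (at t within ?I)"
          using has_vector_derivative_transform[OF JW(2)[OF t] _ ft[OF JW(1)[OF t]]] Y(2) by simp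
        then have "vector_derivative (snd \<phi> \<circ> q) (at t within ?I) = ft (0, t)"
          using vector_derivative_within[OF at_within_Icc_nonbot[OF ab JW(2)[OF t]]] by (simp add: o_def)
        then show ?thesis
          using pos[OF t] by (simp add: ydot_def)
      qed
      have \<xi>_eq: "(?x (0, t), (1 / \<Theta> (0, t)) *\<^sub>R ft (0, t), Z t) = \<xi> \<phi> t" if t: "t \<in> J \<phi>" for t
        using pos[OF t] JW[OF t] by (simp add: ft_eq[OF t] \<xi>_def Y(2) \<Theta>(5))
      have u_eq: "u t = tvec_of A \<phi> (snd \<phi> (q t)) (fs (0, t))" "snd (u t) \<phi> = fs (0, t)" if t: "t \<in> J \<phi>" for t
      proof -
        have "continuous_on ?S (\<lambda>s. Y (s, t))"
          by (rule continuous_on_compose2[OF Yc])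
            (use JW(2)[OF t] in \<open>auto intro!: continuous_on_Pair continuous_on_const continuous_on_id\<close>)
        then have "isCont (\<lambda>s. Y (s, t)) 0"
          using S by (simp add: continuous_on_eq_continuous_at)
        from velocity_eq_tvec_of[OF this UNIV_I _ \<phi>, of "fs (0, t)"]
        show "u t = tvec_of A \<phi> (snd \<phi> (q t)) (fs (0, t))"
          using fs[OF JW(1)[OF t]] JW[OF t] by (simp add: u_def o_def Y(2))
        show "snd (u t) \<phi> = fs (0, t)"
          using vector_derivative_at[OF fs[OF JW(1)[OF t]]] JW[OF t] \<phi>
          by (simp add: u_def velocity_def o_def Y(2))
      qed
      have P_eq: "P t = (\<Sum>j\<in>UNIV. mom \<phi> j t * fs (0, t) $ j)" if t: "t \<in> J \<phi>" for t
        unfolding P_def u_eq(1)[OF t] lift_eq[OF \<phi> t]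
        using JW(3)[OF t] by (simp add: fibre_deriv_tvec_of[OF \<phi>] mom_def \<xi>_def)
      have "continuous_on (J \<phi>) (\<lambda>t. fs (0, t))"
        by (rule continuous_on_compose2[OF cfs])
          (use JW(1) in \<open>auto intro!: continuous_on_Pair continuous_on_const continuous_on_id\<close>)
      then have "continuous_on (J \<phi>) (\<lambda>t. \<Sum>j\<in>UNIV. mom \<phi> j t * fs (0, t) $ j)"
        by (intro continuous_intros continuous_on_mom \<phi>)
      then have cP: "continuous_on (J \<phi>) P"
        by (rule continuous_on_eq) (simp add: P_eq)
      have dH: "(H has_real_derivative \<mu> t * \<theta> t *
          (\<Sum>j\<in>UNIV. el \<phi> j t * (snd (u t) \<phi> $ j - ydot \<phi> t $ j * \<delta> t))) (at t)"
        if t: "t \<in> J \<phi>" and t': "t \<in> {a<..<b}" for t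
      proof -
        have at: "at t within ?I = at t"
          using t' by (intro at_within_interior) auto
        have Z: "(Z has_real_derivative rate t) (at t within ?I)"
          using Zd[OF t'] at by simp
        let ?p' = "\<lambda>j. vector_derivative (mom \<phi> j) (at t within ?I)"
        have th: "\<theta> t \<noteq> 0"
          using pos[OF t] by simp
        define Dz where "Dz = D_z ?F (\<xi> \<phi> t)"
        define d where "d = \<Theta>s (0, t)"
        have gz_eq: "gz 0 t (Z t) = Dz * \<theta> t"
          using DERIV_imp_deriv[OF dz[OF JW(1)[OF t]]] \<xi>_eq[OF t] JW(2)[OF t]
          by (simp add: gz_def Dz_def \<Theta>(5))
        \<comment> \<open>A variation \<open>d\<close> of the time rate acts twice: through the
          factor \<Theta>, and through the velocity divided by \<Theta>. The two contributions add
          up to \<open>- d * En t\<close>, which is how the energy enters.\<close>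
        have "gs 0 t (Z t) = frechet_derivative ?F (at (\<xi> \<phi> t))
            (fs (0, t), (1 / \<theta> t) *\<^sub>R fst' (0, t) + (- d / (\<theta> t)\<^sup>2) *\<^sub>R (\<theta> t *\<^sub>R ydot \<phi> t), 0) * \<theta> t
            + d * ?F (\<xi> \<phi> t)"
          using DERIV_imp_deriv[OF ds[OF JW(1)[OF t]], of "Z t"] JW(2)[OF t]
          unfolding \<xi>_eq[OF t] by (simp add: gs_def d_def \<Theta>(5) ft_eq[OF t])
        also have "\<dots> = (\<Sum>j\<in>UNIV. D_q ?F j (\<xi> \<phi> t) * fs (0, t) $ j * \<theta> t + mom \<phi> j t *
            ((1 / \<theta> t) *\<^sub>R fst' (0, t) + (- d / (\<theta> t)\<^sup>2) *\<^sub>R (\<theta> t *\<^sub>R ydot \<phi> t)) $ j * \<theta> t) + d * ?F (\<xi> \<phi> t)"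
          unfolding local_rep_deriv_expand[OF \<phi> \<xi>_in_chart_dom[OF t]] mom_def[symmetric]
          by (simp only: distrib_right sum_distrib_right sum.distrib mult_zero_right mult_zero_left add_0_right)
        also have "\<dots> = (\<Sum>j\<in>UNIV. D_q ?F j (\<xi> \<phi> t) * fs (0, t) $ j * \<theta> t + mom \<phi> j t * fst' (0, t) $ j
            - d * (ydot \<phi> t $ j * mom \<phi> j t)) + d * ?F (\<xi> \<phi> t)"
        proof -
          have "mom \<phi> j t * ((1 / \<theta> t) *\<^sub>R fst' (0, t) + (- d / (\<theta> t)\<^sup>2) *\<^sub>R (\<theta> t *\<^sub>R ydot \<phi> t)) $ j * \<theta> t
              = mom \<phi> j t * fst' (0, t) $ j - d * (ydot \<phi> t $ j * mom \<phi> j t)" for j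
            using th by (simp add: power2_eq_square field_simps)
          then show ?thesis
            by (simp only: add_diff_eq)
        qed
        also have "\<dots> = (\<Sum>j\<in>UNIV. D_q ?F j (\<xi> \<phi> t) * fs (0, t) $ j * \<theta> t + mom \<phi> j t * fst' (0, t) $ j) - d * En t"
          unfolding En_eq(2)[OF \<phi> t] by (simp add: sum_subtractf sum_distrib_left algebra_simps)
        finally have gs_eq: "gs 0 t (Z t) = (\<Sum>j\<in>UNIV. D_q ?F j (\<xi> \<phi> t) * fs (0, t) $ j * \<theta> t
            + mom \<phi> j t * fst' (0, t) $ j) - d * En t" .
        have dfs: "((\<lambda>t. fs (0, t) $ j) has_real_derivative fst' (0, t) $ j) (at t within ?I)" for j
          using bounded_linear.has_vector_derivative[OF bounded_linear_vec_nth fst'[OF JW(1)[OF t]], of j]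
          by (simp add: has_real_derivative_iff_has_vector_derivative)
        have "((\<lambda>t. \<Sum>j\<in>UNIV. mom \<phi> j t * fs (0, t) $ j) has_real_derivative
            (\<Sum>j\<in>UNIV. ?p' j * fs (0, t) $ j + fst' (0, t) $ j * mom \<phi> j t)) (at t within J \<phi>)"
          unfolding at_within_openin[OF J_openin[OF \<phi>] t]
          by (intro DERIV_sum DERIV_mult mom_derivative[OF \<phi> t Z] dfs)
        then have "(P has_real_derivative (\<Sum>j\<in>UNIV. ?p' j * fs (0, t) $ j + fst' (0, t) $ j * mom \<phi> j t)) (at t within J \<phi>)"
          unfolding has_real_derivative_iff_has_vector_derivative
          by (rule has_vector_derivative_transform[OF t, rotated]) (rule P_eq)
        then have dP: "(P has_real_derivative (\<Sum>j\<in>UNIV. ?p' j * fs (0, t) $ j + fst' (0, t) $ j * mom \<phi> j t)) (at t within ?I)"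
          unfolding at_within_openin[OF J_openin[OF \<phi>] t] .
        define e where "e = (\<Sum>j\<in>UNIV. el \<phi> j t * ydot \<phi> t $ j)"
        have "(H has_real_derivative
            (- gz 0 t (Z t) * \<mu> t) * (W t + (En t * \<delta> t - P t)) +
            ((gz 0 t (Z t) * W t + gs 0 t (Z t)) + ((\<theta> t * (Dz * En t - e)) * \<delta> t + d * En t -
              (\<Sum>j\<in>UNIV. ?p' j * fs (0, t) $ j + fst' (0, t) $ j * mom \<phi> j t))) * \<mu> t) (at t within ?I)"
          unfolding H_def e_def Dz_def d_def
          by (intro DERIV_mult DERIV_add DERIV_diff \<mu> W JW(2)[OF t] En_derivative[OF \<phi> t Z] dP \<delta>)
        \<comment> \<open>The derivative of the integrating factor removes the terms with
          \<open>Dz\<close> in \<open>W\<close>, in the energy and in the momentum, and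
          \<open>d * En t\<close> cancels against the same term in \<open>gs\<close>; only multiples
          of \<open>el\<close> survive.\<close>
        moreover have "(- gz 0 t (Z t) * \<mu> t) * (W t + (En t * \<delta> t - P t)) +
            ((gz 0 t (Z t) * W t + gs 0 t (Z t)) + ((\<theta> t * (Dz * En t - e)) * \<delta> t + d * En t -
              (\<Sum>j\<in>UNIV. ?p' j * fs (0, t) $ j + fst' (0, t) $ j * mom \<phi> j t))) * \<mu> t =
            \<mu> t * \<theta> t * (\<Sum>j\<in>UNIV. el \<phi> j t * (snd (u t) \<phi> $ j - ydot \<phi> t $ j * \<delta> t))"
        proof -
          have p': "?p' j = \<theta> t * (D_q ?F j (\<xi> \<phi> t) + mom \<phi> j t * Dz - el \<phi> j t)" for j
            using th by (simp add: el_def Dz_def)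
          have e1: "(\<Sum>j\<in>UNIV. ?p' j * fs (0, t) $ j + fst' (0, t) $ j * mom \<phi> j t) =
              gs 0 t (Z t) + d * En t + \<theta> t * Dz * P t - \<theta> t * (\<Sum>j\<in>UNIV. el \<phi> j t * fs (0, t) $ j)"
            unfolding p' gs_eq P_eq[OF t]
            by (simp add: algebra_simps sum.distrib sum_subtractf sum_distrib_left)
          have e2: "(\<Sum>j\<in>UNIV. el \<phi> j t * (snd (u t) \<phi> $ j - ydot \<phi> t $ j * \<delta> t)) =
              (\<Sum>j\<in>UNIV. el \<phi> j t * fs (0, t) $ j) - e * \<delta> t"
            unfolding e_def u_eq(2)[OF t]
            by (simp add: right_diff_distrib sum_subtractf sum_distrib_right mult.assoc)
          show ?thesis
            unfolding gz_eq e1 e2 by (simp add: algebra_simps)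
        qed
        ultimately show ?thesis
          unfolding at by simp
      qed
      show ?thesis
        using cP dH by blast
    qed
    have cP: "continuous_on ?I P"
    proof (rule continuous_on_cover)
      fix t assume t: "t \<in> ?I"
      obtain \<phi> where \<phi>: "\<phi> \<in> A" "q t \<in> fst \<phi>"
        using chart_cover by blast
      obtain U where U: "open U" "J \<phi> = ?I \<inter> U"
        using J_openin[OF \<phi>(1)] unfolding openin_open by blast
      have "continuous_on (?I \<inter> U) P"
        using chart_facts[OF \<phi>(1)] unfolding U(2) by blast
      moreover have "t \<in> ?I \<inter> U"
        unfolding U(2)[symmetric] J_def using t \<phi>(2) by blast
      ultimately show "\<exists>U. open U \<and> t \<in> U \<and> continuous_on (?I \<inter> U) P"
        using U(1) by blast
    qed
    have cH: "continuous_on ?I H"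
      unfolding H_def
      by (intro continuous_on_mult continuous_on_add continuous_on_diff continuous_on_En cP
          DERIV_continuous_on[OF \<mu>(3)] DERIV_continuous_on[OF W(2)] DERIV_continuous_on[OF \<delta>])
    have dH: "\<exists>m>0. (H has_real_derivative
        m * (\<Sum>j\<in>UNIV. el \<phi> j t * (snd (u t) \<phi> $ j - ydot \<phi> t $ j * \<delta> t))) (at t)"
      if "\<phi> \<in> A" "t \<in> J \<phi>" "t \<in> {a<..<b}" for \<phi> t
    proof (intro exI[of _ "\<mu> t * \<theta> t"] conjI)
      show "0 < \<mu> t * \<theta> t"
        using \<mu>(2) \<theta>_pos that(3) by auto
      show "(H has_real_derivative \<mu> t * \<theta> t *
          (\<Sum>j\<in>UNIV. el \<phi> j t * (snd (u t) \<phi> $ j - ydot \<phi> t $ j * \<delta> t))) (at t)"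
        using chart_facts[OF that(1)] that(2,3) by blast
    qed
    show thesis
      by (rule that[OF r Zs Z0 \<omega> cH _ \<mu>(2)[of b] _ dH]) (simp_all add: H_def B_def P_def \<mu>(1) W(1))
  qed
qed

end

section \<open>Construction of variations\<close>

lemma Ck_on_pospart_power:
  "Ck_on k (\<lambda>x::real. max 0 x ^ Suc k) UNIV"
proof (induction k)
  case 0
  then show ?case by (auto intro!: continuous_intros)
next
  case (Suc k)
  show ?case
  proof (rule Ck_on_real_SucI[OF thick_UNIV])
    fix x :: real
    consider "x > 0" | "x < 0" | "x = 0" by linarith
    then show "((\<lambda>x. max 0 x ^ Suc (Suc k)) has_vector_derivative real (Suc (Suc k)) * max 0 x ^ Suc k) (at x within UNIV)"
    proof cases
      case 1
      have "((\<lambda>x. x ^ Suc (Suc k)) has_vector_derivative real (Suc (Suc k)) * max 0 x ^ Suc k) (at x)"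
        unfolding has_real_derivative_iff_has_vector_derivative[symmetric]
        using DERIV_pow[of "Suc (Suc k)" x] 1 by (simp add: max_def)
      then show ?thesis
        by (rule has_vector_derivative_transform_within_open[of _ _ _ "{0<..}"]) (use 1 in auto)
    next
      case 2
      have "((\<lambda>x. 0) has_vector_derivative real (Suc (Suc k)) * max 0 x ^ Suc k) (at x)"
        using 2 by simp
      then show ?thesis
        by (rule has_vector_derivative_transform_within_open[of _ _ _ "{..<0}"]) (use 2 in auto)
    next
      case 3
      \<comment> \<open>At the kink the difference quotient is at most \<bar>h\<bar> ^ Suc k, so the
        derivative there is 0 and fits both sides.\<close>
      have "((\<lambda>h::real. max 0 h ^ Suc (Suc k) / h) \<longlongrightarrow> 0) (at 0)"
      proof (rule Lim_null_comparison)
        show "\<forall>\<^sub>F h in at 0. norm (max 0 h ^ Suc (Suc k) / h) \<le> \<bar>h\<bar> ^ Suc k"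
        proof (intro always_eventually allI)
          fix h :: real
          show "norm (max 0 h ^ Suc (Suc k) / h) \<le> \<bar>h\<bar> ^ Suc k"
          proof (cases "h > 0")
            case False
            then have "norm (max 0 h ^ Suc (Suc k) / h) = 0"
              by (simp add: max_def)
            also have "0 \<le> \<bar>h\<bar> ^ Suc k"
              by (rule zero_le_power[OF abs_ge_zero])
            finally show ?thesis .
          qed simp
        qed
        show "((\<lambda>h::real. \<bar>h\<bar> ^ Suc k) \<longlongrightarrow> 0) (at 0)"
          by (auto intro!: tendsto_eq_intros)
      qed
      then show ?thesis
        using 3 by (simp add: has_field_derivative_iff flip: has_real_derivative_iff_has_vector_derivative)
    qed
  next
    show "Ck_on k (\<lambda>x. real (Suc (Suc k)) * max 0 x ^ Suc k) UNIV"
      by (intro Ck_on_mult Ck_on_const thick_UNIV Suc.IH)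
  qed
qed

text \<open>The cube is the power for which \<open>Ck_on_pospart_power\<close> yields class C^2, the
  class of configuration paths. The value 1 at the centre lets the displacement at time
  \<open>c\<close> be prescribed exactly.\<close>

definition bump :: "real \<Rightarrow> real \<Rightarrow> real \<Rightarrow> real" where
  "bump c r t = max 0 (1 - ((t - c) / r)\<^sup>2) ^ 3"

lemma Ck_on_bump: "Ck_on 2 (bump c r) UNIV"
proof -
  have "Ck_on 2 (\<lambda>t. t - c) UNIV"
    using Ck_on_add[OF thick_UNIV Ck_on_bounded_linear[OF bounded_linear_ident thick_UNIV] Ck_on_const[OF thick_UNIV], of 2 "- c"]
    by simp
  then have "Ck_on 2 (\<lambda>t. 1 + (-1) * ((1 / r) * (t - c)) ^ 2) UNIV"
    by (intro Ck_on_add Ck_on_mult Ck_on_power Ck_on_const thick_UNIV)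
  then have "Ck_on 2 (\<lambda>t. 1 - ((t - c) / r)\<^sup>2) UNIV"
    by simp
  from Ck_on_compose[OF thick_UNIV subset_UNIV Ck_on_pospart_power this]
  show ?thesis
    unfolding bump_def by (simp add: numeral_3_eq_3 numeral_2_eq_2)
qed

lemma bump_simps: "bump c r c = 1" "0 \<le> bump c r t" "bump c r t \<le> 1" "0 < r \<Longrightarrow> r \<le> \<bar>t - c\<bar> \<Longrightarrow> bump c r t = 0"
proof -
  show "bump c r c = 1" "0 \<le> bump c r t"
    by (simp_all add: bump_def)
  show "bump c r t \<le> 1"
    unfolding bump_def by (rule power_le_one) auto
  assume "0 < r" "r \<le> \<bar>t - c\<bar>"
  then have "1 \<le> ((t - c) / r)\<^sup>2"
    by (simp add: power_divide abs_le_square_iff[symmetric])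
  then show "bump c r t = 0"
    by (simp add: bump_def)
qed

section \<open>Deformations of a path inside one chart\<close>

lemma (in smooth_mfd) manifold_Ck_slice:
  fixes Y :: "real \<times> real \<Rightarrow> 'q"
  assumes "manifold_Ck A k Y (S \<times> {a..b})" "s \<in> S" "a < b"
  shows "manifold_Ck A k (\<lambda>t. Y (s, t)) {a..b}"
  unfolding manifold_Ck_def
proof (intro conjI ballI)
  have c: "continuous_on (S \<times> {a..b}) Y"
    using assms(1) by (simp add: manifold_Ck_def)
  show c': "continuous_on {a..b} (\<lambda>t. Y (s, t))"
    by (rule continuous_on_compose2[OF c]) (use assms(2) in \<open>auto intro!: continuous_on_Pair continuous_on_const continuous_on_id\<close>)
  fix \<phi> assume \<phi>: "\<phi> \<in> A"
  have th: "thick ({a..b} \<inter> (\<lambda>t. Y (s, t)) -` fst \<phi>)"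
    by (rule thick_openin[OF thick_Icc[OF assms(3)] openin_chart_preimage[OF c' \<phi>]])
  have "Ck_on k (\<lambda>t. (snd \<phi> \<circ> Y) (s, t)) ({a..b} \<inter> (\<lambda>t. Y (s, t)) -` fst \<phi>)"
  proof (rule Ck_on_compose[OF th, where f = "snd \<phi> \<circ> Y" and g = "Pair s"])
    show "Ck_on k (snd \<phi> \<circ> Y) ((S \<times> {a..b}) \<inter> Y -` fst \<phi>)"
      using assms(1) \<phi> unfolding manifold_Ck_def by blast
    show "Ck_on k (Pair s) ({a..b} \<inter> (\<lambda>t. Y (s, t)) -` fst \<phi>)"
      by (intro Ck_on_Pair th Ck_on_const Ck_on_bounded_linear bounded_linear_ident)
  qed (use assms(2) in auto)
  then show "Ck_on k (snd \<phi> \<circ> (\<lambda>t. Y (s, t))) ({a..b} \<inter> (\<lambda>t. Y (s, t)) -` fst \<phi>)"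
    by (simp add: o_def)
qed

lemma (in smooth_mfd) manifold_Ck_snd:
  fixes q :: "real \<Rightarrow> 'q" and S :: "real set"
  assumes "manifold_Ck A k q {a..b}" "open S" "a < b"
  shows "manifold_Ck A k (\<lambda>p. q (snd p)) (S \<times> {a..b})"
  unfolding manifold_Ck_def
proof (intro conjI ballI)
  have c: "continuous_on {a..b} q"
    using assms(1) by (simp add: manifold_Ck_def)
  show c': "continuous_on (S \<times> {a..b}) (\<lambda>p. q (snd p))"
    by (rule continuous_on_compose2[OF c]) (auto intro!: continuous_on_snd continuous_on_id)
  fix \<phi> assume \<phi>: "\<phi> \<in> A"
  have th: "thick (S \<times> {a..b} \<inter> (\<lambda>p. q (snd p)) -` fst \<phi>)"
    by (rule thick_openin[OF thick_Times[OF thick_open[OF assms(2)] thick_Icc[OF assms(3)]] openin_chart_preimage[OF c' \<phi>]])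
  have "Ck_on k (\<lambda>p. (snd \<phi> \<circ> q) (snd p)) (S \<times> {a..b} \<inter> (\<lambda>p. q (snd p)) -` fst \<phi>)"
  proof (rule Ck_on_compose[OF th, where f = "snd \<phi> \<circ> q" and g = snd])
    show "Ck_on k (snd \<phi> \<circ> q) ({a..b} \<inter> q -` fst \<phi>)"
      using assms(1) \<phi> unfolding manifold_Ck_def by blast
    show "Ck_on k snd (S \<times> {a..b} \<inter> (\<lambda>p. q (snd p)) -` fst \<phi>)"
      by (intro th Ck_on_bounded_linear bounded_linear_snd)
  qed auto
  then show "Ck_on k (snd \<phi> \<circ> (\<lambda>p. q (snd p))) (S \<times> {a..b} \<inter> (\<lambda>p. q (snd p)) -` fst \<phi>)"
    by (simp add: o_def)
qed

text \<open>The coordinate displacement \<open>\<beta> s\<close> is scaled by a bump that vanishes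
  for \<open>\<bar>t - c\<bar> \<ge> r\<close>, but the chart formula is used up to
  \<open>2 * r\<close>. The regions \<open>\<bar>t - c\<bar> < 2 * r\<close> and
  \<open>r < \<bar>t - c\<bar>\<close> are then open, cover all times, and overlap where the path is
  unchanged, so that regularity never has to be checked at a seam.\<close>

definition chart_variation ::
  "('q, 'n::finite) chart \<Rightarrow> real \<Rightarrow> real \<Rightarrow> (real \<Rightarrow> real ^ 'n) \<Rightarrow> (real \<Rightarrow> 'q) \<Rightarrow> real \<Rightarrow> real \<Rightarrow> 'q" where
  "chart_variation \<phi> c r \<beta> q s t =
     (if \<bar>t - c\<bar> < 2 * r then chart_inv \<phi> (snd \<phi> (q t) + bump c r t *\<^sub>R \<beta> s) else q t)"

lemma (in smooth_mfd) chart_variation_outside: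
  assumes "\<phi> \<in> A" "0 < r" "\<And>t. t \<in> {a..b} \<Longrightarrow> \<bar>t - c\<bar> < 2 * r \<Longrightarrow> q t \<in> fst \<phi>" "t \<in> {a..b}" "r \<le> \<bar>t - c\<bar>"
  shows "chart_variation \<phi> c r \<beta> q s t = q t"
  using assms bump_simps(4)[OF assms(2,5)] by (auto simp: chart_variation_def)

text \<open>In an arbitrary chart \<psi>, the inner region shows a transition map composed with a
  C^2 coordinate expression, and the outer region shows the path itself; \<open>Ck_on_local\<close>
  joins the two.\<close>

lemma (in smooth_mfd) manifold_Ck_chart_variation:
  assumes ab: "a < b" and q: "manifold_Ck A 2 q {a..b}" and \<phi>: "\<phi> \<in> A" and r: "0 < r"
    and dom: "\<And>t. t \<in> {a..b} \<Longrightarrow> \<bar>t - c\<bar> < 2 * r \<Longrightarrow> q t \<in> fst \<phi>"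
    and S: "open S" and \<beta>: "Ck_on 2 \<beta> S"
    and img: "\<And>s t. s \<in> S \<Longrightarrow> t \<in> {a..b} \<Longrightarrow> \<bar>t - c\<bar> < 2 * r \<Longrightarrow>
      snd \<phi> (q t) + bump c r t *\<^sub>R \<beta> s \<in> snd \<phi> ` fst \<phi>"
  shows "manifold_Ck A 2 (\<lambda>p. chart_variation \<phi> c r \<beta> q (fst p) (snd p)) (S \<times> {a..b})"
proof -
  let ?P = "S \<times> {a..b}"
  let ?G = "\<lambda>p. chart_variation \<phi> c r \<beta> q (fst p) (snd p)"
  let ?h = "\<lambda>p. snd \<phi> (q (snd p)) + bump c r (snd p) *\<^sub>R \<beta> (fst p)"
  let ?R1 = "{p :: real \<times> real. \<bar>snd p - c\<bar> < 2 * r}" and ?R2 = "{p :: real \<times> real. r < \<bar>snd p - c\<bar>}"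
  have o: "open ?R1" "open ?R2"
    by (intro open_Collect_less continuous_intros)+
  have cover: "p \<in> ?R1 \<or> p \<in> ?R2" for p
    using r by auto
  have thP: "thick ?P"
    by (intro thick_Times thick_open S thick_Icc ab)
  have qc: "continuous_on {a..b} q"
    using q by (simp add: manifold_Ck_def)
  have C2q: "Ck_on 2 (snd \<phi> \<circ> q) ({a..b} \<inter> q -` fst \<phi>)"
    using q \<phi> unfolding manifold_Ck_def by blast
  have G1: "?G p = chart_inv \<phi> (?h p)" if "p \<in> ?R1" for p
    using that by (simp add: chart_variation_def)
  have G2: "?G p = q (snd p)" if "p \<in> ?P \<inter> ?R2" for p
    by (rule chart_variation_outside[OF \<phi> r dom]) (use that in auto)
  have h: "Ck_on 2 ?h T" if T: "thick T" "T \<subseteq> ?P \<inter> ?R1" for T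
  proof (intro Ck_on_add Ck_on_scaleR T)
    have Tp: "snd p \<in> {a..b}" "\<bar>snd p - c\<bar> < 2 * r" if "p \<in> T" for p
      using T(2) that by auto
    have "Ck_on 2 (\<lambda>p. (snd \<phi> \<circ> q) (snd p)) T"
      by (rule Ck_on_compose[OF T(1) _ C2q Ck_on_bounded_linear[OF bounded_linear_snd T(1)]])
        (use Tp dom in blast)
    then show "Ck_on 2 (\<lambda>p. snd \<phi> (q (snd p))) T"
      by simp
    show "Ck_on 2 (\<lambda>p. bump c r (snd p)) T"
      by (rule Ck_on_compose[OF T(1) subset_UNIV Ck_on_bump Ck_on_bounded_linear[OF bounded_linear_snd T(1)]])
    show "Ck_on 2 (\<lambda>p. \<beta> (fst p)) T"
      by (rule Ck_on_compose[OF T(1) _ \<beta> Ck_on_bounded_linear[OF bounded_linear_fst T(1)]]) (use T(2) in auto)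
  qed
  have hdom: "?h p \<in> snd \<phi> ` fst \<phi>" if "p \<in> ?P \<inter> ?R1" for p
    using img[of "fst p" "snd p"] that by auto
  have cG: "continuous_on ?P ?G"
  proof (rule continuous_on_cover)
    fix p assume p: "p \<in> ?P"
    have "continuous_on (?P \<inter> ?R1) (\<lambda>p. chart_inv \<phi> (?h p))"
      by (rule continuous_on_compose2[OF continuous_on_chart_inv[OF \<phi>] Ck_on_imp_continuous_on[OF h]])
        (use thick_open_Int[OF thP o(1)] hdom in blast)+
    then have c1: "continuous_on (?P \<inter> ?R1) ?G"
      by (rule continuous_on_eq) (simp add: G1)
    have "continuous_on (?P \<inter> ?R2) (\<lambda>p. q (snd p))"
      by (rule continuous_on_compose2[OF qc]) (auto intro!: continuous_on_snd continuous_on_id)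
    then have c2: "continuous_on (?P \<inter> ?R2) ?G"
      by (rule continuous_on_eq) (simp add: G2)
    show "\<exists>U. open U \<and> p \<in> U \<and> continuous_on (?P \<inter> U) ?G"
      using cover[of p] c1 c2 o by blast
  qed
  have "Ck_on 2 (snd \<psi> \<circ> ?G) (?P \<inter> ?G -` fst \<psi>)" if \<psi>: "\<psi> \<in> A" for \<psi>
  proof (rule Ck_on_local)
    fix p assume p: "p \<in> ?P \<inter> ?G -` fst \<psi>"
    let ?V = "?P \<inter> ?G -` fst \<psi>"
    have thV: "thick ?V"
      by (rule thick_openin[OF thP openin_chart_preimage[OF cG \<psi>]])
    have t1: "thick (?V \<inter> ?R1)" and t2: "thick (?V \<inter> ?R2)"
      using thick_open_Int[OF thV] o by blast+
    have h_im: "?h ` (?V \<inter> ?R1) \<subseteq> snd \<phi> ` (fst \<phi> \<inter> fst \<psi>)"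
    proof
      fix x assume "x \<in> ?h ` (?V \<inter> ?R1)"
      then obtain p where p: "p \<in> ?V \<inter> ?R1" and x: "x = ?h p"
        by blast
      then have d: "x \<in> snd \<phi> ` fst \<phi>" and "chart_inv \<phi> x \<in> fst \<psi>"
        using hdom[of p] G1[of p] by auto
      then show "x \<in> snd \<phi> ` (fst \<phi> \<inter> fst \<psi>)"
        using chart_chart_inv[OF \<phi> d] by (metis IntI image_eqI)
    qed
    have "Ck_on 2 (\<lambda>p. (snd \<psi> \<circ> chart_inv \<phi>) (?h p)) (?V \<inter> ?R1)"
      by (rule Ck_on_compose[OF t1 h_im Ck_on_transition[OF \<phi> \<psi>] h[OF t1]]) blast
    then have c1: "Ck_on 2 (snd \<psi> \<circ> ?G) (?V \<inter> ?R1)"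
      by (rule Ck_on_cong[THEN iffD1, rotated]) (simp add: G1)
    have C2\<psi>: "Ck_on 2 (snd \<psi> \<circ> q) ({a..b} \<inter> q -` fst \<psi>)"
      using q \<psi> unfolding manifold_Ck_def by blast
    have "Ck_on 2 (\<lambda>p. (snd \<psi> \<circ> q) (snd p)) (?V \<inter> ?R2)"
      by (rule Ck_on_compose[OF t2 _ C2\<psi> Ck_on_bounded_linear[OF bounded_linear_snd t2]])
        (use G2 in auto)
    then have c2: "Ck_on 2 (snd \<psi> \<circ> ?G) (?V \<inter> ?R2)"
      by (rule Ck_on_cong[THEN iffD1, rotated]) (use G2 in auto)
    show "\<exists>U. open U \<and> p \<in> U \<and> Ck_on 2 (snd \<psi> \<circ> ?G) (?V \<inter> U)"
      using cover[of p] c1 c2 o by blast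
  qed
  then show ?thesis
    using cG unfolding manifold_Ck_def by blast
qed

lemma velocity_const: "velocity A (\<lambda>s. p) UNIV 0 = (p, \<lambda>_. 0)"
proof -
  have "vector_derivative (snd \<psi> \<circ> (\<lambda>s. p)) (at 0) = 0" for \<psi> :: "('a, 'b) chart"
    by (simp add: o_def)
  then show ?thesis
    unfolding velocity_def by (simp only: if_cancel)
qed

context smooth_mfd
begin

lemma chart_variation_velocity:
  assumes \<phi>: "\<phi> \<in> A" and t: "\<bar>t - c\<bar> < 2 * r" and q: "q t \<in> fst \<phi>"
    and S: "open S" "0 \<in> S" and \<beta>: "continuous_on S \<beta>" "\<beta> 0 = 0" "(\<beta> has_vector_derivative v) (at 0)"
    and img: "\<And>s. s \<in> S \<Longrightarrow> snd \<phi> (q t) + bump c r t *\<^sub>R \<beta> s \<in> snd \<phi> ` fst \<phi>"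
  defines "u \<equiv> velocity A (\<lambda>s. chart_variation \<phi> c r \<beta> q s t) UNIV 0"
  shows "u = tvec_of A \<phi> (snd \<phi> (q t)) (bump c r t *\<^sub>R v)" "u \<in> tangent_bundle A"
    "snd u \<phi> = bump c r t *\<^sub>R v" "fst u = q t"
proof -
  let ?h = "\<lambda>s. snd \<phi> (q t) + bump c r t *\<^sub>R \<beta> s"
  let ?\<gamma> = "\<lambda>s. chart_variation \<phi> c r \<beta> q s t"
  have \<gamma>: "?\<gamma> s = chart_inv \<phi> (?h s)" for s
    using t by (simp add: chart_variation_def)
  have \<gamma>0: "?\<gamma> 0 = q t"
    unfolding \<gamma> \<beta>(2) using \<phi> q by simp
  have "continuous_on S ?\<gamma>"
    unfolding \<gamma>
    by (rule continuous_on_compose2[OF continuous_on_chart_inv[OF \<phi>]])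
      (use img in \<open>auto intro!: continuous_intros \<beta>\<close>)
  then have cont: "isCont ?\<gamma> 0"
    using S by (simp add: continuous_on_eq_continuous_at)
  have "(?h has_vector_derivative 0 + bump c r t *\<^sub>R v) (at 0)"
    by (intro has_vector_derivative_add has_vector_derivative_const
        bounded_linear.has_vector_derivative[OF bounded_linear_scaleR_right] \<beta>(3))
  then have "(snd \<phi> \<circ> ?\<gamma> has_vector_derivative 0 + bump c r t *\<^sub>R v) (at 0)"
    by (rule has_vector_derivative_transform_within_open[OF _ S])
      (simp only: o_def \<gamma> chart_chart_inv(1)[OF \<phi> img])
  then have d: "(snd \<phi> \<circ> ?\<gamma> has_vector_derivative bump c r t *\<^sub>R v) (at 0)"
    by simp
  have dom: "?\<gamma> 0 \<in> fst \<phi>"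
    unfolding \<gamma>0 by (rule q)
  show "u = tvec_of A \<phi> (snd \<phi> (q t)) (bump c r t *\<^sub>R v)"
    using velocity_eq_tvec_of[OF cont UNIV_I _ \<phi> dom d] unfolding u_def \<gamma>0 by simp
  show "u \<in> tangent_bundle A"
    using velocity_in_tangent_bundle[OF cont UNIV_I _ \<phi> dom d] unfolding u_def by simp
  show "snd u \<phi> = bump c r t *\<^sub>R v" "fst u = q t"
    using vector_derivative_at[OF d] dom \<phi> unfolding u_def velocity_def \<gamma>0 by simp_all
qed

text \<open>In the chart \<psi> the field is the bump times a transition derivative applied to a
  constant vector, hence as regular as path and bump allow. The order \<open>k\<close> is left open
  because the field is needed with class C^2 on each piece but only continuous across the
  impact.\<close>

lemma Ck_on_variation_field:
  assumes ab: "a < b" and qc: "continuous_on {a..b} q" and \<phi>: "\<phi> \<in> A" and \<psi>: "\<psi> \<in> A" and r: "0 < r" and k: "k \<le> 2"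
    and C: "Ck_on k (snd \<phi> \<circ> q) ({a..b} \<inter> q -` fst \<phi>)"
    and dom: "\<And>t. t \<in> {a..b} \<Longrightarrow> \<bar>t - c\<bar> < 2 * r \<Longrightarrow> q t \<in> fst \<phi>"
    and u1: "\<And>t. t \<in> {a..b} \<Longrightarrow> \<bar>t - c\<bar> < 2 * r \<Longrightarrow> u t = tvec_of A \<phi> (snd \<phi> (q t)) (bump c r t *\<^sub>R v)"
    and u2: "\<And>t. t \<in> {a..b} \<Longrightarrow> r \<le> \<bar>t - c\<bar> \<Longrightarrow> u t = (q t, \<lambda>_. 0)"
  shows "Ck_on k (\<lambda>t. snd (u t) \<psi>) ({a..b} \<inter> q -` fst \<psi>)"
proof (rule Ck_on_local)
  let ?V = "{a..b} \<inter> q -` fst \<psi>" and ?R1 = "{t. \<bar>t - c\<bar> < 2 * r}" and ?R2 = "{t. r < \<bar>t - c\<bar>}"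
  fix t assume t: "t \<in> ?V"
  have o: "open ?R1" "open ?R2"
    by (intro open_Collect_less continuous_intros)+
  have cover: "t \<in> ?R1 \<or> t \<in> ?R2"
    using r by auto
  have thV: "thick ?V"
    by (rule thick_openin[OF thick_Icc[OF ab] openin_chart_preimage[OF qc \<psi>]])
  have t1: "thick (?V \<inter> ?R1)" and t2: "thick (?V \<inter> ?R2)"
    using thick_open_Int[OF thV] o by blast+
  have im: "(\<lambda>t. snd \<phi> (q t)) ` (?V \<inter> ?R1) \<subseteq> snd \<phi> ` (fst \<phi> \<inter> fst \<psi>)"
    using dom by blast
  have "Ck_on k (snd \<phi> \<circ> q) (?V \<inter> ?R1)"
    by (rule Ck_on_subset[OF C _ t1]) (use dom in blast)
  then have cq: "Ck_on k (\<lambda>t. snd \<phi> (q t)) (?V \<inter> ?R1)"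
    by (simp add: o_def)
  have "Ck_on k (\<lambda>t. transition_deriv \<phi> \<psi> (snd \<phi> (q t)) v) (?V \<inter> ?R1)"
    by (rule Ck_on_compose[OF t1 im Ck_on_frechet_derivative_open[OF Ck_on_transition[OF \<phi> \<psi>] open_overlap[OF \<phi> \<psi>]] cq])
  then have "Ck_on k (\<lambda>t. bump c r t *\<^sub>R transition_deriv \<phi> \<psi> (snd \<phi> (q t)) v) (?V \<inter> ?R1)"
    by (intro Ck_on_scaleR t1 Ck_on_subset[OF Ck_on_mono[OF Ck_on_bump k]] subset_UNIV)
  moreover have "bump c r t *\<^sub>R transition_deriv \<phi> \<psi> (snd \<phi> (q t)) v = snd (u t) \<psi>" if "t \<in> ?V \<inter> ?R1" for t
  proof -
    have t: "t \<in> {a..b}" "\<bar>t - c\<bar> < 2 * r" "q t \<in> fst \<psi>"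
      using that by auto
    have "snd (u t) \<psi> = transition_deriv \<phi> \<psi> (snd \<phi> (q t)) (bump c r t *\<^sub>R v)"
      unfolding u1[OF t(1,2)] tvec_of_def Let_def chart_inv_chart[OF \<phi> dom[OF t(1,2)]] using t(3) \<psi> by simp
    then show ?thesis
      using linear_scale[OF linear_transition_deriv[OF \<phi> \<psi> dom[OF t(1,2)] t(3)]] by simp
  qed
  ultimately have c1: "Ck_on k (\<lambda>t. snd (u t) \<psi>) (?V \<inter> ?R1)"
    using Ck_on_cong[of "?V \<inter> ?R1" "\<lambda>t. bump c r t *\<^sub>R transition_deriv \<phi> \<psi> (snd \<phi> (q t)) v"
        "\<lambda>t. snd (u t) \<psi>" k] by blast
  have c2: "Ck_on k (\<lambda>t. snd (u t) \<psi>) (?V \<inter> ?R2)"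
    by (rule Ck_on_cong[THEN iffD1, OF _ Ck_on_const[OF t2, of _ 0]]) (use u2 in auto)
  show "\<exists>U. open U \<and> t \<in> U \<and> Ck_on k (\<lambda>t. snd (u t) \<psi>) (?V \<inter> U)"
    using cover c1 c2 o by blast
qed

lemma smooth_on_snd:
  fixes f :: "real \<Rightarrow> 'b::real_normed_vector" and S :: "real set"
  assumes "smooth_on f {a..b}" "a < b" "open S"
  shows "smooth_on (\<lambda>p. f (snd p)) (S \<times> {a..b})"
  unfolding smooth_on_def
proof
  fix k
  have th: "thick (S \<times> {a..b})"
    by (intro thick_Times thick_open assms thick_Icc)
  show "Ck_on k (\<lambda>p. f (snd p)) (S \<times> {a..b})"
    using assms(1) unfolding smooth_on_def
    by (intro Ck_on_compose[OF th _ _ Ck_on_bounded_linear[OF bounded_linear_snd th], of "{a..b}"]) auto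
qed

text \<open>The hypotheses \<open>cross\<close> serve two uses: a bump away from the impact, which
  fixes the impact point, and a bump centred at the impact, which moves that point along a curve in
  \<open>B\<close>. The bounds on \<open>c\<close> and \<open>r\<close> keep the support inside
  \<open>{0..1}\<close>, so the end points stay fixed.\<close>

lemma chart_variation_admissible:
  assumes \<tau>: "0 < \<tau>\<^sub>i" "\<tau>\<^sub>i < 1" and cq: "cq \<in> config_paths A \<tau>\<^sub>i B" and ct: "ct \<in> time_paths"
    and \<phi>: "\<phi> \<in> A" and r: "0 < r" "r \<le> c" "c + r \<le> 1"
    and dom: "\<And>t. t \<in> {0..1} \<Longrightarrow> \<bar>t - c\<bar> < 2 * r \<Longrightarrow> cq t \<in> fst \<phi>"
    and \<epsilon>: "0 < \<epsilon>" and \<beta>: "Ck_on 2 \<beta> {-\<epsilon><..<\<epsilon>}" "\<beta> 0 = 0" "(\<beta> has_vector_derivative v) (at 0)"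
    and cross: "\<And>s. s \<in> {-\<epsilon><..<\<epsilon>} \<Longrightarrow> chart_variation \<phi> c r \<beta> cq s \<tau>\<^sub>i \<in> B"
      "\<And>k. manifold_Ck A k (\<lambda>s. chart_variation \<phi> c r \<beta> cq s \<tau>\<^sub>i) {-\<epsilon><..<\<epsilon>}"
  defines "u \<equiv> \<lambda>t. velocity A (\<lambda>s. chart_variation \<phi> c r \<beta> cq s t) UNIV 0"
  shows "(u, \<lambda>_. 0) \<in> fixed_end_variations A \<tau>\<^sub>i B (cq, ct)"
    "path_curve A \<tau>\<^sub>i (Omega A \<tau>\<^sub>i B (cq 0) (cq 1)) (cq, ct) (u, \<lambda>_. 0) (\<lambda>s. (chart_variation \<phi> c r \<beta> cq s, ct))"
    "\<And>t. t \<in> {0..1} \<Longrightarrow> \<bar>t - c\<bar> < 2 * r \<Longrightarrow> snd (u t) \<phi> = bump c r t *\<^sub>R v"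
    "\<And>t. t \<in> {0..1} \<Longrightarrow> r \<le> \<bar>t - c\<bar> \<Longrightarrow> u t = (cq t, \<lambda>_. 0)"
proof -
  let ?G = "chart_variation \<phi> c r \<beta> cq"
  have cont: "continuous_on {0..1} cq" and p1: "manifold_Ck A 2 cq {0..\<tau>\<^sub>i}" and p2: "manifold_Ck A 2 cq {\<tau>\<^sub>i..1}"
    using cq by (auto simp: config_paths_def)
  have out: "?G s t = cq t" if "t \<in> {0..1}" "r \<le> \<bar>t - c\<bar>" for s t
    by (rule chart_variation_outside[OF \<phi> r(1) dom that]) auto
  \<comment> \<open>Over the support of the bump the path has a compact image in the open coordinate
    domain, so a whole \<open>e\<close>-neighbourhood of the image lies in the domain and small
    displacements cannot leave it. Off the support nothing moves.\<close>
  obtain \<epsilon>' where \<epsilon>': "0 < \<epsilon>'" "\<epsilon>' \<le> \<epsilon>" and img: "\<And>s t. s \<in> {-\<epsilon>'<..<\<epsilon>'} \<Longrightarrow> t \<in> {0..1} \<Longrightarrow> \<bar>t - c\<bar> < 2 * r \<Longrightarrow>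
      snd \<phi> (cq t) + bump c r t *\<^sub>R \<beta> s \<in> snd \<phi> ` fst \<phi>"
  proof -
    let ?K = "(\<lambda>t. snd \<phi> (cq t)) ` {c - r..c + r}"
    have sub: "{c - r..c + r} \<subseteq> {0..1}"
      using r by auto
    have "continuous_on {c - r..c + r} (\<lambda>t. snd \<phi> (cq t))"
      by (rule continuous_on_compose2[OF continuous_on_chart[OF \<phi>] continuous_on_subset[OF cont sub]])
        (use sub dom r(1) in \<open>fastforce simp: abs_if\<close>)
    then have "compact ?K"
      by (rule compact_continuous_image) auto
    moreover have "?K \<subseteq> snd \<phi> ` fst \<phi>"
    proof
      fix x assume "x \<in> ?K"
      then obtain t where t: "t \<in> {c - r..c + r}" "x = snd \<phi> (cq t)"
        by blast
      have "cq t \<in> fst \<phi>"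
        by (rule dom) (use t sub r(1) in auto)
      then show "x \<in> snd \<phi> ` fst \<phi>"
        using t(2) by blast
    qed
    ultimately obtain e where e: "e > 0" "(\<Union>x\<in>?K. ball x e) \<subseteq> snd \<phi> ` fst \<phi>"
      using compact_subset_open_imp_ball_epsilon_subset[OF _ chart(2)[OF \<phi>]] by metis
    have "isCont \<beta> 0"
      using Ck_on_imp_continuous_on[OF \<beta>(1)] \<epsilon> by (simp add: continuous_on_eq_continuous_at)
    then have "\<forall>\<^sub>F s in at 0. dist (\<beta> s) (\<beta> 0) < e"
      using e(1) by (simp add: isCont_def tendstoD)
    then obtain d where d: "d > 0" "\<And>s. s \<noteq> 0 \<Longrightarrow> dist s 0 < d \<Longrightarrow> dist (\<beta> s) (\<beta> 0) < e"
      unfolding eventually_at by blast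
    have "snd \<phi> (cq t) + bump c r t *\<^sub>R \<beta> s \<in> snd \<phi> ` fst \<phi>"
      if s: "s \<in> {- min d \<epsilon><..<min d \<epsilon>}" and t: "t \<in> {0..1}" "\<bar>t - c\<bar> < 2 * r" for s t
    proof (cases "r \<le> \<bar>t - c\<bar>")
      case True
      then show ?thesis
        using bump_simps(4)[OF r(1) True] dom[OF t] by simp
    next
      case False
      then have K: "snd \<phi> (cq t) \<in> ?K"
        by (intro imageI) auto
      have "norm (\<beta> s) < e"
        using d(2)[of s] s \<beta>(2) e(1) by (cases "s = 0") auto
      moreover have "bump c r t * norm (\<beta> s) \<le> 1 * norm (\<beta> s)"
        by (intro mult_right_mono bump_simps) simp
      ultimately have "norm (bump c r t *\<^sub>R \<beta> s) < e"
        using bump_simps(2)[of c r t] by simp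
      then have "snd \<phi> (cq t) + bump c r t *\<^sub>R \<beta> s \<in> ball (snd \<phi> (cq t)) e"
        by (simp add: dist_norm)
      then show ?thesis
        using e(2) K by blast
    qed
    then show thesis
      using d(1) \<epsilon> by (intro that[of "min d \<epsilon>"]) auto
  qed
  let ?S = "{-\<epsilon>'<..<\<epsilon>'}"
  have S: "open ?S" "0 \<in> ?S" "?S \<subseteq> {-\<epsilon><..<\<epsilon>}"
    using \<epsilon>' by auto
  have \<beta>S: "Ck_on 2 \<beta> ?S"
    by (rule Ck_on_subset[OF \<beta>(1) S(3) thick_open[OF S(1)]])
  have G2: "manifold_Ck A 2 (\<lambda>p. ?G (fst p) (snd p)) (?S \<times> {a..b})"
    if "a < b" "{a..b} \<subseteq> {0..1}" "manifold_Ck A 2 cq {a..b}" for a b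
    by (rule manifold_Ck_chart_variation[OF that(1,3) \<phi> r(1) _ S(1) \<beta>S]) (use that(2) dom img in blast)+
  have sub: "{0..\<tau>\<^sub>i} \<subseteq> {0..1}" "{\<tau>\<^sub>i..1} \<subseteq> {0..1}"
    using \<tau> by auto
  note J1 = G2[OF \<tau>(1) sub(1) p1] and J2 = G2[OF \<tau>(2) sub(2) p2]
  have u1: "u t = tvec_of A \<phi> (snd \<phi> (cq t)) (bump c r t *\<^sub>R v)" "u t \<in> tangent_bundle A"
      "snd (u t) \<phi> = bump c r t *\<^sub>R v" "fst (u t) = cq t"
    if t: "t \<in> {0..1}" "\<bar>t - c\<bar> < 2 * r" for t
    using chart_variation_velocity[where q = cq and t = t and \<beta> = \<beta>, OF \<phi> t(2) dom[OF t] S(1,2) Ck_on_imp_continuous_on[OF \<beta>S] \<beta>(2,3) img[OF _ t]]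
    unfolding u_def by blast+
  have u2: "u t = (cq t, \<lambda>_. 0)" if "t \<in> {0..1}" "r \<le> \<bar>t - c\<bar>" for t
    unfolding u_def out[OF that] by (rule velocity_const)
  have ub: "u t \<in> tangent_bundle A \<and> fst (u t) = cq t" if "t \<in> {0..1}" for t
    using u1(2,4)[OF that] u2[OF that] zero_in_tangent_bundle r(1) by (cases "\<bar>t - c\<bar> < 2 * r") auto
  have C2: "Ck_on 2 (\<lambda>t. snd (u t) \<psi>) ({a..b} \<inter> cq -` fst \<psi>)"
    if "a < b" "{a..b} \<subseteq> {0..1}" "manifold_Ck A 2 cq {a..b}" "\<psi> \<in> A" for a b \<psi>
  proof (rule Ck_on_variation_field[OF that(1) _ \<phi> that(4) r(1)])
    show "continuous_on {a..b} cq"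
      using cont that(2) by (rule continuous_on_subset)
    show "Ck_on 2 (snd \<phi> \<circ> cq) ({a..b} \<inter> cq -` fst \<phi>)"
      using that(3) \<phi> unfolding manifold_Ck_def by blast
  qed (use that(2) dom u1(1) u2 in blast)+
  have C0: "continuous_on ({0..1} \<inter> cq -` fst \<psi>) (\<lambda>t. snd (u t) \<psi>)" if "\<psi> \<in> A" for \<psi>
  proof -
    have "Ck_on 0 (\<lambda>t. snd (u t) \<psi>) ({0..1} \<inter> cq -` fst \<psi>)"
    proof (rule Ck_on_variation_field[OF _ cont \<phi> that r(1)])
      show "Ck_on 0 (snd \<phi> \<circ> cq) ({0..1} \<inter> cq -` fst \<phi>)"
        unfolding Ck_on.simps
        by (rule continuous_on_compose[OF continuous_on_subset[OF cont]])
          (auto intro: continuous_on_subset[OF continuous_on_chart[OF \<phi>]])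
    qed (use dom u1(1) u2 in auto)
    then show ?thesis by simp
  qed
  have G0: "?G 0 t = cq t" if "t \<in> {0..1}" for t
    using that dom \<phi> by (simp add: chart_variation_def \<beta>(2))
  have "u \<tau>\<^sub>i \<in> tangent_space A B (cq \<tau>\<^sub>i)"
    unfolding tangent_space_def u_def
    using cross \<epsilon> G0[of \<tau>\<^sub>i] \<tau> by (intro CollectI exI[of _ "\<lambda>s. ?G s \<tau>\<^sub>i"]) auto
  then have ut: "u \<in> config_tangent A \<tau>\<^sub>i B cq"
    unfolding config_tangent_def mem_Collect_eq
    using ub C0 C2[OF \<tau>(1) sub(1) p1] C2[OF \<tau>(2) sub(2) p2] by blast
  have ends: "r \<le> \<bar>0 - c\<bar>" "r \<le> \<bar>1 - c\<bar>"
    using r by auto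
  have "smooth_on (\<lambda>_::real. 0::real) {0..1}"
    unfolding smooth_on_def by (intro allI Ck_on_const thick_Icc) auto
  then show "(u, \<lambda>_. 0) \<in> fixed_end_variations A \<tau>\<^sub>i B (cq, ct)"
    unfolding fixed_end_variations_def using ut u2[OF _ ends(1)] u2[OF _ ends(2)] by simp
  have om: "(?G s, ct) \<in> Omega A \<tau>\<^sub>i B (cq 0) (cq 1)" if s: "s \<in> ?S" for s
  proof -
    have m: "manifold_Ck A 2 (?G s) {0..\<tau>\<^sub>i}" "manifold_Ck A 2 (?G s) {\<tau>\<^sub>i..1}"
      using manifold_Ck_slice[OF J1 s \<tau>(1)] manifold_Ck_slice[OF J2 s \<tau>(2)] by simp_all
    then have "continuous_on ({0..\<tau>\<^sub>i} \<union> {\<tau>\<^sub>i..1}) (?G s)"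
      by (intro continuous_on_closed_Un) (auto simp: manifold_Ck_def)
    moreover have "{0..\<tau>\<^sub>i} \<union> {\<tau>\<^sub>i..1} = {0..1}"
      using \<tau> by auto
    moreover have "?G s \<tau>\<^sub>i \<in> B"
      using cross(1) s S(3) by blast
    ultimately show ?thesis
      using m ct out[OF _ ends(1)] out[OF _ ends(2)] by (simp add: Omega_def config_paths_def)
  qed
  have "smooth_on (\<lambda>p. ct (snd p)) (?S \<times> {0..1})"
    using ct by (intro smooth_on_snd S) (auto simp: time_paths_def)
  then show "path_curve A \<tau>\<^sub>i (Omega A \<tau>\<^sub>i B (cq 0) (cq 1)) (cq, ct) (u, \<lambda>_. 0) (\<lambda>s. (?G s, ct))"
    unfolding path_curve_def case_prod_unfold fst_conv snd_conv
    using \<epsilon>'(1) om J1 J2 G0 by (intro exI[of _ \<epsilon>']) (simp add: u_def)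
  show "\<And>t. t \<in> {0..1} \<Longrightarrow> \<bar>t - c\<bar> < 2 * r \<Longrightarrow> snd (u t) \<phi> = bump c r t *\<^sub>R v"
    by (rule u1(3))
  show "\<And>t. t \<in> {0..1} \<Longrightarrow> r \<le> \<bar>t - c\<bar> \<Longrightarrow> u t = (cq t, \<lambda>_. 0)"
    by (rule u2)
qed

lemma manifold_Ck_const:
  assumes "open S"
  shows "manifold_Ck A k (\<lambda>_. p) S"
proof -
  have "thick (S \<inter> (\<lambda>_. p) -` fst \<phi>)" for \<phi> :: "('q, 'n) chart"
    using assms by (cases "p \<in> fst \<phi>") (auto simp: thick_open vimage_def)
  then show ?thesis
    unfolding manifold_Ck_def o_def by (intro conjI ballI continuous_on_const Ck_on_const)
qed

section \<open>Variations of the time component alone\<close>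

lemma zero_config_tangent:
  assumes \<tau>: "0 < \<tau>\<^sub>i" "\<tau>\<^sub>i < 1" and cq: "cq \<in> config_paths A \<tau>\<^sub>i B"
  shows "(\<lambda>t. (cq t, \<lambda>_. 0)) \<in> config_tangent A \<tau>\<^sub>i B cq"
proof -
  have c: "continuous_on {0..\<tau>\<^sub>i} cq" "continuous_on {\<tau>\<^sub>i..1} cq" and B: "cq \<tau>\<^sub>i \<in> B"
    using cq by (auto simp: config_paths_def manifold_Ck_def)
  have "(cq \<tau>\<^sub>i, \<lambda>_. 0) = velocity A (\<lambda>s. cq \<tau>\<^sub>i) UNIV 0"
    by (rule velocity_const[symmetric])
  then have "(cq \<tau>\<^sub>i, \<lambda>_. 0) \<in> tangent_space A B (cq \<tau>\<^sub>i)"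
    unfolding tangent_space_def using B
    by (intro CollectI exI[of _ "\<lambda>s. cq \<tau>\<^sub>i"] conjI exI[of _ "1::real"] allI manifold_Ck_const) auto
  moreover have "Ck_on 2 (\<lambda>t. 0 :: real ^ 'n) ({0..\<tau>\<^sub>i} \<inter> cq -` fst \<phi>)"
    "Ck_on 2 (\<lambda>t. 0 :: real ^ 'n) ({\<tau>\<^sub>i..1} \<inter> cq -` fst \<phi>)" if "\<phi> \<in> A" for \<phi>
    using that \<tau> c
    by (intro Ck_on_const thick_openin[OF thick_Icc openin_chart_preimage]; simp)+
  ultimately show ?thesis
    unfolding config_tangent_def mem_Collect_eq fst_conv snd_conv
    using zero_in_tangent_bundle continuous_on_const by blast
qed

text \<open>The configuration path is kept, so the momentum does not enter the boundary terms. The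
  function t (1 - t) vanishes at both ends and is positive at the impact, which isolates the jump of
  the energy.\<close>

lemma time_variation_admissible:
  assumes \<tau>: "0 < \<tau>\<^sub>i" "\<tau>\<^sub>i < 1" and cq: "cq \<in> config_paths A \<tau>\<^sub>i B" and ct: "ct \<in> time_paths"
  shows "(\<lambda>t. (cq t, \<lambda>_. 0), \<lambda>t. t * (1 - t)) \<in> fixed_end_variations A \<tau>\<^sub>i B (cq, ct)"
    "path_curve A \<tau>\<^sub>i (Omega A \<tau>\<^sub>i B (cq 0) (cq 1)) (cq, ct) (\<lambda>t. (cq t, \<lambda>_. 0), \<lambda>t. t * (1 - t))
      (\<lambda>s. (cq, \<lambda>t. ct t + s * (t * (1 - t))))"
proof -
  have Ck_id: "Ck_on k (\<lambda>t. t * (1 - t)) T" if "thick T" for k and T :: "real set"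
  proof -
    have "Ck_on k (\<lambda>t. t * (1 + (-1) * t)) T"
      by (intro Ck_on_mult Ck_on_add Ck_on_const Ck_on_bounded_linear bounded_linear_ident that)
    then show ?thesis by simp
  qed
  have sct: "Ck_on k ct {0..1}" for k
    using ct by (simp add: time_paths_def smooth_on_def)
  have I: "thick {0..1::real}"
    by (rule thick_Icc) simp
  show "(\<lambda>t. (cq t, \<lambda>_. 0), \<lambda>t. t * (1 - t)) \<in> fixed_end_variations A \<tau>\<^sub>i B (cq, ct)"
    using zero_config_tangent[OF \<tau> cq] Ck_id[OF I] by (simp add: fixed_end_variations_def smooth_on_def)
  let ?D = "\<lambda>t. vector_derivative ct (at t within {0..1})"
  have nb: "at t within {0..1} \<noteq> bot" if "t \<in> {0..1}" for t :: real
    using at_within_Icc_nonbot that by (metis zero_less_one)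
  obtain D2 where D: "\<And>t. t \<in> {0..1} \<Longrightarrow> (ct has_vector_derivative ?D t) (at t within {0..1})"
      "continuous_on {0..1} ?D"
    using C2_curve[OF openin_subtopology_self zero_less_one sct[of 2]] by metis
  obtain t0 where t0: "t0 \<in> {0..1}" "\<And>t. t \<in> {0..1} \<Longrightarrow> ?D t0 \<le> ?D t"
    using continuous_attains_inf[OF compact_Icc _ D(2)] by auto
  \<comment> \<open>The least time rate on \<open>{0..1}\<close>. As
    \<open>\<bar>1 - 2 * t\<bar> \<le> 1\<close> there, every \<open>s\<close> of smaller absolute
    value keeps the perturbed time strictly increasing.\<close>
  define \<epsilon> where "\<epsilon> = ?D t0"
  have \<epsilon>: "0 < \<epsilon>"
    using ct t0(1) by (simp add: time_paths_def \<epsilon>_def)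
  let ?S = "{-\<epsilon><..<\<epsilon>}"
  have om: "(\<lambda>t. ct t + s * (t * (1 - t))) \<in> time_paths" if s: "s \<in> ?S" for s
    unfolding time_paths_def mem_Collect_eq smooth_on_def
  proof (intro conjI allI ballI)
    show "Ck_on k (\<lambda>t. ct t + s * (t * (1 - t))) {0..1}" for k
      by (intro Ck_on_add Ck_on_mult[OF _ Ck_on_const] Ck_id I sct)
    fix t :: real assume t: "t \<in> {0..1}"
    have "((\<lambda>t. s * (t * (1 - t))) has_vector_derivative s * (1 - 2 * t)) (at t within {0..1})"
      unfolding has_real_derivative_iff_has_vector_derivative[symmetric]
      by (auto intro!: derivative_eq_intros simp: algebra_simps)
    then have "vector_derivative (\<lambda>t. ct t + s * (t * (1 - t))) (at t within {0..1}) = ?D t + s * (1 - 2 * t)"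
      by (intro vector_derivative_within[OF nb[OF t]] has_vector_derivative_add D t)
    moreover have "\<bar>s * (1 - 2 * t)\<bar> < \<epsilon>"
    proof -
      have "\<bar>s\<bar> * \<bar>1 - 2 * t\<bar> \<le> \<bar>s\<bar> * 1"
        by (rule mult_left_mono) (use t in auto)
      also have "\<dots> < \<epsilon>"
        using s by auto
      finally show ?thesis
        by (simp add: abs_mult)
    qed
    ultimately show "0 < vector_derivative (\<lambda>t. ct t + s * (t * (1 - t))) (at t within {0..1})"
      using t0(2)[OF t] by (simp add: \<epsilon>_def)
  qed
  have S: "open ?S"
    by simp
  have th: "thick (?S \<times> {0..1::real})"
    by (rule thick_Times[OF thick_open[OF S] I])
  have sm: "smooth_on (\<lambda>p. ct (snd p) + fst p * (snd p * (1 - snd p))) (?S \<times> {0..1})"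
    unfolding smooth_on_def
  proof
    fix k
    have "Ck_on k (\<lambda>p. ct (snd p)) (?S \<times> {0..1})"
      by (rule Ck_on_compose[OF th _ sct Ck_on_bounded_linear[OF bounded_linear_snd th]]) auto
    moreover have "Ck_on k (\<lambda>p. snd p * (1 - snd p)) (?S \<times> {0..1::real})"
      using Ck_on_compose[where f = "\<lambda>t. t * (1 - t)" and g = snd,
          OF th subset_UNIV Ck_id[OF thick_UNIV] Ck_on_bounded_linear[OF bounded_linear_snd th]]
      by simp
    ultimately show "Ck_on k (\<lambda>p. ct (snd p) + fst p * (snd p * (1 - snd p))) (?S \<times> {0..1})"
      by (rule Ck_on_add[OF th _ Ck_on_mult[OF th Ck_on_bounded_linear[OF bounded_linear_fst th]]])
  qed
  have m: "manifold_Ck A 2 (\<lambda>p. cq (snd p)) (?S \<times> {0..\<tau>\<^sub>i})" "manifold_Ck A 2 (\<lambda>p. cq (snd p)) (?S \<times> {\<tau>\<^sub>i..1})"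
    using cq \<tau> by (intro manifold_Ck_snd S; simp add: config_paths_def)+
  have vd: "vector_derivative (\<lambda>s. ct t + s * (t * (1 - t))) (at 0) = t * (1 - t)" for t
  proof (rule vector_derivative_at)
    show "((\<lambda>s. ct t + s * (t * (1 - t))) has_vector_derivative t * (1 - t)) (at 0)"
      unfolding has_real_derivative_iff_has_vector_derivative[symmetric]
      by (auto intro!: derivative_eq_intros)
  qed
  show "path_curve A \<tau>\<^sub>i (Omega A \<tau>\<^sub>i B (cq 0) (cq 1)) (cq, ct) (\<lambda>t. (cq t, \<lambda>_. 0), \<lambda>t. t * (1 - t))
      (\<lambda>s. (cq, \<lambda>t. ct t + s * (t * (1 - t))))"
    unfolding path_curve_def case_prod_unfold fst_conv snd_conv
    using \<epsilon> om m sm cq by (intro exI[of _ \<epsilon>]) (simp add: vd velocity_const Omega_def)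
qed

end

section \<open>The first variation of the action\<close>

lemma vector_derivative_within_cong:
  assumes "\<And>t. t \<in> I \<Longrightarrow> f t = g t" "t \<in> I"
  shows "vector_derivative f (at t within I) = vector_derivative g (at t within I)"
  unfolding vector_derivative_def has_vector_derivative_def
  using has_derivative_within_cong[OF assms] by simp

lemma at_within_pieces:
  fixes \<tau> t :: real
  shows "t < \<tau> \<Longrightarrow> \<tau> \<le> 1 \<Longrightarrow> at t within {0..\<tau>} = at t within {0..1}"
    and "\<tau> < t \<Longrightarrow> 0 \<le> \<tau> \<Longrightarrow> at t within {\<tau>..1} = at t within {0..1}"
  by (rule at_within_nhd[of t "{..<\<tau>}"]; force) (rule at_within_nhd[of t "{\<tau><..}"]; force)

lemma velocity_at_cong: "at t within I = at t within I' \<Longrightarrow> velocity A \<gamma> I t = velocity A \<gamma> I' t"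
  by (simp only: velocity_def)

text \<open>\<open>Z\<close> is any fixed solution along the path; in the theorem it becomes the one
  that \<open>Zhat\<close> picks.\<close>

locale herglotz_path = lagrangian_mfd A L
  for A :: "('q::{t2_space, second_countable_topology}, 'n::finite) chart set"
    and L :: "('q, 'n) tvec \<times> real \<Rightarrow> real" +
  fixes \<tau>\<^sub>i z0 :: real and B :: "'q set" and cq :: "real \<Rightarrow> 'q" and ct Z :: "real \<Rightarrow> real"
  assumes \<tau>: "0 < \<tau>\<^sub>i" "\<tau>\<^sub>i < 1" and cq: "cq \<in> config_paths A \<tau>\<^sub>i B" and ct: "ct \<in> time_paths"
    and Z: "herglotz_solution A L \<tau>\<^sub>i z0 (cq, ct) Z"
begin

definition \<theta> :: "real \<Rightarrow> real" where
  "\<theta> t = vector_derivative ct (at t within {0..1})"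

definition \<theta>' :: "real \<Rightarrow> real" where
  "\<theta>' t = vector_derivative \<theta> (at t within {0..1})"

lemma \<theta>_C1: "\<exists>c2. (\<forall>t\<in>{0..1}. (\<theta> has_vector_derivative c2 t) (at t within {0..1})) \<and> continuous_on {0..1} c2"
proof (rule C2_curve[OF openin_subtopology_self zero_less_one, of ct])
  show "Ck_on 2 ct {0..1}"
    using ct by (simp add: time_paths_def smooth_on_def)
  fix c2
  assume "\<And>t. t \<in> {0..1} \<Longrightarrow> ((\<lambda>t. vector_derivative ct (at t within {0..1})) has_vector_derivative c2 t) (at t within {0..1})"
    "continuous_on {0..1} c2"
  then show ?thesis
    unfolding \<theta>_def[abs_def] by blast
qed

lemma ct_derivs:
  assumes "t \<in> {0..1}"
  shows "0 < \<theta> t" "(\<theta> has_real_derivative \<theta>' t) (at t within {0..1})"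
proof -
  show "0 < \<theta> t"
    using ct assms by (simp add: time_paths_def \<theta>_def)
  obtain c2 where c2: "(\<theta> has_vector_derivative c2 t) (at t within {0..1})"
    using \<theta>_C1 assms by blast
  then show "(\<theta> has_real_derivative \<theta>' t) (at t within {0..1})"
    using vector_derivative_within[OF at_within_Icc_nonbot[OF zero_less_one assms] c2]
    by (simp add: \<theta>'_def has_real_derivative_iff_has_vector_derivative)
qed

lemma \<theta>'_cont: "continuous_on {0..1} \<theta>'"
proof -
  obtain c2 where c2: "\<And>t. t \<in> {0..1} \<Longrightarrow> (\<theta> has_vector_derivative c2 t) (at t within {0..1})" "continuous_on {0..1} c2"
    using \<theta>_C1 by blast
  have "c2 t = \<theta>' t" if "t \<in> {0..1}" for t
    using vector_derivative_within[OF at_within_Icc_nonbot[OF zero_less_one that] c2(1)[OF that]]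
    by (simp add: \<theta>'_def)
  then show ?thesis
    using c2(2) continuous_on_eq by blast
qed

lemma Z_cont: "continuous_on {0..1} Z"
  using Z by (simp add: herglotz_solution_def)

lemma piece_subsets: "{0..\<tau>\<^sub>i} \<subseteq> {0..1}" "{\<tau>\<^sub>i..1} \<subseteq> {0..1}"
  using \<tau> by auto

text \<open>Derivatives are taken within the closed pieces, so a quantity of \<open>p1\<close> at
  \<open>\<tau>\<^sub>i\<close> is its value from the left and the same quantity of
  \<open>p2\<close> its value from the right. The jump conditions compare the two.\<close>

sublocale p1: curve_piece A L 0 \<tau>\<^sub>i cq \<theta> \<theta>' Z
  using \<tau>(1) cq ct_derivs(1) DERIV_subset[OF ct_derivs(2) piece_subsets(1)] piece_subsets(1)
    continuous_on_subset[OF \<theta>'_cont piece_subsets(1)] continuous_on_subset[OF Z_cont piece_subsets(1)]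
  by unfold_locales (auto simp: config_paths_def)

sublocale p2: curve_piece A L \<tau>\<^sub>i 1 cq \<theta> \<theta>' Z
  using \<tau>(2) cq ct_derivs(1) DERIV_subset[OF ct_derivs(2) piece_subsets(2)] piece_subsets(2)
    continuous_on_subset[OF \<theta>'_cont piece_subsets(2)] continuous_on_subset[OF Z_cont piece_subsets(2)]
  by unfold_locales (auto simp: config_paths_def)

lemma lifted_path_pieces:
  "t \<in> {0..<\<tau>\<^sub>i} \<Longrightarrow> lifted_path A (cq, ct) Z t = (p1.lift t, Z t)"
  "t \<in> {\<tau>\<^sub>i<..1} \<Longrightarrow> lifted_path A (cq, ct) Z t = (p2.lift t, Z t)"
  using \<tau> velocity_at_cong[OF at_within_pieces(1), of t \<tau>\<^sub>i A cq] velocity_at_cong[OF at_within_pieces(2), of \<tau>\<^sub>i t A cq]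
  by (simp_all add: lifted_path_def p1.lift_def p2.lift_def \<theta>_def)

lemma Z_derivs:
  "t \<in> {0..<\<tau>\<^sub>i} \<Longrightarrow> (Z has_real_derivative p1.rate t) (at t within {0..\<tau>\<^sub>i})"
  "t \<in> {\<tau>\<^sub>i<..1} \<Longrightarrow> (Z has_real_derivative p2.rate t) (at t within {\<tau>\<^sub>i..1})"
proof -
  have d: "(Z has_real_derivative L (lifted_path A (cq, ct) Z t) * \<theta> t) (at t within {0..1})"
    if "t \<in> {0..1} - {\<tau>\<^sub>i}" for t
    using Z that unfolding herglotz_solution_def snd_conv \<theta>_def by blast
  show "t \<in> {0..<\<tau>\<^sub>i} \<Longrightarrow> (Z has_real_derivative p1.rate t) (at t within {0..\<tau>\<^sub>i})"
    using d[of t] lifted_path_pieces(1)[of t] at_within_pieces(1)[of t \<tau>\<^sub>i] \<tau> by (simp add: p1.rate_def)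
  show "t \<in> {\<tau>\<^sub>i<..1} \<Longrightarrow> (Z has_real_derivative p2.rate t) (at t within {\<tau>\<^sub>i..1})"
    using d[of t] lifted_path_pieces(2)[of t] at_within_pieces(2)[of \<tau>\<^sub>i t] \<tau> by (simp add: p2.rate_def)
qed

text \<open>\<open>first_variation\<close> is applied to both pieces. The first starts from the
  constant \<open>z0\<close>; since solutions are continuous at the impact, the variation \<nu> of
  its end value is the initial variation on the second piece, whose end value is the action.\<close>

lemma first_variation_action:
  assumes pc: "path_curve A \<tau>\<^sub>i (Omega A \<tau>\<^sub>i B q1 q2) (cq, ct) (u, \<delta>) \<Gamma>"
  defines "B1 \<equiv> \<lambda>t. p1.En t * \<delta> t - fibre_deriv L (p1.lift t) (u t) (Z t)"
    and "B2 \<equiv> \<lambda>t. p2.En t * \<delta> t - fibre_deriv L (p2.lift t) (u t) (Z t)"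
  obtains \<omega> \<nu> H1 H2 \<kappa>1 \<kappa>2 where
    "((\<lambda>s. action A L \<tau>\<^sub>i z0 (\<Gamma> s)) has_real_derivative \<omega>) (at 0)"
    "continuous_on {0..\<tau>\<^sub>i} H1" "H1 0 = B1 0" "0 < \<kappa>1" "H1 \<tau>\<^sub>i = \<kappa>1 * (\<nu> + B1 \<tau>\<^sub>i)"
    "\<And>\<phi> t. \<phi> \<in> A \<Longrightarrow> t \<in> p1.J \<phi> \<Longrightarrow> t \<in> {0<..<\<tau>\<^sub>i} \<Longrightarrow> \<exists>m>0. (H1 has_real_derivative
       m * (\<Sum>j\<in>UNIV. p1.el \<phi> j t * (snd (u t) \<phi> $ j - p1.ydot \<phi> t $ j * \<delta> t))) (at t)"
    "continuous_on {\<tau>\<^sub>i..1} H2" "H2 \<tau>\<^sub>i = \<nu> + B2 \<tau>\<^sub>i" "0 < \<kappa>2" "H2 1 = \<kappa>2 * (\<omega> + B2 1)"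
    "\<And>\<phi> t. \<phi> \<in> A \<Longrightarrow> t \<in> p2.J \<phi> \<Longrightarrow> t \<in> {\<tau>\<^sub>i<..<1} \<Longrightarrow> \<exists>m>0. (H2 has_real_derivative
       m * (\<Sum>j\<in>UNIV. p2.el \<phi> j t * (snd (u t) \<phi> $ j - p2.ydot \<phi> t $ j * \<delta> t))) (at t)"
proof -
  define Y where "Y p = fst (\<Gamma> (fst p)) (snd p)" for p :: "real \<times> real"
  define \<Theta> where "\<Theta> p = vector_derivative (snd (\<Gamma> (fst p))) (at (snd p) within {0..1})" for p :: "real \<times> real"
  define T where "T p = snd (\<Gamma> (fst p)) (snd p)" for p :: "real \<times> real"
  obtain \<epsilon> where \<epsilon>: "0 < \<epsilon>" and om: "\<And>s. s \<in> {-\<epsilon><..<\<epsilon>} \<Longrightarrow> \<Gamma> s \<in> Omega A \<tau>\<^sub>i B q1 q2"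
    and Y1: "manifold_Ck A 2 Y ({-\<epsilon><..<\<epsilon>} \<times> {0..\<tau>\<^sub>i})" and Y2: "manifold_Ck A 2 Y ({-\<epsilon><..<\<epsilon>} \<times> {\<tau>\<^sub>i..1})"
    and T: "smooth_on T ({-\<epsilon><..<\<epsilon>} \<times> {0..1})"
    and base: "\<And>t. t \<in> {0..1} \<Longrightarrow> Y (0, t) = cq t" "\<And>t. t \<in> {0..1} \<Longrightarrow> T (0, t) = ct t"
      "\<And>t. t \<in> {0..1} \<Longrightarrow> velocity A (\<lambda>s. Y (s, t)) UNIV 0 = u t"
      "\<And>t. t \<in> {0..1} \<Longrightarrow> vector_derivative (\<lambda>s. T (s, t)) (at 0) = \<delta> t"
    using pc unfolding path_curve_def case_prod_unfold Y_def[abs_def] T_def[abs_def] fst_conv snd_conv by blast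
  let ?S = "{-\<epsilon><..<\<epsilon>}"
  have S: "open ?S" "0 \<in> ?S"
    using \<epsilon> by auto
  have nb: "at t within {0..1} \<noteq> bot" if "t \<in> {0..1}" for t :: real
    by (rule at_within_Icc_nonbot[OF zero_less_one that])
  \<comment> \<open>The \<open>s\<close>-derivative of the time rate is a mixed partial of
    \<open>T\<close>, hence at \<open>s = 0\<close> also the derivative of the time variation
    \<delta>.\<close>
  have "\<exists>\<Theta>s. continuous_on (?S \<times> {0..1}) \<Theta> \<and> continuous_on (?S \<times> {0..1}) \<Theta>s \<and>
      (\<forall>s\<in>?S. \<forall>t\<in>{0..1}. ((\<lambda>s. \<Theta> (s, t)) has_real_derivative \<Theta>s (s, t)) (at s)) \<and>
      (\<forall>t\<in>{0..1}. (\<delta> has_real_derivative \<Theta>s (0, t)) (at t within {0..1}))"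
  proof (rule C2_family[OF openin_subtopology_self S(1) zero_less_one])
    show "Ck_on 2 T (?S \<times> {0..1})"
      using T unfolding smooth_on_def by blast
    fix fs ft fst' ftt
    assume c: "continuous_on (?S \<times> {0..1}) fs" "continuous_on (?S \<times> {0..1}) ft"
      "continuous_on (?S \<times> {0..1}) fst'" "continuous_on (?S \<times> {0..1}) ftt"
      and fs: "\<And>s t. (s, t) \<in> ?S \<times> {0..1} \<Longrightarrow> ((\<lambda>s. T (s, t)) has_vector_derivative fs (s, t)) (at s)"
      and ft: "\<And>s t. (s, t) \<in> ?S \<times> {0..1} \<Longrightarrow> ((\<lambda>t. T (s, t)) has_vector_derivative ft (s, t)) (at t within {0..1})"
      and fts: "\<And>s t. (s, t) \<in> ?S \<times> {0..1} \<Longrightarrow> ((\<lambda>s. ft (s, t)) has_vector_derivative fst' (s, t)) (at s)"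
      and fst': "\<And>s t. (s, t) \<in> ?S \<times> {0..1} \<Longrightarrow> ((\<lambda>t. fs (s, t)) has_vector_derivative fst' (s, t)) (at t within {0..1})"
    have \<Theta>: "\<Theta> p = ft p" if p: "p \<in> ?S \<times> {0..1}" for p
    proof -
      obtain s t where st: "p = (s, t)" "s \<in> ?S" "t \<in> {0..1}"
        using p by blast
      have "((\<lambda>t. T (s, t)) has_vector_derivative ft (s, t)) (at t within {0..1})"
        by (rule ft) (use st in blast)
      then show ?thesis
        using vector_derivative_within[OF nb[OF st(3)]] by (simp add: \<Theta>_def T_def st(1))
    qed
    have "continuous_on (?S \<times> {0..1}) \<Theta>"
      by (rule continuous_on_eq[OF c(2)]) (simp only: \<Theta>)
    moreover have "((\<lambda>s. \<Theta> (s, t)) has_real_derivative fst' (s, t)) (at s)" if "s \<in> ?S" "t \<in> {0..1}" for s t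
      unfolding has_real_derivative_iff_has_vector_derivative
      by (rule has_vector_derivative_transform_within_open[OF fts S(1) that(1)]) (use that \<Theta> in auto)
    moreover have "(\<delta> has_real_derivative fst' (0, t)) (at t within {0..1})" if t: "t \<in> {0..1}" for t
    proof -
      have "\<delta> t = fs (0, t)" if "t \<in> {0..1}" for t
        using vector_derivative_at[OF fs[of 0 t]] base(4)[OF that] that S(2) by simp
      then show ?thesis
        unfolding has_real_derivative_iff_has_vector_derivative
        by (rule has_vector_derivative_transform[OF t _ fst']) (use t S(2) in auto)
    qed
    ultimately show ?thesis
      using c(3) by blast
  qed
  then obtain \<Theta>s where \<Theta>: "continuous_on (?S \<times> {0..1}) \<Theta>" "continuous_on (?S \<times> {0..1}) \<Theta>s"
      "\<And>s t. s \<in> ?S \<Longrightarrow> t \<in> {0..1} \<Longrightarrow> ((\<lambda>s. \<Theta> (s, t)) has_real_derivative \<Theta>s (s, t)) (at s)"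
      "\<And>t. t \<in> {0..1} \<Longrightarrow> (\<delta> has_real_derivative \<Theta>s (0, t)) (at t within {0..1})"
    by blast
  have \<Theta>pos: "0 < \<Theta> (s, t)" if "s \<in> ?S" "t \<in> {0..1}" for s t
    using om[OF that(1)] that(2) by (auto simp: Omega_def time_paths_def \<Theta>_def)
  have \<Theta>0: "\<Theta> (0, t) = \<theta> t" if t: "t \<in> {0..1}" for t
    unfolding \<Theta>_def \<theta>_def fst_conv snd_conv
    by (rule vector_derivative_within_cong[OF _ t]) (use base(2) in \<open>simp add: T_def\<close>)
  have sub: "?S \<times> {0..\<tau>\<^sub>i} \<subseteq> ?S \<times> {0..1}" "?S \<times> {\<tau>\<^sub>i..1} \<subseteq> ?S \<times> {0..1}"
    using piece_subsets by blast+
  define g1 where "g1 = family_rate A L {0..\<tau>\<^sub>i} Y \<Theta>"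
  define g2 where "g2 = family_rate A L {\<tau>\<^sub>i..1} Y \<Theta>"
  have in1: "t \<in> {0..1}" if "t \<in> {0..\<tau>\<^sub>i}" for t
    using that \<tau> by auto
  have in2: "t \<in> {0..1}" if "t \<in> {\<tau>\<^sub>i..1}" for t
    using that \<tau> by auto
  have Zd1: "(Z has_real_derivative p1.rate t) (at t)" if "t \<in> {0<..<\<tau>\<^sub>i}" for t
    using Z_derivs(1)[of t] that at_within_interior[of t "{0..\<tau>\<^sub>i}"] by simp
  have Zd2: "(Z has_real_derivative p2.rate t) (at t)" if "t \<in> {\<tau>\<^sub>i<..<1}" for t
    using Z_derivs(2)[of t] that at_within_interior[of t "{\<tau>\<^sub>i..1}"] by simp
  have Z0: "z0 = Z 0"
    using Z by (simp add: herglotz_solution_def)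
  have C1: "continuous_on (?S \<times> {0..\<tau>\<^sub>i} \<times> UNIV) (\<lambda>(s, t, z). deriv (g1 s t) z)"
      "\<And>s t z. s \<in> ?S \<Longrightarrow> t \<in> {0..\<tau>\<^sub>i} \<Longrightarrow> (g1 s t has_real_derivative deriv (g1 s t) z) (at z)"
    using family_rate_continuously_differentiable(3,5)[OF \<tau>(1) S(1) Y1 continuous_on_subset[OF \<Theta>(1) sub(1)]
        continuous_on_subset[OF \<Theta>(2) sub(1)] \<Theta>pos[OF _ in1] \<Theta>(3)[OF _ in1]]
    unfolding g1_def by blast+
  have C2: "continuous_on (?S \<times> {\<tau>\<^sub>i..1} \<times> UNIV) (\<lambda>(s, t, z). deriv (g2 s t) z)"
      "\<And>s t z. s \<in> ?S \<Longrightarrow> t \<in> {\<tau>\<^sub>i..1} \<Longrightarrow> (g2 s t has_real_derivative deriv (g2 s t) z) (at z)"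
    using family_rate_continuously_differentiable(3,5)[OF \<tau>(2) S(1) Y2 continuous_on_subset[OF \<Theta>(1) sub(2)]
        continuous_on_subset[OF \<Theta>(2) sub(2)] \<Theta>pos[OF _ in2] \<Theta>(3)[OF _ in2]]
    unfolding g2_def by blast+
  show thesis
  proof (rule p1.first_variation[where Y = Y and \<Theta> = \<Theta> and \<delta> = \<delta> and \<zeta> = "\<lambda>_. z0",
        OF \<epsilon> Y1 base(1)[OF in1] continuous_on_subset[OF \<Theta>(1) sub(1)] continuous_on_subset[OF \<Theta>(2) sub(1)]
        \<Theta>pos[OF _ in1] \<Theta>(3)[OF _ in1] \<Theta>0[OF in1] DERIV_subset[OF \<Theta>(4)[OF in1] piece_subsets(1)]
        Zd1 DERIV_const Z0, folded g1_def])
    fix r1 Z1 \<nu> H1 \<kappa>1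
    assume r1: "0 < r1" "r1 \<le> \<epsilon>" and Z1: "\<And>s. s \<in> {-r1<..<r1} \<Longrightarrow> Z1 s 0 = z0"
      "\<And>s t. s \<in> {-r1<..<r1} \<Longrightarrow> t \<in> {0..\<tau>\<^sub>i} \<Longrightarrow> (Z1 s has_real_derivative g1 s t (Z1 s t)) (at t within {0..\<tau>\<^sub>i})"
      "\<And>t. t \<in> {0..\<tau>\<^sub>i} \<Longrightarrow> Z1 0 t = Z t"
      and \<nu>: "((\<lambda>s. Z1 s \<tau>\<^sub>i) has_real_derivative \<nu>) (at 0)"
      and H1: "continuous_on {0..\<tau>\<^sub>i} H1"
        "H1 0 = 0 + (p1.En 0 * \<delta> 0 - fibre_deriv L (p1.lift 0) (velocity A (\<lambda>s. Y (s, 0)) UNIV 0) (Z 0))" "0 < \<kappa>1"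
        "H1 \<tau>\<^sub>i = \<kappa>1 * (\<nu> + (p1.En \<tau>\<^sub>i * \<delta> \<tau>\<^sub>i - fibre_deriv L (p1.lift \<tau>\<^sub>i) (velocity A (\<lambda>s. Y (s, \<tau>\<^sub>i)) UNIV 0) (Z \<tau>\<^sub>i)))"
        "\<And>\<phi> t. \<phi> \<in> A \<Longrightarrow> t \<in> p1.J \<phi> \<Longrightarrow> t \<in> {0<..<\<tau>\<^sub>i} \<Longrightarrow> \<exists>m>0. (H1 has_real_derivative
          m * (\<Sum>j\<in>UNIV. p1.el \<phi> j t * (snd (velocity A (\<lambda>s. Y (s, t)) UNIV 0) \<phi> $ j - p1.ydot \<phi> t $ j * \<delta> t))) (at t)"
    have Z1\<tau>: "Z1 0 \<tau>\<^sub>i = Z \<tau>\<^sub>i"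
      using Z1(3) \<tau> by simp
    show thesis
    proof (rule p2.first_variation[where Y = Y and \<Theta> = \<Theta> and \<delta> = \<delta> and \<zeta> = "\<lambda>s. Z1 s \<tau>\<^sub>i",
          OF \<epsilon> Y2 base(1)[OF in2] continuous_on_subset[OF \<Theta>(1) sub(2)] continuous_on_subset[OF \<Theta>(2) sub(2)]
          \<Theta>pos[OF _ in2] \<Theta>(3)[OF _ in2] \<Theta>0[OF in2] DERIV_subset[OF \<Theta>(4)[OF in2] piece_subsets(2)]
          Zd2 \<nu> Z1\<tau>, folded g2_def])
      fix r2 Z2 \<omega> H2 \<kappa>2
      assume r2: "0 < r2" "r2 \<le> \<epsilon>" and Z2: "\<And>s. s \<in> {-r2<..<r2} \<Longrightarrow> Z2 s \<tau>\<^sub>i = Z1 s \<tau>\<^sub>i"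
        "\<And>s t. s \<in> {-r2<..<r2} \<Longrightarrow> t \<in> {\<tau>\<^sub>i..1} \<Longrightarrow> (Z2 s has_real_derivative g2 s t (Z2 s t)) (at t within {\<tau>\<^sub>i..1})"
        and \<omega>: "((\<lambda>s. Z2 s 1) has_real_derivative \<omega>) (at 0)"
        and H2: "continuous_on {\<tau>\<^sub>i..1} H2"
          "H2 \<tau>\<^sub>i = \<nu> + (p2.En \<tau>\<^sub>i * \<delta> \<tau>\<^sub>i - fibre_deriv L (p2.lift \<tau>\<^sub>i) (velocity A (\<lambda>s. Y (s, \<tau>\<^sub>i)) UNIV 0) (Z \<tau>\<^sub>i))" "0 < \<kappa>2"
          "H2 1 = \<kappa>2 * (\<omega> + (p2.En 1 * \<delta> 1 - fibre_deriv L (p2.lift 1) (velocity A (\<lambda>s. Y (s, 1)) UNIV 0) (Z 1)))"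
          "\<And>\<phi> t. \<phi> \<in> A \<Longrightarrow> t \<in> p2.J \<phi> \<Longrightarrow> t \<in> {\<tau>\<^sub>i<..<1} \<Longrightarrow> \<exists>m>0. (H2 has_real_derivative
            m * (\<Sum>j\<in>UNIV. p2.el \<phi> j t * (snd (velocity A (\<lambda>s. Y (s, t)) UNIV 0) \<phi> $ j - p2.ydot \<phi> t $ j * \<delta> t))) (at t)"
      \<comment> \<open>The action refers to a solution picked by choice. Joining
        \<open>Z1 s\<close> and \<open>Z2 s\<close> yields one solution along
        \<open>\<Gamma> s\<close>, and every other solution has the same value at 1.\<close>
      have act: "action A L \<tau>\<^sub>i z0 (\<Gamma> s) = Z2 s 1" if s: "s \<in> {- min r1 r2<..<min r1 r2}" for s
      proof -
        have s1: "s \<in> {-r1<..<r1}" and s2: "s \<in> {-r2<..<r2}" and sS: "s \<in> ?S"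
          using s r1 r2 by auto
        have rate1: "L (lifted_path A (\<Gamma> s) V t) * vector_derivative (snd (\<Gamma> s)) (at t within {0..1}) = g1 s t (V t)"
          if "t \<in> {0..<\<tau>\<^sub>i}" for V t
          using that \<tau> velocity_at_cong[OF at_within_pieces(1), of t \<tau>\<^sub>i A "fst (\<Gamma> s)"]
          by (simp add: lifted_path_def g1_def family_rate_def \<Theta>_def Y_def)
        have rate2: "L (lifted_path A (\<Gamma> s) V t) * vector_derivative (snd (\<Gamma> s)) (at t within {0..1}) = g2 s t (V t)"
          if "t \<in> {\<tau>\<^sub>i<..1}" for V t
          using that \<tau> velocity_at_cong[OF at_within_pieces(2), of \<tau>\<^sub>i t A "fst (\<Gamma> s)"]
          by (simp add: lifted_path_def g2_def family_rate_def \<Theta>_def Y_def)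
        have cZ1: "continuous_on {0..\<tau>\<^sub>i} (Z1 s)"
          by (rule DERIV_continuous_on[OF Z1(2)[OF s1]])
        have cZ2: "continuous_on {\<tau>\<^sub>i..1} (Z2 s)"
          by (rule DERIV_continuous_on[OF Z2(2)[OF s2]])
        define V where "V t = (if t \<le> \<tau>\<^sub>i then Z1 s t else Z2 s t)" for t
        have V1: "V t = Z1 s t" if "t \<in> {0..\<tau>\<^sub>i}" for t
          using that by (simp add: V_def)
        have V2: "V t = Z2 s t" if "t \<in> {\<tau>\<^sub>i..1}" for t
          using that Z2(1)[OF s2] by (cases "t = \<tau>\<^sub>i") (auto simp: V_def)
        have sol: "herglotz_solution A L \<tau>\<^sub>i z0 (\<Gamma> s) V"
          unfolding herglotz_solution_def
        proof (intro conjI ballI)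
          have "continuous_on ({0..\<tau>\<^sub>i} \<union> {\<tau>\<^sub>i..1}) V"
            by (intro continuous_on_closed_Un continuous_on_eq[OF cZ1] continuous_on_eq[OF cZ2])
              (auto simp: V1 V2)
          moreover have "{0..\<tau>\<^sub>i} \<union> {\<tau>\<^sub>i..1} = {0..1}"
            using \<tau> by auto
          ultimately show "continuous_on {0..1} V"
            by simp
          show "V 0 = z0"
            using V1[of 0] Z1(1)[OF s1] \<tau> by simp
          fix t assume "t \<in> {0..1} - {\<tau>\<^sub>i}"
          then consider "t \<in> {0..<\<tau>\<^sub>i}" | "t \<in> {\<tau>\<^sub>i<..1}"
            by fastforce
          then show "(V has_real_derivative L (lifted_path A (\<Gamma> s) V t) *
              vector_derivative (snd (\<Gamma> s)) (at t within {0..1})) (at t within {0..1})"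
          proof cases
            case 1
            then have t: "t \<in> {0..\<tau>\<^sub>i}" by simp
            have "(V has_real_derivative g1 s t (V t)) (at t within {0..\<tau>\<^sub>i})"
              unfolding has_real_derivative_iff_has_vector_derivative V1[OF t]
              by (rule has_vector_derivative_transform[OF t V1 Z1(2)[OF s1 t,
                  unfolded has_real_derivative_iff_has_vector_derivative]])
            then show ?thesis
              unfolding rate1[OF 1] using at_within_pieces(1)[of t \<tau>\<^sub>i] 1 \<tau> by simp
          next
            case 2
            then have t: "t \<in> {\<tau>\<^sub>i..1}" by simp
            have "(V has_real_derivative g2 s t (V t)) (at t within {\<tau>\<^sub>i..1})"
              unfolding has_real_derivative_iff_has_vector_derivative V2[OF t]
              by (rule has_vector_derivative_transform[OF t V2 Z2(2)[OF s2 t,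
                  unfolded has_real_derivative_iff_has_vector_derivative]])
            then show ?thesis
              unfolding rate2[OF 2] using at_within_pieces(2)[of \<tau>\<^sub>i t] 2 \<tau> by simp
          qed
        qed
        have c1: "continuous_on ({0..\<tau>\<^sub>i} \<times> UNIV) (\<lambda>(t, z). deriv (g1 s t) z)"
        proof -
          have "continuous_on ({0..\<tau>\<^sub>i} \<times> UNIV) (\<lambda>p. (\<lambda>(s, t, z). deriv (g1 s t) z) (s, p))"
            by (rule continuous_on_compose2[OF C1(1)]) (use sS in \<open>auto intro!: continuous_intros\<close>)
          then show ?thesis
            by (simp add: case_prod_unfold)
        qed
        have c2: "continuous_on ({\<tau>\<^sub>i..1} \<times> UNIV) (\<lambda>(t, z). deriv (g2 s t) z)"
        proof -
          have "continuous_on ({\<tau>\<^sub>i..1} \<times> UNIV) (\<lambda>p. (\<lambda>(s, t, z). deriv (g2 s t) z) (s, p))"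
            by (rule continuous_on_compose2[OF C2(1)]) (use sS in \<open>auto intro!: continuous_intros\<close>)
          then show ?thesis
            by (simp add: case_prod_unfold)
        qed
        have d: "(V has_real_derivative g1 s t (V t)) (at t)"
          if V: "herglotz_solution A L \<tau>\<^sub>i z0 (\<Gamma> s) V" and t: "t \<in> {0<..<\<tau>\<^sub>i}" for V t
        proof -
          have "(V has_real_derivative g1 s t (V t)) (at t within {0..1})"
          proof -
            have t': "t \<in> {0..1} - {\<tau>\<^sub>i}" "t \<in> {0..<\<tau>\<^sub>i}"
              using t \<tau> by auto
            have "(V has_real_derivative L (lifted_path A (\<Gamma> s) V t) *
                vector_derivative (snd (\<Gamma> s)) (at t within {0..1})) (at t within {0..1})"
              using V t'(1) unfolding herglotz_solution_def by blast
            then show ?thesis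
              unfolding rate1[OF t'(2)] .
          qed
          moreover have "at t within {0..1} = at t"
            using t \<tau> by (intro at_within_interior) auto
          ultimately show ?thesis by simp
        qed
        have d': "(V has_real_derivative g2 s t (V t)) (at t)"
          if V: "herglotz_solution A L \<tau>\<^sub>i z0 (\<Gamma> s) V" and t: "t \<in> {\<tau>\<^sub>i<..<1}" for V t
        proof -
          have "(V has_real_derivative g2 s t (V t)) (at t within {0..1})"
          proof -
            have t': "t \<in> {0..1} - {\<tau>\<^sub>i}" "t \<in> {\<tau>\<^sub>i<..1}"
              using t \<tau> by auto
            have "(V has_real_derivative L (lifted_path A (\<Gamma> s) V t) *
                vector_derivative (snd (\<Gamma> s)) (at t within {0..1})) (at t within {0..1})"
              using V t'(1) unfolding herglotz_solution_def by blast
            then show ?thesis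
              unfolding rate2[OF t'(2)] .
          qed
          moreover have "at t within {0..1} = at t"
            using t \<tau> by (intro at_within_interior) auto
          ultimately show ?thesis by simp
        qed
        \<comment> \<open>Uniqueness is used on each piece in turn, since no equation is imposed at
          \<open>\<tau>\<^sub>i\<close>; agreement there is the initial condition for the second
          piece.\<close>
        have uniq: "V' 1 = V 1" if V': "herglotz_solution A L \<tau>\<^sub>i z0 (\<Gamma> s) V'" for V'
        proof -
          have cc: "continuous_on {0..\<tau>\<^sub>i} U" "continuous_on {\<tau>\<^sub>i..1} U" "U 0 = z0"
            if "herglotz_solution A L \<tau>\<^sub>i z0 (\<Gamma> s) U" for U
            using that piece_subsets by (auto simp: herglotz_solution_def intro: continuous_on_subset)
          have e: "V' \<tau>\<^sub>i = V \<tau>\<^sub>i"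
            by (rule ode_solution_unique[where f = "g1 s", OF C1(2)[OF sS] c1 cc(1)[OF V'] d[OF V'] cc(1)[OF sol] d[OF sol]])
              (use cc(3)[OF V'] cc(3)[OF sol] \<tau> in auto)
          show ?thesis
            by (rule ode_solution_unique[where f = "g2 s", OF C2(2)[OF sS] c2 cc(2)[OF V'] d'[OF V'] cc(2)[OF sol] d'[OF sol]])
              (use e \<tau> in auto)
        qed
        have "herglotz_solution A L \<tau>\<^sub>i z0 (\<Gamma> s) (Zhat A L \<tau>\<^sub>i z0 (\<Gamma> s))"
          unfolding Zhat_def by (rule someI[of "herglotz_solution A L \<tau>\<^sub>i z0 (\<Gamma> s)", OF sol])
        then show ?thesis
          unfolding action_def using uniq V2[of 1] \<tau> by simp
      qed
      have "((\<lambda>s. action A L \<tau>\<^sub>i z0 (\<Gamma> s)) has_real_derivative \<omega>) (at 0)"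
        by (rule has_field_derivative_transform_within_open[OF \<omega>, of "{- min r1 r2<..<min r1 r2}"])
          (use r1 r2 act in auto)
      then show thesis
      proof (rule that[OF _ H1(1) _ H1(3) _ _ H2(1) _ H2(3)])
        show "H1 0 = B1 0" "H1 \<tau>\<^sub>i = \<kappa>1 * (\<nu> + B1 \<tau>\<^sub>i)" "H2 \<tau>\<^sub>i = \<nu> + B2 \<tau>\<^sub>i" "H2 1 = \<kappa>2 * (\<omega> + B2 1)"
          using H1(2,4) H2(2,4) \<tau> by (simp_all add: B1_def B2_def base(3))
        show "\<exists>m>0. (H1 has_real_derivative
            m * (\<Sum>j\<in>UNIV. p1.el \<phi> j t * (snd (u t) \<phi> $ j - p1.ydot \<phi> t $ j * \<delta> t))) (at t)"
          if "\<phi> \<in> A" "t \<in> p1.J \<phi>" "t \<in> {0<..<\<tau>\<^sub>i}" for \<phi> t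
          using H1(5)[OF that] base(3)[of t] that(3) \<tau> by simp
        show "\<exists>m>0. (H2 has_real_derivative
            m * (\<Sum>j\<in>UNIV. p2.el \<phi> j t * (snd (u t) \<phi> $ j - p2.ydot \<phi> t $ j * \<delta> t))) (at t)"
          if "\<phi> \<in> A" "t \<in> p2.J \<phi>" "t \<in> {\<tau>\<^sub>i<..<1}" for \<phi> t
          using H2(5)[OF that] base(3)[of t] that(3) \<tau> by simp
      qed
    qed
  qed
qed

lemma fibre_deriv_zero: "fibre_deriv L w (p, \<lambda>_. 0) z = 0"
  by (simp add: fibre_deriv_def)

lemma fibre_deriv_pieces:
  assumes "\<phi> \<in> A" "w \<in> tangent_bundle A" "fst w = cq t" "cq t \<in> fst \<phi>"
  shows "t \<in> {0..\<tau>\<^sub>i} \<Longrightarrow> fibre_deriv L (p1.lift t) w (Z t) = (\<Sum>j\<in>UNIV. p1.mom \<phi> j t * snd w \<phi> $ j)"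
    and "t \<in> {\<tau>\<^sub>i..1} \<Longrightarrow> fibre_deriv L (p2.lift t) w (Z t) = (\<Sum>j\<in>UNIV. p2.mom \<phi> j t * snd w \<phi> $ j)"
proof -
  have w: "w = tvec_of A \<phi> (snd \<phi> (cq t)) (snd w \<phi>)"
    using tangent_vector_eq_tvec_of[OF assms(2,1)] assms(3,4) by simp
  note f = fibre_deriv_tvec_of[OF assms(1) imageI[OF assms(4)], of _ "snd w \<phi>" "Z t"]
  show "fibre_deriv L (p1.lift t) w (Z t) = (\<Sum>j\<in>UNIV. p1.mom \<phi> j t * snd w \<phi> $ j)" if "t \<in> {0..\<tau>\<^sub>i}"
  proof -
    have t: "t \<in> p1.J \<phi>"
      using that assms(4) unfolding p1.J_def by blast
    have "fibre_deriv L (p1.lift t) (tvec_of A \<phi> (snd \<phi> (cq t)) (snd w \<phi>)) (Z t) = (\<Sum>j\<in>UNIV. p1.mom \<phi> j t * snd w \<phi> $ j)"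
      unfolding p1.lift_eq[OF assms(1) t] f p1.mom_def p1.\<xi>_def ..
    then show ?thesis
      unfolding w[symmetric] .
  qed
  show "fibre_deriv L (p2.lift t) w (Z t) = (\<Sum>j\<in>UNIV. p2.mom \<phi> j t * snd w \<phi> $ j)" if "t \<in> {\<tau>\<^sub>i..1}"
  proof -
    have t: "t \<in> p2.J \<phi>"
      using that assms(4) unfolding p2.J_def by blast
    have "fibre_deriv L (p2.lift t) (tvec_of A \<phi> (snd \<phi> (cq t)) (snd w \<phi>)) (Z t) = (\<Sum>j\<in>UNIV. p2.mom \<phi> j t * snd w \<phi> $ j)"
      unfolding p2.lift_eq[OF assms(1) t] f p2.mom_def p2.\<xi>_def ..
    then show ?thesis
      unfolding w[symmetric] .
  qed
qed

lemma chart_at: "t \<in> {a..b} \<Longrightarrow> \<exists>\<phi>\<in>A. t \<in> {a..b} \<inter> cq -` fst \<phi>"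
  using chart_cover by blast

lemma action_derivative_jump:
  assumes el1: "\<And>\<phi> j t. \<phi> \<in> A \<Longrightarrow> t \<in> p1.J \<phi> \<Longrightarrow> t \<in> {0<..<\<tau>\<^sub>i} \<Longrightarrow> p1.el \<phi> j t = 0"
    and el2: "\<And>\<phi> j t. \<phi> \<in> A \<Longrightarrow> t \<in> p2.J \<phi> \<Longrightarrow> t \<in> {\<tau>\<^sub>i<..<1} \<Longrightarrow> p2.el \<phi> j t = 0"
    and w: "(u, \<delta>) \<in> fixed_end_variations A \<tau>\<^sub>i B (cq, ct)"
    and pc: "path_curve A \<tau>\<^sub>i (Omega A \<tau>\<^sub>i B q1 q2) (cq, ct) (u, \<delta>) \<Gamma>"
  shows "\<exists>\<kappa>>0. ((\<lambda>s. action A L \<tau>\<^sub>i z0 (\<Gamma> s)) has_real_derivative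
    \<kappa> * ((p2.En \<tau>\<^sub>i * \<delta> \<tau>\<^sub>i - fibre_deriv L (p2.lift \<tau>\<^sub>i) (u \<tau>\<^sub>i) (Z \<tau>\<^sub>i)) -
      (p1.En \<tau>\<^sub>i * \<delta> \<tau>\<^sub>i - fibre_deriv L (p1.lift \<tau>\<^sub>i) (u \<tau>\<^sub>i) (Z \<tau>\<^sub>i)))) (at 0)"
proof (rule first_variation_action[OF pc])
  let ?B1 = "\<lambda>t. p1.En t * \<delta> t - fibre_deriv L (p1.lift t) (u t) (Z t)"
  let ?B2 = "\<lambda>t. p2.En t * \<delta> t - fibre_deriv L (p2.lift t) (u t) (Z t)"
  fix \<omega> \<nu> H1 H2 \<kappa>1 \<kappa>2
  assume \<omega>: "((\<lambda>s. action A L \<tau>\<^sub>i z0 (\<Gamma> s)) has_real_derivative \<omega>) (at 0)"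
    and H1: "continuous_on {0..\<tau>\<^sub>i} H1" "H1 0 = ?B1 0" "0 < \<kappa>1" "H1 \<tau>\<^sub>i = \<kappa>1 * (\<nu> + ?B1 \<tau>\<^sub>i)"
    "\<And>\<phi> t. \<phi> \<in> A \<Longrightarrow> t \<in> p1.J \<phi> \<Longrightarrow> t \<in> {0<..<\<tau>\<^sub>i} \<Longrightarrow> \<exists>m>0. (H1 has_real_derivative
       m * (\<Sum>j\<in>UNIV. p1.el \<phi> j t * (snd (u t) \<phi> $ j - p1.ydot \<phi> t $ j * \<delta> t))) (at t)"
    and H2: "continuous_on {\<tau>\<^sub>i..1} H2" "H2 \<tau>\<^sub>i = \<nu> + ?B2 \<tau>\<^sub>i" "0 < \<kappa>2" "H2 1 = \<kappa>2 * (\<omega> + ?B2 1)"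
    "\<And>\<phi> t. \<phi> \<in> A \<Longrightarrow> t \<in> p2.J \<phi> \<Longrightarrow> t \<in> {\<tau>\<^sub>i<..<1} \<Longrightarrow> \<exists>m>0. (H2 has_real_derivative
       m * (\<Sum>j\<in>UNIV. p2.el \<phi> j t * (snd (u t) \<phi> $ j - p2.ydot \<phi> t $ j * \<delta> t))) (at t)"
  have ends: "u 0 = (fst (u 0), \<lambda>_. 0)" "u 1 = (fst (u 1), \<lambda>_. 0)" "\<delta> 0 = 0" "\<delta> 1 = 0"
    using w by (auto simp: fixed_end_variations_def prod_eq_iff)
  have B0: "?B1 0 = 0" "?B2 1 = 0"
    using ends fibre_deriv_zero by (metis diff_0_right mult_zero_right)+
  have "(H1 has_real_derivative 0) (at t)" if t: "0 < t" "t < \<tau>\<^sub>i" for t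
  proof -
    obtain \<phi> where \<phi>: "\<phi> \<in> A" "t \<in> p1.J \<phi>"
      using chart_at[of t 0 \<tau>\<^sub>i] t unfolding p1.J_def by force
    then show ?thesis
      using H1(5)[OF \<phi>] el1[OF \<phi>] t by simp
  qed
  then have "H1 \<tau>\<^sub>i = H1 0"
    using DERIV_isconst_end[OF \<tau>(1) H1(1)] by blast
  \<comment> \<open>\<open>H1\<close> starts at 0 and \<open>\<kappa>1\<close> is positive, so at
    the impact the variation of \<open>Z\<close> cancels the boundary term.\<close>
  then have \<nu>: "\<nu> = - ?B1 \<tau>\<^sub>i"
    using H1(2,3,4) B0(1) by simp
  have "(H2 has_real_derivative 0) (at t)" if t: "\<tau>\<^sub>i < t" "t < 1" for t
  proof -
    obtain \<phi> where \<phi>: "\<phi> \<in> A" "t \<in> p2.J \<phi>"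
      using chart_at[of t \<tau>\<^sub>i 1] t unfolding p2.J_def by force
    then show ?thesis
      using H2(5)[OF \<phi>] el2[OF \<phi>] t by simp
  qed
  then have "H2 1 = H2 \<tau>\<^sub>i"
    using DERIV_isconst_end[OF \<tau>(2) H2(1)] by blast
  then have "\<kappa>2 * \<omega> = ?B2 \<tau>\<^sub>i - ?B1 \<tau>\<^sub>i"
    using H2(2,4) B0(2) \<nu> by simp
  then have "\<omega> = (1 / \<kappa>2) * (?B2 \<tau>\<^sub>i - ?B1 \<tau>\<^sub>i)"
    using H2(3) by (simp add: field_simps)
  then show ?thesis
    using \<omega> H2(3) by (intro exI[of _ "1 / \<kappa>2"]) simp
qed

text \<open>The window of the bump keeps clear of the impact, so the impact point is fixed and the
  boundary terms vanish there as well as at both ends. Then \<open>H1\<close> and \<open>H2\<close>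
  are linked only by \<nu>, and criticality makes \<open>H2\<close> end at 0.\<close>

lemma bump_variation:
  assumes crit: "critical_point A L \<tau>\<^sub>i z0 B (cq 0) (cq 1) (cq, ct)"
    and \<phi>: "\<phi> \<in> A" and r: "0 < r" "2 * r \<le> c" "c + 2 * r \<le> 1" "2 * r \<le> \<bar>\<tau>\<^sub>i - c\<bar>"
    and dom: "\<And>t. t \<in> {0..1} \<Longrightarrow> \<bar>t - c\<bar> < 2 * r \<Longrightarrow> cq t \<in> fst \<phi>"
  obtains u \<nu> H1 H2 \<kappa> where
    "\<And>t. t \<in> {0..1} \<Longrightarrow> \<bar>t - c\<bar> < 2 * r \<Longrightarrow> snd (u t) \<phi> = bump c r t *\<^sub>R v"
    "\<And>t. t \<in> {0..1} \<Longrightarrow> r \<le> \<bar>t - c\<bar> \<Longrightarrow> u t = (cq t, \<lambda>_. 0)"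
    "continuous_on {0..\<tau>\<^sub>i} H1" "H1 0 = 0" "0 < \<kappa>" "H1 \<tau>\<^sub>i = \<kappa> * \<nu>"
    "\<And>\<phi> t. \<phi> \<in> A \<Longrightarrow> t \<in> p1.J \<phi> \<Longrightarrow> t \<in> {0<..<\<tau>\<^sub>i} \<Longrightarrow>
      \<exists>m>0. (H1 has_real_derivative m * (\<Sum>j\<in>UNIV. p1.el \<phi> j t * snd (u t) \<phi> $ j)) (at t)"
    "continuous_on {\<tau>\<^sub>i..1} H2" "H2 \<tau>\<^sub>i = \<nu>" "H2 1 = 0"
    "\<And>\<phi> t. \<phi> \<in> A \<Longrightarrow> t \<in> p2.J \<phi> \<Longrightarrow> t \<in> {\<tau>\<^sub>i<..<1} \<Longrightarrow>
      \<exists>m>0. (H2 has_real_derivative m * (\<Sum>j\<in>UNIV. p2.el \<phi> j t * snd (u t) \<phi> $ j)) (at t)"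
proof -
  let ?\<beta> = "\<lambda>s::real. s *\<^sub>R v"
  define u where "u t = velocity A (\<lambda>s. chart_variation \<phi> c r ?\<beta> cq s t) UNIV 0" for t
  have \<beta>: "Ck_on 2 ?\<beta> {-1<..<1}" "?\<beta> 0 = 0" "(?\<beta> has_vector_derivative v) (at 0)"
  proof -
    show "Ck_on 2 ?\<beta> {-1<..<1}"
      by (intro Ck_on_bounded_linear bounded_linear_scaleR_left thick_open) simp
    show "(?\<beta> has_vector_derivative v) (at 0)"
      by (simp add: has_vector_derivative_def bounded_linear_imp_has_derivative bounded_linear_scaleR_left)
  qed simp
  have \<tau>c: "chart_variation \<phi> c r ?\<beta> cq s \<tau>\<^sub>i = cq \<tau>\<^sub>i" for s
    using r(1,4) by (simp add: chart_variation_def)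
  have B: "cq \<tau>\<^sub>i \<in> B"
    using cq by (simp add: config_paths_def)
  have rc: "r \<le> c" "c + r \<le> 1"
    using r by auto
  have cross: "\<And>s. s \<in> {-1<..<1} \<Longrightarrow> chart_variation \<phi> c r ?\<beta> cq s \<tau>\<^sub>i \<in> B"
      "\<And>k. manifold_Ck A k (\<lambda>s. chart_variation \<phi> c r ?\<beta> cq s \<tau>\<^sub>i) {-1<..<1}"
    unfolding \<tau>c by (rule B) (rule manifold_Ck_const, simp)
  note adm = chart_variation_admissible[where \<beta> = ?\<beta> and v = v and c = c and r = r and \<phi> = \<phi>,
      OF \<tau> cq ct \<phi> r(1) rc dom zero_less_one \<beta> cross]
  have w: "(u, \<lambda>_. 0) \<in> fixed_end_variations A \<tau>\<^sub>i B (cq, ct)"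
    unfolding u_def[abs_def] by (rule adm(1))
  have pc: "path_curve A \<tau>\<^sub>i (Omega A \<tau>\<^sub>i B (cq 0) (cq 1)) (cq, ct) (u, \<lambda>_. 0) (\<lambda>s. (chart_variation \<phi> c r ?\<beta> cq s, ct))"
    unfolding u_def[abs_def] by (rule adm(2))
  have u1: "snd (u t) \<phi> = bump c r t *\<^sub>R v" if "t \<in> {0..1}" "\<bar>t - c\<bar> < 2 * r" for t
    unfolding u_def by (rule adm(3)) (use that in auto)
  have u2: "u t = (cq t, \<lambda>_. 0)" if "t \<in> {0..1}" "r \<le> \<bar>t - c\<bar>" for t
    unfolding u_def by (rule adm(4)) (use that in auto)
  have crit0: "((\<lambda>s. action A L \<tau>\<^sub>i z0 (chart_variation \<phi> c r ?\<beta> cq s, ct)) has_real_derivative 0) (at 0)"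
    using crit w pc unfolding critical_point_def by blast
  have u0: "u 0 = (cq 0, \<lambda>_. 0)" "u 1 = (cq 1, \<lambda>_. 0)" "u \<tau>\<^sub>i = (cq \<tau>\<^sub>i, \<lambda>_. 0)"
    using r \<tau> by (intro u2; simp)+
  show thesis
  proof (rule first_variation_action[OF pc])
    fix \<omega> \<nu> H1 H2 \<kappa>1 \<kappa>2
    assume \<omega>: "((\<lambda>s. action A L \<tau>\<^sub>i z0 (chart_variation \<phi> c r ?\<beta> cq s, ct)) has_real_derivative \<omega>) (at 0)"
      and H1: "continuous_on {0..\<tau>\<^sub>i} H1" "H1 0 = p1.En 0 * 0 - fibre_deriv L (p1.lift 0) (u 0) (Z 0)" "0 < \<kappa>1"
        "H1 \<tau>\<^sub>i = \<kappa>1 * (\<nu> + (p1.En \<tau>\<^sub>i * 0 - fibre_deriv L (p1.lift \<tau>\<^sub>i) (u \<tau>\<^sub>i) (Z \<tau>\<^sub>i)))"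
        "\<And>\<phi> t. \<phi> \<in> A \<Longrightarrow> t \<in> p1.J \<phi> \<Longrightarrow> t \<in> {0<..<\<tau>\<^sub>i} \<Longrightarrow> \<exists>m>0. (H1 has_real_derivative
          m * (\<Sum>j\<in>UNIV. p1.el \<phi> j t * (snd (u t) \<phi> $ j - p1.ydot \<phi> t $ j * 0))) (at t)"
      and H2: "continuous_on {\<tau>\<^sub>i..1} H2" "H2 \<tau>\<^sub>i = \<nu> + (p2.En \<tau>\<^sub>i * 0 - fibre_deriv L (p2.lift \<tau>\<^sub>i) (u \<tau>\<^sub>i) (Z \<tau>\<^sub>i))" "0 < \<kappa>2"
        "H2 1 = \<kappa>2 * (\<omega> + (p2.En 1 * 0 - fibre_deriv L (p2.lift 1) (u 1) (Z 1)))"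
        "\<And>\<phi> t. \<phi> \<in> A \<Longrightarrow> t \<in> p2.J \<phi> \<Longrightarrow> t \<in> {\<tau>\<^sub>i<..<1} \<Longrightarrow> \<exists>m>0. (H2 has_real_derivative
          m * (\<Sum>j\<in>UNIV. p2.el \<phi> j t * (snd (u t) \<phi> $ j - p2.ydot \<phi> t $ j * 0))) (at t)"
    have \<omega>0: "\<omega> = 0"
      using DERIV_unique[OF \<omega> crit0] .
    have h: "H1 0 = 0" "H1 \<tau>\<^sub>i = \<kappa>1 * \<nu>" "H2 \<tau>\<^sub>i = \<nu>" "H2 1 = 0"
      using H1(2,4) H2(2,4) by (simp_all add: u0 fibre_deriv_zero \<omega>0)
    show thesis
      by (rule that[of u H1 \<kappa>1 \<nu> H2, OF u1 u2 H1(1) h(1) H1(3) h(2) H1(5)[unfolded mult_zero_right diff_0_right]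
            H2(1) h(3,4) H2(5)[unfolded mult_zero_right diff_0_right]])
  qed
qed

end

text \<open>Equal end values leave a nondecreasing function no choice but to be constant.\<close>

lemma zero_derivative_of_monotone:
  fixes H :: "real \<Rightarrow> real"
  assumes cont: "continuous_on {a..b} H" and ends: "H a = H b" and t0: "t0 \<in> {a<..<b}"
    and der: "\<And>t. t \<in> {a<..<b} \<Longrightarrow> \<exists>y\<ge>0. (H has_real_derivative y) (at t)"
    and d: "(H has_real_derivative d) (at t0)"
  shows "d = 0"
proof -
  have der': "\<exists>y. (H has_real_derivative y) (at x) \<and> 0 \<le> y" if "a < x" "x < b" for x
    using der[of x] that by auto
  have "H t = H a" if t: "t \<in> {a<..<b}" for t
  proof -
    have "H a \<le> H t"
      by (rule nondecreasing_openI[where f = H, OF _ continuous_on_subset[OF cont]]) (use t in \<open>auto intro: der'\<close>)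
    moreover have "H t \<le> H b"
      by (rule nondecreasing_openI[where f = H, OF _ continuous_on_subset[OF cont]]) (use t in \<open>auto intro: der'\<close>)
    ultimately show ?thesis
      using ends by simp
  qed
  then have "(H has_real_derivative 0) (at t0)"
    by (intro has_field_derivative_transform_within_open[OF DERIV_const, of "{a<..<b}" t0 "H a"]) (use t0 in auto)
  then show ?thesis
    using d DERIV_unique by blast
qed

text \<open>Variations vanish at the times 0 and 1, so the equations of motion there come from
  interior times by continuity. As \<open>J\<close> is relatively open, interior times belonging to
  \<open>J\<close> come arbitrarily close to \<open>t\<close>.\<close>

lemma zero_on_closure:
  fixes e :: "real \<Rightarrow> real"
  assumes ab: "a < b" and cont: "continuous_on J e" and J: "openin (top_of_set {a..b}) J"
    and zero: "\<And>t. t \<in> J \<Longrightarrow> t \<in> {a<..<b} \<Longrightarrow> e t = 0" and t: "t \<in> J"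
  shows "e t = 0"
proof (rule ccontr)
  assume nz: "e t \<noteq> 0"
  obtain U where U: "open U" "J = {a..b} \<inter> U"
    using J by (auto simp: openin_open)
  have "\<forall>\<^sub>F s in at t within J. e s \<noteq> 0"
    using cont t nz by (intro tendsto_imp_eventually_ne[of e "e t"]) (auto simp: continuous_on_def)
  then obtain d where d: "d > 0" "\<And>s. s \<in> J \<Longrightarrow> s \<noteq> t \<Longrightarrow> dist s t < d \<Longrightarrow> e s \<noteq> 0"
    unfolding eventually_at by blast
  have "t \<in> closure {a<..<b}"
    using t U ab by (simp add: closure_greaterThanLessThan)
  moreover have "open (U \<inter> ball t d)" "t \<in> U \<inter> ball t d"
    using U t d by auto
  ultimately obtain s where s: "s \<in> U \<inter> ball t d" "s \<in> {a<..<b}"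
    by (metis open_Int_closure_eq_empty disjoint_iff)
  then have "s \<in> J"
    using U by auto
  then have "e s = 0"
    using zero s(2) by blast
  moreover have "e s \<noteq> 0"
    using d(2)[OF \<open>s \<in> J\<close>] s(1) nz by (cases "s = t") (auto simp: dist_commute)
  ultimately show False by blast
qed

section \<open>Critical points of the action\<close>

lemma manifold_Ck_subset:
  assumes "manifold_Ck A k f S" "T \<subseteq> S" "open T" "\<And>\<phi>. \<phi> \<in> A \<Longrightarrow> open (fst \<phi>)"
  shows "manifold_Ck A k f T"
  unfolding manifold_Ck_def
proof (intro conjI ballI)
  show c: "continuous_on T f"
    using assms(1,2) continuous_on_subset unfolding manifold_Ck_def by blast
  fix \<phi> assume \<phi>: "\<phi> \<in> A"
  have o: "open (T \<inter> f -` fst \<phi>)"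
    by (rule continuous_open_preimage[OF c assms(3) assms(4)[OF \<phi>]])
  have C: "Ck_on k (snd \<phi> \<circ> f) (S \<inter> f -` fst \<phi>)"
    using assms(1) \<phi> unfolding manifold_Ck_def by blast
  show "Ck_on k (snd \<phi> \<circ> f) (T \<inter> f -` fst \<phi>)"
    by (rule Ck_on_subset[OF C _ thick_open[OF o]]) (use assms(2) in blast)
qed

lemma manifold_Ck_cong:
  assumes "\<And>x. x \<in> S \<Longrightarrow> f x = g x" "manifold_Ck A k g S"
  shows "manifold_Ck A k f S"
  unfolding manifold_Ck_def
proof (intro conjI ballI)
  show "continuous_on S f"
    using assms unfolding manifold_Ck_def by (simp cong: continuous_on_cong)
  fix \<phi> assume \<phi>: "\<phi> \<in> A"
  have eq: "S \<inter> f -` fst \<phi> = S \<inter> g -` fst \<phi>"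
    using assms(1) by auto
  have "Ck_on k (snd \<phi> \<circ> g) (S \<inter> g -` fst \<phi>)"
    using assms(2) \<phi> unfolding manifold_Ck_def by blast
  then show "Ck_on k (snd \<phi> \<circ> f) (S \<inter> f -` fst \<phi>)"
    unfolding eq by (rule Ck_on_cong[THEN iffD1, rotated]) (simp add: assms(1))
qed

text \<open>The parameter interval is shrunk until the curve representing \<open>v\<close> fits into
  the given chart; its coordinate expression will then serve as displacement of the impact
  point.\<close>

lemma (in smooth_mfd) tangent_space_curve:
  assumes v: "v \<in> tangent_space A B p" and \<phi>: "\<phi> \<in> A" "p \<in> fst \<phi>"
  obtains \<beta> \<epsilon> where "0 < \<epsilon>" "\<beta> 0 = p" "\<And>s. s \<in> {-\<epsilon><..<\<epsilon>} \<Longrightarrow> \<beta> s \<in> B" "\<And>s. s \<in> {-\<epsilon><..<\<epsilon>} \<Longrightarrow> \<beta> s \<in> fst \<phi>"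
    "\<And>k. manifold_Ck A k \<beta> {-\<epsilon><..<\<epsilon>}" "Ck_on 2 (snd \<phi> \<circ> \<beta>) {-\<epsilon><..<\<epsilon>}"
    "(snd \<phi> \<circ> \<beta> has_vector_derivative snd v \<phi>) (at 0)" "v \<in> tangent_bundle A" "fst v = p"
proof -
  obtain \<beta> \<epsilon>0 where \<beta>: "v = velocity A \<beta> UNIV 0" "\<beta> 0 = p" "0 < \<epsilon>0" "\<beta> ` {-\<epsilon>0<..<\<epsilon>0} \<subseteq> B"
    and \<beta>_smooth: "\<forall>k. manifold_Ck A k \<beta> {-\<epsilon>0<..<\<epsilon>0}"
    using v unfolding tangent_space_def mem_Collect_eq by (elim exE conjE) (rule that)
  have c: "continuous_on {-\<epsilon>0<..<\<epsilon>0} \<beta>"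
    using \<beta>_smooth[rule_format, of 0] by (simp add: manifold_Ck_def)
  have o: "open ({-\<epsilon>0<..<\<epsilon>0} \<inter> \<beta> -` fst \<phi>)"
    by (rule continuous_open_preimage[OF c _ chart(1)[OF \<phi>(1)]]) simp
  have "0 \<in> {-\<epsilon>0<..<\<epsilon>0} \<inter> \<beta> -` fst \<phi>"
    using \<beta>(2,3) \<phi>(2) by simp
  with o obtain \<epsilon> where \<epsilon>: "0 < \<epsilon>" "ball 0 \<epsilon> \<subseteq> {-\<epsilon>0<..<\<epsilon>0} \<inter> \<beta> -` fst \<phi>"
    by (rule openE)
  have ball: "ball 0 \<epsilon> = {-\<epsilon><..<\<epsilon>}"
    by (auto simp: dist_real_def)
  let ?T = "{-\<epsilon><..<\<epsilon>}"
  have T: "open ?T" "0 \<in> ?T" "?T \<subseteq> {-\<epsilon>0<..<\<epsilon>0}" "\<And>s. s \<in> ?T \<Longrightarrow> \<beta> s \<in> fst \<phi>"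
    using \<epsilon> unfolding ball by auto
  have m: "manifold_Ck A k \<beta> ?T" for k
    by (rule manifold_Ck_subset[OF \<beta>_smooth[rule_format] T(3,1) chart(1)])
  have TT: "?T \<inter> \<beta> -` fst \<phi> = ?T"
    using T(4) by blast
  have C: "Ck_on 2 (snd \<phi> \<circ> \<beta>) ?T"
    using m[of 2] \<phi>(1) TT unfolding manifold_Ck_def by metis
  then have "(snd \<phi> \<circ> \<beta>) differentiable (at 0)"
    using Ck_on_open_has_derivative[OF _ T(1,2), of 1] unfolding numeral_2_eq_2 One_nat_def differentiable_def by blast
  then have d: "(snd \<phi> \<circ> \<beta> has_vector_derivative vector_derivative (snd \<phi> \<circ> \<beta>) (at 0)) (at 0)"
    by (simp add: vector_derivative_works)
  have cont: "isCont \<beta> 0"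
    using c \<beta>(3) by (simp add: continuous_on_eq_continuous_at)
  have dom: "\<beta> 0 \<in> fst \<phi>"
    using \<beta>(2) \<phi>(2) by simp
  have "v \<in> tangent_bundle A"
    unfolding \<beta>(1) by (rule velocity_in_tangent_bundle[OF cont UNIV_I _ \<phi>(1) dom d]) simp
  moreover have "fst v = p" "snd v \<phi> = vector_derivative (snd \<phi> \<circ> \<beta>) (at 0)"
    using dom \<phi>(1) by (simp_all add: \<beta>(1,2) velocity_def)
  moreover have "\<beta> s \<in> B" if "s \<in> ?T" for s
    using that T(3) \<beta>(4) by blast
  ultimately show thesis
    using that[of \<epsilon> \<beta>] \<epsilon>(1) \<beta>(2) T(4) m C d by presburger
qed

text \<open>The factor \<open>sgn (e t0)\<close> treats both signs of \<open>e t0\<close> at once.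
  The bounds on \<open>R\<close> keep the neighbourhood inside the piece.\<close>

lemma sign_nbhd:
  fixes e :: "real \<Rightarrow> real"
  assumes cont: "continuous_on J e" and J: "openin (top_of_set {a..b}) J"
    and t0: "t0 \<in> J" "t0 \<in> {a<..<b}" and nz: "e t0 \<noteq> 0"
  shows "\<exists>R>0. R \<le> t0 - a \<and> R \<le> b - t0 \<and> (\<forall>t. \<bar>t - t0\<bar> < R \<longrightarrow> t \<in> J \<and> 0 < sgn (e t0) * e t)"
proof -
  obtain U where U: "open U" "J = {a..b} \<inter> U"
    using J by (auto simp: openin_open)
  obtain d1 where d1: "d1 > 0" "ball t0 d1 \<subseteq> U"
    using U t0(1) open_contains_ball by blast
  have "((\<lambda>t. sgn (e t0) * e t) \<longlongrightarrow> sgn (e t0) * e t0) (at t0 within J)"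
    using cont t0(1) by (intro tendsto_mult_left) (simp add: continuous_on_def)
  moreover have pos: "0 < sgn (e t0) * e t0"
    using nz by (simp add: sgn_mult_self_eq abs_sgn_eq sgn_if)
  ultimately have "\<forall>\<^sub>F t in at t0 within J. 0 < sgn (e t0) * e t"
    by (rule order_tendstoD(1))
  then obtain d2 where d2: "d2 > 0" "\<And>t. t \<in> J \<Longrightarrow> t \<noteq> t0 \<Longrightarrow> dist t t0 < d2 \<Longrightarrow> 0 < sgn (e t0) * e t"
    unfolding eventually_at by blast
  define R where "R = min (min d1 d2) (min (t0 - a) (b - t0))"
  have R: "R \<le> d1" "R \<le> d2" "R \<le> t0 - a" "R \<le> b - t0" "0 < R"
    using d1(1) d2(1) t0(2) by (auto simp: R_def)
  have "t \<in> J \<and> 0 < sgn (e t0) * e t" if t: "\<bar>t - t0\<bar> < R" for t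
  proof -
    have "t \<in> ball t0 d1" "t \<in> {a..b}"
      using t R by (auto simp: dist_real_def)
    then have "t \<in> J"
      using d1 U by blast
    moreover have "0 < sgn (e t0) * e t"
      using d2(2)[OF \<open>t \<in> J\<close>] t R pos by (cases "t = t0") (auto simp: dist_real_def)
    ultimately show ?thesis by blast
  qed
  then show ?thesis
    using R by blast
qed

lemma vector_derivative_openin_cong:
  assumes "openin (top_of_set I) T" "t \<in> T" "\<And>s. s \<in> T \<Longrightarrow> f s = g s"
  shows "vector_derivative f (at t within I) = vector_derivative g (at t within I)"
  using vector_derivative_within_cong[of T f g, OF assms(3,2)] at_within_openin[OF assms(1,2)] by simp

context herglotz_path
begin

text \<open>The bump points along the axis \<open>j\<close>, so only the \<open>j\<close>-th
  expression is paired with the variation, and the factor \<open>sgn (e t0)\<close> makes the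
  pairing nonnegative on the whole window.\<close>

lemma euler_lagrange_interior:
  assumes crit: "critical_point A L \<tau>\<^sub>i z0 B (cq 0) (cq 1) (cq, ct)" and \<phi>: "\<phi> \<in> A"
  shows "t0 \<in> p1.J \<phi> \<Longrightarrow> t0 \<in> {0<..<\<tau>\<^sub>i} \<Longrightarrow> p1.el \<phi> j t0 = 0"
    and "t0 \<in> p2.J \<phi> \<Longrightarrow> t0 \<in> {\<tau>\<^sub>i<..<1} \<Longrightarrow> p2.el \<phi> j t0 = 0"
proof -
  show "p1.el \<phi> j t0 = 0" if t0: "t0 \<in> p1.J \<phi>" "t0 \<in> {0<..<\<tau>\<^sub>i}"
  proof (rule ccontr)
    assume nz: "p1.el \<phi> j t0 \<noteq> 0"
    obtain e where e: "continuous_on (p1.J \<phi>) e" "\<And>t. t \<in> p1.J \<phi> \<Longrightarrow>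
        (Z has_real_derivative p1.rate t) (at t within {0..\<tau>\<^sub>i}) \<Longrightarrow> p1.el \<phi> j t = e t"
      using p1.el_continuous_extension[OF \<phi>] by metis
    have el: "p1.el \<phi> j t = e t" if "t \<in> p1.J \<phi>" "t \<in> {0<..<\<tau>\<^sub>i}" for t
      using e(2)[OF that(1) Z_derivs(1)] that(2) by simp
    have e0: "e t0 \<noteq> 0"
      using nz el[OF t0] by simp
    obtain R where R: "0 < R" "R \<le> t0 - 0" "R \<le> \<tau>\<^sub>i - t0"
      "\<And>t. \<bar>t - t0\<bar> < R \<Longrightarrow> t \<in> p1.J \<phi> \<and> 0 < sgn (e t0) * e t"
      using sign_nbhd[OF e(1) p1.J_openin[OF \<phi>] t0 e0] by blast
    \<comment> \<open>The window \<open>2 * r\<close> of the chart formula is then exactly the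
      neighbourhood on which the sign is controlled.\<close>
    define r where "r = R / 2"
    have r: "0 < r" "2 * r \<le> t0" "t0 + 2 * r \<le> 1" "2 * r \<le> \<bar>\<tau>\<^sub>i - t0\<bar>"
      using R \<tau> by (auto simp: r_def)
    have dom: "cq t \<in> fst \<phi>" if "\<bar>t - t0\<bar> < 2 * r" for t
      using R(4)[of t] that by (simp add: p1.J_def r_def)
    show False
    proof (rule bump_variation[OF crit \<phi> r dom, where v = "sgn (e t0) *\<^sub>R axis j 1"])
      fix u \<nu> H1 H2 \<kappa>
      assume u1: "\<And>t. t \<in> {0..1} \<Longrightarrow> \<bar>t - t0\<bar> < 2 * r \<Longrightarrow> snd (u t) \<phi> = bump t0 r t *\<^sub>R sgn (e t0) *\<^sub>R axis j 1"
        and u2: "\<And>t. t \<in> {0..1} \<Longrightarrow> r \<le> \<bar>t - t0\<bar> \<Longrightarrow> u t = (cq t, \<lambda>_. 0)"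
        and H1: "continuous_on {0..\<tau>\<^sub>i} H1" "H1 0 = 0" "0 < \<kappa>" "H1 \<tau>\<^sub>i = \<kappa> * \<nu>"
          "\<And>\<phi> t. \<phi> \<in> A \<Longrightarrow> t \<in> p1.J \<phi> \<Longrightarrow> t \<in> {0<..<\<tau>\<^sub>i} \<Longrightarrow>
            \<exists>m>0. (H1 has_real_derivative m * (\<Sum>j\<in>UNIV. p1.el \<phi> j t * snd (u t) \<phi> $ j)) (at t)"
        and H2: "continuous_on {\<tau>\<^sub>i..1} H2" "H2 \<tau>\<^sub>i = \<nu>" "H2 1 = 0"
          "\<And>\<phi> t. \<phi> \<in> A \<Longrightarrow> t \<in> p2.J \<phi> \<Longrightarrow> t \<in> {\<tau>\<^sub>i<..<1} \<Longrightarrow>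
            \<exists>m>0. (H2 has_real_derivative m * (\<Sum>j\<in>UNIV. p2.el \<phi> j t * snd (u t) \<phi> $ j)) (at t)"
      \<comment> \<open>The bump lies in the first piece, so \<open>H2\<close> is constant; its end
        value 0 forces \<nu> = 0, and \<open>H1\<close> gets equal end values.\<close>
      have "(H2 has_real_derivative 0) (at t)" if t: "\<tau>\<^sub>i < t" "t < 1" for t
      proof -
        obtain \<psi> where \<psi>: "\<psi> \<in> A" "t \<in> p2.J \<psi>"
          using chart_at[of t \<tau>\<^sub>i 1] t unfolding p2.J_def by force
        have "u t = (cq t, \<lambda>_. 0)"
          by (rule u2) (use t \<tau> r t0 in auto)
        then show ?thesis
          using H2(4)[OF \<psi>] t by simp
      qed
      then have "H2 1 = H2 \<tau>\<^sub>i"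
        using DERIV_isconst_end[OF \<tau>(2) H2(1)] by blast
      then have ends: "H1 0 = H1 \<tau>\<^sub>i"
        using H1(2,4) H2(2,3) by simp
      have near: "\<exists>m>0. (H1 has_real_derivative m * (bump t0 r t * (sgn (e t0) * e t))) (at t)"
        if t: "\<bar>t - t0\<bar> < 2 * r" for t
      proof -
        have tI: "t \<in> {0<..<\<tau>\<^sub>i}" "t \<in> {0..1}"
          using t R \<tau> by (auto simp: r_def)
        have tJ: "t \<in> p1.J \<phi>"
          using R(4)[of t] t by (simp add: r_def)
        have "(\<Sum>i\<in>UNIV. p1.el \<phi> i t * snd (u t) \<phi> $ i) = bump t0 r t * (sgn (e t0) * e t)"
          by (simp add: u1[OF tI(2) t] axis_def if_distrib el[OF tJ tI(1)] mult_ac cong: if_cong)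
        then show ?thesis
          using H1(5)[OF \<phi> tJ tI(1)] by simp
      qed
      \<comment> \<open>At the centre the bump equals 1, so the derivative of \<open>H1\<close>
        there is a positive multiple of \<open>\<bar>e t0\<bar>\<close>, which cannot be 0.\<close>
      obtain m where m: "m > 0" "(H1 has_real_derivative m * (bump t0 r t0 * (sgn (e t0) * e t0))) (at t0)"
        using near[of t0] r(1) by auto
      have "m * (bump t0 r t0 * (sgn (e t0) * e t0)) = 0"
      proof (rule zero_derivative_of_monotone[OF H1(1) ends t0(2) _ m(2)])
        fix t assume t: "t \<in> {0<..<\<tau>\<^sub>i}"
        show "\<exists>y\<ge>0. (H1 has_real_derivative y) (at t)"
        proof (cases "\<bar>t - t0\<bar> < 2 * r")
          case True
          obtain m where m: "m > 0" "(H1 has_real_derivative m * (bump t0 r t * (sgn (e t0) * e t))) (at t)"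
            using near[OF True] by blast
          have "\<bar>t - t0\<bar> < R"
            using True by (simp add: r_def)
          from conjunct2[OF R(4)[OF this]] have "0 \<le> m * (bump t0 r t * (sgn (e t0) * e t))"
            by (intro mult_nonneg_nonneg[OF less_imp_le[OF m(1)] mult_nonneg_nonneg[OF bump_simps(2)]] less_imp_le)
          then show ?thesis
            using m(2) by blast
        next
          case False
          obtain \<psi> where \<psi>: "\<psi> \<in> A" "t \<in> p1.J \<psi>"
            using chart_at[of t 0 \<tau>\<^sub>i] t unfolding p1.J_def by force
          have "u t = (cq t, \<lambda>_. 0)"
            by (rule u2) (use t \<tau> r(1) False in auto)
          then show ?thesis
            using H1(5)[OF \<psi> t] by auto
        qed
      qed
      then show False
        using m(1) e0 by (simp add: bump_simps(1) sgn_eq_0_iff)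
    qed
  qed
  show "p2.el \<phi> j t0 = 0" if t0: "t0 \<in> p2.J \<phi>" "t0 \<in> {\<tau>\<^sub>i<..<1}"
  proof (rule ccontr)
    assume nz: "p2.el \<phi> j t0 \<noteq> 0"
    obtain e where e: "continuous_on (p2.J \<phi>) e" "\<And>t. t \<in> p2.J \<phi> \<Longrightarrow>
        (Z has_real_derivative p2.rate t) (at t within {\<tau>\<^sub>i..1}) \<Longrightarrow> p2.el \<phi> j t = e t"
      using p2.el_continuous_extension[OF \<phi>] by metis
    have el: "p2.el \<phi> j t = e t" if "t \<in> p2.J \<phi>" "t \<in> {\<tau>\<^sub>i<..<1}" for t
      using e(2)[OF that(1) Z_derivs(2)] that(2) by simp
    have e0: "e t0 \<noteq> 0"
      using nz el[OF t0] by simp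
    obtain R where R: "0 < R" "R \<le> t0 - \<tau>\<^sub>i" "R \<le> 1 - t0"
      "\<And>t. \<bar>t - t0\<bar> < R \<Longrightarrow> t \<in> p2.J \<phi> \<and> 0 < sgn (e t0) * e t"
      using sign_nbhd[OF e(1) p2.J_openin[OF \<phi>] t0 e0] by blast
    define r where "r = R / 2"
    have r: "0 < r" "2 * r \<le> t0" "t0 + 2 * r \<le> 1" "2 * r \<le> \<bar>\<tau>\<^sub>i - t0\<bar>"
      using R \<tau> by (auto simp: r_def)
    have dom: "cq t \<in> fst \<phi>" if "\<bar>t - t0\<bar> < 2 * r" for t
      using R(4)[of t] that by (simp add: p2.J_def r_def)
    show False
    proof (rule bump_variation[OF crit \<phi> r dom, where v = "sgn (e t0) *\<^sub>R axis j 1"])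
      fix u \<nu> H1 H2 \<kappa>
      assume u1: "\<And>t. t \<in> {0..1} \<Longrightarrow> \<bar>t - t0\<bar> < 2 * r \<Longrightarrow> snd (u t) \<phi> = bump t0 r t *\<^sub>R sgn (e t0) *\<^sub>R axis j 1"
        and u2: "\<And>t. t \<in> {0..1} \<Longrightarrow> r \<le> \<bar>t - t0\<bar> \<Longrightarrow> u t = (cq t, \<lambda>_. 0)"
        and H1: "continuous_on {0..\<tau>\<^sub>i} H1" "H1 0 = 0" "0 < \<kappa>" "H1 \<tau>\<^sub>i = \<kappa> * \<nu>"
          "\<And>\<phi> t. \<phi> \<in> A \<Longrightarrow> t \<in> p1.J \<phi> \<Longrightarrow> t \<in> {0<..<\<tau>\<^sub>i} \<Longrightarrow>
            \<exists>m>0. (H1 has_real_derivative m * (\<Sum>j\<in>UNIV. p1.el \<phi> j t * snd (u t) \<phi> $ j)) (at t)"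
        and H2: "continuous_on {\<tau>\<^sub>i..1} H2" "H2 \<tau>\<^sub>i = \<nu>" "H2 1 = 0"
          "\<And>\<phi> t. \<phi> \<in> A \<Longrightarrow> t \<in> p2.J \<phi> \<Longrightarrow> t \<in> {\<tau>\<^sub>i<..<1} \<Longrightarrow>
            \<exists>m>0. (H2 has_real_derivative m * (\<Sum>j\<in>UNIV. p2.el \<phi> j t * snd (u t) \<phi> $ j)) (at t)"
      \<comment> \<open>On the second piece the roles are exchanged: \<open>H1\<close> is constant
        0, so \<nu> = 0 and \<open>H2\<close> starts where it ends.\<close>
      have "(H1 has_real_derivative 0) (at t)" if t: "0 < t" "t < \<tau>\<^sub>i" for t
      proof -
        obtain \<psi> where \<psi>: "\<psi> \<in> A" "t \<in> p1.J \<psi>"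
          using chart_at[of t 0 \<tau>\<^sub>i] t unfolding p1.J_def by force
        have "u t = (cq t, \<lambda>_. 0)"
          by (rule u2) (use t \<tau> r t0 in auto)
        then show ?thesis
          using H1(5)[OF \<psi>] t by simp
      qed
      then have "H1 \<tau>\<^sub>i = H1 0"
        using DERIV_isconst_end[OF \<tau>(1) H1(1)] by blast
      then have ends: "H2 \<tau>\<^sub>i = H2 1"
        using H1(2,3,4) H2(2,3) by simp
      have near: "\<exists>m>0. (H2 has_real_derivative m * (bump t0 r t * (sgn (e t0) * e t))) (at t)"
        if t: "\<bar>t - t0\<bar> < 2 * r" for t
      proof -
        have tI: "t \<in> {\<tau>\<^sub>i<..<1}" "t \<in> {0..1}"
          using t R \<tau> by (auto simp: r_def)
        have tJ: "t \<in> p2.J \<phi>"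
          using R(4)[of t] t by (simp add: r_def)
        have "(\<Sum>i\<in>UNIV. p2.el \<phi> i t * snd (u t) \<phi> $ i) = bump t0 r t * (sgn (e t0) * e t)"
          by (simp add: u1[OF tI(2) t] axis_def if_distrib el[OF tJ tI(1)] mult_ac cong: if_cong)
        then show ?thesis
          using H2(4)[OF \<phi> tJ tI(1)] by simp
      qed
      obtain m where m: "m > 0" "(H2 has_real_derivative m * (bump t0 r t0 * (sgn (e t0) * e t0))) (at t0)"
        using near[of t0] r(1) by auto
      have "m * (bump t0 r t0 * (sgn (e t0) * e t0)) = 0"
      proof (rule zero_derivative_of_monotone[OF H2(1) ends t0(2) _ m(2)])
        fix t assume t: "t \<in> {\<tau>\<^sub>i<..<1}"
        show "\<exists>y\<ge>0. (H2 has_real_derivative y) (at t)"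
        proof (cases "\<bar>t - t0\<bar> < 2 * r")
          case True
          obtain m where m: "m > 0" "(H2 has_real_derivative m * (bump t0 r t * (sgn (e t0) * e t))) (at t)"
            using near[OF True] by blast
          have "\<bar>t - t0\<bar> < R"
            using True by (simp add: r_def)
          from conjunct2[OF R(4)[OF this]] have "0 \<le> m * (bump t0 r t * (sgn (e t0) * e t))"
            by (intro mult_nonneg_nonneg[OF less_imp_le[OF m(1)] mult_nonneg_nonneg[OF bump_simps(2)]] less_imp_le)
          then show ?thesis
            using m(2) by blast
        next
          case False
          obtain \<psi> where \<psi>: "\<psi> \<in> A" "t \<in> p2.J \<psi>"
            using chart_at[of t \<tau>\<^sub>i 1] t unfolding p2.J_def by force
          have "u t = (cq t, \<lambda>_. 0)"
            by (rule u2) (use t \<tau> r(1) False in auto)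
          then show ?thesis
            using H2(4)[OF \<psi> t] by auto
        qed
      qed
      then show False
        using m(1) e0 by (simp add: bump_simps(1) sgn_eq_0_iff)
    qed
  qed
qed

lemma euler_lagrange:
  assumes crit: "critical_point A L \<tau>\<^sub>i z0 B (cq 0) (cq 1) (cq, ct)" and \<phi>: "\<phi> \<in> A"
  shows "t \<in> p1.J \<phi> \<Longrightarrow> t \<in> {0..<\<tau>\<^sub>i} \<Longrightarrow> p1.el \<phi> j t = 0"
    and "t \<in> p2.J \<phi> \<Longrightarrow> t \<in> {\<tau>\<^sub>i<..1} \<Longrightarrow> p2.el \<phi> j t = 0"
proof -
  assume t: "t \<in> p1.J \<phi>" "t \<in> {0..<\<tau>\<^sub>i}"
  obtain e where e: "continuous_on (p1.J \<phi>) e" "\<And>t. t \<in> p1.J \<phi> \<Longrightarrow>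
      (Z has_real_derivative p1.rate t) (at t within {0..\<tau>\<^sub>i}) \<Longrightarrow> p1.el \<phi> j t = e t"
    using p1.el_continuous_extension[OF \<phi>] by metis
  have "e t = 0"
  proof (rule zero_on_closure[OF \<tau>(1) e(1) p1.J_openin[OF \<phi>] _ t(1)])
    fix s assume s: "s \<in> p1.J \<phi>" "s \<in> {0<..<\<tau>\<^sub>i}"
    then show "e s = 0"
      using e(2)[OF s(1) Z_derivs(1)] euler_lagrange_interior(1)[OF crit \<phi> s] by simp
  qed
  then show "p1.el \<phi> j t = 0"
    using e(2)[OF t(1) Z_derivs(1)[OF t(2)]] by simp
next
  assume t: "t \<in> p2.J \<phi>" "t \<in> {\<tau>\<^sub>i<..1}"
  obtain e where e: "continuous_on (p2.J \<phi>) e" "\<And>t. t \<in> p2.J \<phi> \<Longrightarrow>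
      (Z has_real_derivative p2.rate t) (at t within {\<tau>\<^sub>i..1}) \<Longrightarrow> p2.el \<phi> j t = e t"
    using p2.el_continuous_extension[OF \<phi>] by metis
  have "e t = 0"
  proof (rule zero_on_closure[OF \<tau>(2) e(1) p2.J_openin[OF \<phi>] _ t(1)])
    fix s assume s: "s \<in> p2.J \<phi>" "s \<in> {\<tau>\<^sub>i<..<1}"
    then show "e s = 0"
      using e(2)[OF s(1) Z_derivs(2)] euler_lagrange_interior(2)[OF crit \<phi> s] by simp
  qed
  then show "p2.el \<phi> j t = 0"
    using e(2)[OF t(1) Z_derivs(2)[OF t(2)]] by simp
qed

lemma critical_point_iff:
  "critical_point A L \<tau>\<^sub>i z0 B (cq 0) (cq 1) (cq, ct) \<longleftrightarrow>
    (\<forall>\<phi>\<in>A. \<forall>j. (\<forall>t\<in>p1.J \<phi> \<inter> {0..<\<tau>\<^sub>i}. p1.el \<phi> j t = 0) \<and> (\<forall>t\<in>p2.J \<phi> \<inter> {\<tau>\<^sub>i<..1}. p2.el \<phi> j t = 0)) \<and>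
    (\<forall>v\<in>tangent_space A B (cq \<tau>\<^sub>i). fibre_deriv L (p1.lift \<tau>\<^sub>i) v (Z \<tau>\<^sub>i) = fibre_deriv L (p2.lift \<tau>\<^sub>i) v (Z \<tau>\<^sub>i)) \<and>
    p1.En \<tau>\<^sub>i = p2.En \<tau>\<^sub>i" (is "_ \<longleftrightarrow> ?EL \<and> ?mom \<and> ?en")
proof
  assume R: "?EL \<and> ?mom \<and> ?en"
  show "critical_point A L \<tau>\<^sub>i z0 B (cq 0) (cq 1) (cq, ct)"
    unfolding critical_point_def
  proof (intro ballI allI impI)
    fix w \<Gamma>
    assume w: "w \<in> fixed_end_variations A \<tau>\<^sub>i B (cq, ct)"
      and pc: "path_curve A \<tau>\<^sub>i (Omega A \<tau>\<^sub>i B (cq 0) (cq 1)) (cq, ct) w \<Gamma>"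
    obtain u \<delta> where w_eq: "w = (u, \<delta>)" by (cases w)
    have "u \<tau>\<^sub>i \<in> tangent_space A B (cq \<tau>\<^sub>i)"
      using w unfolding w_eq fixed_end_variations_def config_tangent_def by simp
    then have fd: "fibre_deriv L (p1.lift \<tau>\<^sub>i) (u \<tau>\<^sub>i) (Z \<tau>\<^sub>i) = fibre_deriv L (p2.lift \<tau>\<^sub>i) (u \<tau>\<^sub>i) (Z \<tau>\<^sub>i)"
      using R by blast
    have e1: "p1.el \<phi> j t = 0" if "\<phi> \<in> A" "t \<in> p1.J \<phi>" "t \<in> {0<..<\<tau>\<^sub>i}" for \<phi> j t
    proof -
      have "t \<in> p1.J \<phi> \<inter> {0..<\<tau>\<^sub>i}"
        using that by simp
      then show ?thesis
        using R that(1) by blast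
    qed
    have e2: "p2.el \<phi> j t = 0" if "\<phi> \<in> A" "t \<in> p2.J \<phi>" "t \<in> {\<tau>\<^sub>i<..<1}" for \<phi> j t
    proof -
      have "t \<in> p2.J \<phi> \<inter> {\<tau>\<^sub>i<..1}"
        using that by simp
      then show ?thesis
        using R that(1) by blast
    qed
    show "((\<lambda>s. action A L \<tau>\<^sub>i z0 (\<Gamma> s)) has_real_derivative 0) (at 0)"
      using action_derivative_jump[OF e1 e2 w[unfolded w_eq] pc[unfolded w_eq]] fd R by auto
  qed
next
  assume crit: "critical_point A L \<tau>\<^sub>i z0 B (cq 0) (cq 1) (cq, ct)"
  have EL: ?EL
    using euler_lagrange[OF crit] by blast
  have e1: "p1.el \<phi> j t = 0" if "\<phi> \<in> A" "t \<in> p1.J \<phi>" "t \<in> {0<..<\<tau>\<^sub>i}" for \<phi> j t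
    using euler_lagrange_interior(1)[OF crit that] .
  have e2: "p2.el \<phi> j t = 0" if "\<phi> \<in> A" "t \<in> p2.J \<phi>" "t \<in> {\<tau>\<^sub>i<..<1}" for \<phi> j t
    using euler_lagrange_interior(2)[OF crit that] .
  have jump: "p2.En \<tau>\<^sub>i * \<delta> \<tau>\<^sub>i - fibre_deriv L (p2.lift \<tau>\<^sub>i) (u \<tau>\<^sub>i) (Z \<tau>\<^sub>i) =
      p1.En \<tau>\<^sub>i * \<delta> \<tau>\<^sub>i - fibre_deriv L (p1.lift \<tau>\<^sub>i) (u \<tau>\<^sub>i) (Z \<tau>\<^sub>i)"
    if w: "(u, \<delta>) \<in> fixed_end_variations A \<tau>\<^sub>i B (cq, ct)"
      and pc: "path_curve A \<tau>\<^sub>i (Omega A \<tau>\<^sub>i B (cq 0) (cq 1)) (cq, ct) (u, \<delta>) \<Gamma>" for u \<delta> \<Gamma>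
  proof -
    obtain \<kappa> where \<kappa>: "\<kappa> > 0" "((\<lambda>s. action A L \<tau>\<^sub>i z0 (\<Gamma> s)) has_real_derivative
      \<kappa> * ((p2.En \<tau>\<^sub>i * \<delta> \<tau>\<^sub>i - fibre_deriv L (p2.lift \<tau>\<^sub>i) (u \<tau>\<^sub>i) (Z \<tau>\<^sub>i)) -
      (p1.En \<tau>\<^sub>i * \<delta> \<tau>\<^sub>i - fibre_deriv L (p1.lift \<tau>\<^sub>i) (u \<tau>\<^sub>i) (Z \<tau>\<^sub>i)))) (at 0)"
      using action_derivative_jump[OF e1 e2 w pc] by blast
    moreover have "((\<lambda>s. action A L \<tau>\<^sub>i z0 (\<Gamma> s)) has_real_derivative 0) (at 0)"
      using crit w pc unfolding critical_point_def by blast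
    ultimately show ?thesis
      using DERIV_unique by fastforce
  qed
  have mom: ?mom
  proof
    fix v assume v: "v \<in> tangent_space A B (cq \<tau>\<^sub>i)"
    obtain \<phi> where \<phi>: "\<phi> \<in> A" "cq \<tau>\<^sub>i \<in> fst \<phi>"
      using chart_cover by blast
    show "fibre_deriv L (p1.lift \<tau>\<^sub>i) v (Z \<tau>\<^sub>i) = fibre_deriv L (p2.lift \<tau>\<^sub>i) v (Z \<tau>\<^sub>i)"
    proof (rule tangent_space_curve[OF v \<phi>])
      fix \<beta> \<epsilon>
      assume \<epsilon>: "0 < \<epsilon>" and \<beta>0: "\<beta> 0 = cq \<tau>\<^sub>i" and \<beta>B: "\<And>s. s \<in> {-\<epsilon><..<\<epsilon>} \<Longrightarrow> \<beta> s \<in> B"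
        and \<beta>\<phi>: "\<And>s. s \<in> {-\<epsilon><..<\<epsilon>} \<Longrightarrow> \<beta> s \<in> fst \<phi>" and \<beta>m: "\<And>k. manifold_Ck A k \<beta> {-\<epsilon><..<\<epsilon>}"
        and \<beta>C: "Ck_on 2 (snd \<phi> \<circ> \<beta>) {-\<epsilon><..<\<epsilon>}"
        and \<beta>d: "(snd \<phi> \<circ> \<beta> has_vector_derivative snd v \<phi>) (at 0)" and vT: "v \<in> tangent_bundle A" "fst v = cq \<tau>\<^sub>i"
      have cont: "continuous_on {0..1} cq"
        using cq by (simp add: config_paths_def)
      obtain U where U: "open U" "{0..1} \<inter> cq -` fst \<phi> = {0..1} \<inter> U"
        using openin_chart_preimage[OF cont \<phi>(1)] unfolding openin_open by blast
      have "\<tau>\<^sub>i \<in> {0..1} \<inter> U"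
        unfolding U(2)[symmetric] using \<phi>(2) \<tau> by simp
      then obtain R where R: "0 < R" "ball \<tau>\<^sub>i R \<subseteq> U"
        using U(1) openE by blast
      \<comment> \<open>\<open>R / 2\<close> keeps the window \<open>2 * r\<close> inside the chart
        domain; the other two bounds keep the support of the bump inside
        \<open>{0..1}\<close>.\<close>
      define r where "r = min (R / 2) (min \<tau>\<^sub>i (1 - \<tau>\<^sub>i))"
      have r: "0 < r" "r \<le> \<tau>\<^sub>i" "\<tau>\<^sub>i + r \<le> 1" "2 * r \<le> R"
      proof -
        have "r \<le> R / 2"
          unfolding r_def by (rule min.cobounded1)
        then show "2 * r \<le> R" by simp
      qed (use R(1) \<tau> in \<open>auto simp: r_def\<close>)
      have dom: "cq t \<in> fst \<phi>" if "t \<in> {0..1}" "\<bar>t - \<tau>\<^sub>i\<bar> < 2 * r" for t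
      proof -
        have "t \<in> ball \<tau>\<^sub>i R"
          using that r(4) by (simp add: dist_real_def)
        then have "t \<in> {0..1} \<inter> U"
          using R(2) that(1) by blast
        then show ?thesis
          unfolding U(2)[symmetric] by blast
      qed
      \<comment> \<open>The bump is centred at the impact, where it equals 1. With the coordinate
        difference as displacement the impact point follows \<beta> exactly and hence stays in
        \<open>B\<close>.\<close>
      define \<beta>' where "\<beta>' s = snd \<phi> (\<beta> s) - snd \<phi> (cq \<tau>\<^sub>i)" for s
      have "Ck_on 2 (\<lambda>s. (snd \<phi> \<circ> \<beta>) s + (- snd \<phi> (cq \<tau>\<^sub>i))) {-\<epsilon><..<\<epsilon>}"
        by (intro Ck_on_add \<beta>C Ck_on_const thick_open open_greaterThanLessThan)
      then have \<beta>'C: "Ck_on 2 \<beta>' {-\<epsilon><..<\<epsilon>}"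
        by (simp add: \<beta>'_def[abs_def])
      have \<beta>'0: "\<beta>' 0 = 0"
        by (simp add: \<beta>'_def \<beta>0)
      have "((\<lambda>s. (snd \<phi> \<circ> \<beta>) s - snd \<phi> (cq \<tau>\<^sub>i)) has_vector_derivative snd v \<phi> - 0) (at 0)"
        by (intro has_vector_derivative_diff \<beta>d has_vector_derivative_const)
      then have \<beta>'d: "(\<beta>' has_vector_derivative snd v \<phi>) (at 0)"
        by (simp add: \<beta>'_def[abs_def])
      have cross: "chart_variation \<phi> \<tau>\<^sub>i r \<beta>' cq s \<tau>\<^sub>i = \<beta> s" if "s \<in> {-\<epsilon><..<\<epsilon>}" for s
        using r(1) \<phi>(1) \<beta>\<phi>[OF that] by (simp add: chart_variation_def bump_simps(1) \<beta>'_def)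
      have cB: "chart_variation \<phi> \<tau>\<^sub>i r \<beta>' cq s \<tau>\<^sub>i \<in> B" if "s \<in> {-\<epsilon><..<\<epsilon>}" for s
        unfolding cross[OF that] by (rule \<beta>B[OF that])
      have cm: "manifold_Ck A k (\<lambda>s. chart_variation \<phi> \<tau>\<^sub>i r \<beta>' cq s \<tau>\<^sub>i) {-\<epsilon><..<\<epsilon>}" for k
        by (rule manifold_Ck_cong[OF cross \<beta>m])
      define u where "u t = velocity A (\<lambda>s. chart_variation \<phi> \<tau>\<^sub>i r \<beta>' cq s t) UNIV 0" for t
      note adm = chart_variation_admissible[where \<beta> = \<beta>' and v = "snd v \<phi>" and c = \<tau>\<^sub>i and r = r and \<phi> = \<phi>,
          OF \<tau> cq ct \<phi>(1) r(1-3) dom \<epsilon> \<beta>'C \<beta>'0 \<beta>'d cB cm]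
      have w: "(u, \<lambda>_. 0) \<in> fixed_end_variations A \<tau>\<^sub>i B (cq, ct)"
        unfolding u_def[abs_def] by (rule adm(1))
      have pc: "path_curve A \<tau>\<^sub>i (Omega A \<tau>\<^sub>i B (cq 0) (cq 1)) (cq, ct) (u, \<lambda>_. 0) (\<lambda>s. (chart_variation \<phi> \<tau>\<^sub>i r \<beta>' cq s, ct))"
        unfolding u_def[abs_def] by (rule adm(2))
      have "snd (u \<tau>\<^sub>i) \<phi> = bump \<tau>\<^sub>i r \<tau>\<^sub>i *\<^sub>R snd v \<phi>"
        unfolding u_def by (rule adm(3)) (use \<tau> r(1) in auto)
      then have u\<phi>: "snd (u \<tau>\<^sub>i) \<phi> = snd v \<phi>"
        by (simp add: bump_simps(1))
      have uT: "u \<tau>\<^sub>i \<in> tangent_bundle A" "fst (u \<tau>\<^sub>i) = cq \<tau>\<^sub>i"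
        using w \<tau> by (simp_all add: fixed_end_variations_def config_tangent_def)
      \<comment> \<open>Components in one chart determine a tangent vector, so the constructed field
        takes the prescribed value \<open>v\<close> at the impact.\<close>
      have "u \<tau>\<^sub>i = tvec_of A \<phi> (snd \<phi> (fst (u \<tau>\<^sub>i))) (snd (u \<tau>\<^sub>i) \<phi>)"
        by (rule tangent_vector_eq_tvec_of[OF uT(1) \<phi>(1)]) (simp add: uT(2) \<phi>(2))
      also have "\<dots> = tvec_of A \<phi> (snd \<phi> (fst v)) (snd v \<phi>)"
        by (simp add: uT(2) vT(2) u\<phi>)
      also have "\<dots> = v"
        by (rule tangent_vector_eq_tvec_of[OF vT(1) \<phi>(1), symmetric]) (simp add: vT(2) \<phi>(2))
      finally have "u \<tau>\<^sub>i = v" .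
      then show ?thesis
        using jump[OF w pc] by simp
    qed
  qed
  have "p2.En \<tau>\<^sub>i * (\<tau>\<^sub>i * (1 - \<tau>\<^sub>i)) = p1.En \<tau>\<^sub>i * (\<tau>\<^sub>i * (1 - \<tau>\<^sub>i))"
    using jump[OF time_variation_admissible[OF \<tau> cq ct]] by (simp add: fibre_deriv_zero)
  then have ?en
    using \<tau> by simp
  then show "?EL \<and> ?mom \<and> ?en"
    using EL mom by blast
qed

section \<open>Translation into the coordinate form of the equations\<close>

definition lifted_coords :: "('q, 'n) chart \<Rightarrow> real \<Rightarrow> (real ^ 'n) \<times> (real ^ 'n) \<times> real" where
  "lifted_coords \<phi> t = coords \<phi> (lifted_path A (cq, ct) Z t)"

lemma lifted_coords_pieces:
  assumes "\<phi> \<in> A"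
  shows "t \<in> p1.J \<phi> \<Longrightarrow> t \<in> {0..<\<tau>\<^sub>i} \<Longrightarrow> lifted_coords \<phi> t = p1.\<xi> \<phi> t"
    and "t \<in> p2.J \<phi> \<Longrightarrow> t \<in> {\<tau>\<^sub>i<..1} \<Longrightarrow> lifted_coords \<phi> t = p2.\<xi> \<phi> t"
  using lifted_path_pieces p1.coords_lift[OF _ assms] p2.coords_lift[OF _ assms] by (simp_all add: lifted_coords_def)

text \<open>Before the impact, derivatives within the piece and within \<open>{0..1}\<close> have
  the same filter. The second identity exhibits the defect of the energy balance as the contraction
  of the Euler-Lagrange expressions with the velocity.\<close>

lemma time_derivs_piece1:
  assumes \<phi>: "\<phi> \<in> A" and t: "t \<in> p1.J \<phi>" "t \<in> {0..<\<tau>\<^sub>i}"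
  shows "D_q (local_rep A L \<phi>) j (lifted_coords \<phi> t) - time_deriv ct (\<lambda>\<sigma>. D_v (local_rep A L \<phi>) j (lifted_coords \<phi> \<sigma>)) t
      + D_v (local_rep A L \<phi>) j (lifted_coords \<phi> t) * D_z (local_rep A L \<phi>) (lifted_coords \<phi> t) = p1.el \<phi> j t"
    and "time_deriv ct (\<lambda>\<sigma>. energy (local_rep A L \<phi>) (lifted_coords \<phi> \<sigma>)) t =
      D_z (local_rep A L \<phi>) (lifted_coords \<phi> t) * energy (local_rep A L \<phi>) (lifted_coords \<phi> t) - (\<Sum>j\<in>UNIV. p1.el \<phi> j t * p1.ydot \<phi> t $ j)"
proof -
  let ?F = "local_rep A L \<phi>" and ?T = "p1.J \<phi> \<inter> {..<\<tau>\<^sub>i}"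
  have at: "at t within {0..\<tau>\<^sub>i} = at t within {0..1}"
    using at_within_pieces(1)[of t \<tau>\<^sub>i] t \<tau> by simp
  have T: "openin (top_of_set {0..\<tau>\<^sub>i}) ?T"
    by (intro openin_Int_open p1.J_openin \<phi>) auto
  have tT: "t \<in> ?T"
    using t by simp
  have T_eq: "lifted_coords \<phi> s = p1.\<xi> \<phi> s" if "s \<in> ?T" for s
    by (rule lifted_coords_pieces(1)[OF \<phi>]) (use that in \<open>auto simp: p1.J_def\<close>)
  note vd = vector_derivative_openin_cong[OF T tT]
  have "vector_derivative (\<lambda>\<sigma>. D_v ?F j (lifted_coords \<phi> \<sigma>)) (at t within {0..1}) = vector_derivative (p1.mom \<phi> j) (at t within {0..\<tau>\<^sub>i})"
    unfolding at[symmetric] by (rule vd) (simp add: T_eq p1.mom_def)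
  then show "D_q ?F j (lifted_coords \<phi> t) - time_deriv ct (\<lambda>\<sigma>. D_v ?F j (lifted_coords \<phi> \<sigma>)) t + D_v ?F j (lifted_coords \<phi> t) * D_z ?F (lifted_coords \<phi> t) = p1.el \<phi> j t"
    by (simp add: p1.el_def time_deriv_def T_eq[OF tT] \<theta>_def p1.mom_def)
  have "vector_derivative (\<lambda>\<sigma>. energy ?F (lifted_coords \<phi> \<sigma>)) (at t within {0..1}) = vector_derivative p1.En (at t within {0..\<tau>\<^sub>i})"
    unfolding at[symmetric] by (rule vd) (use T_eq p1.En_eq(1)[OF \<phi>] in simp)
  also have "\<dots> = \<theta> t * (D_z ?F (p1.\<xi> \<phi> t) * p1.En t - (\<Sum>j\<in>UNIV. p1.el \<phi> j t * p1.ydot \<phi> t $ j))"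
    using p1.En_derivative[OF \<phi> t(1) Z_derivs(1)[OF t(2)]] t \<tau>
    unfolding has_real_derivative_iff_has_vector_derivative
    by (intro vector_derivative_within at_within_Icc_nonbot) auto
  finally show "time_deriv ct (\<lambda>\<sigma>. energy ?F (lifted_coords \<phi> \<sigma>)) t =
      D_z ?F (lifted_coords \<phi> t) * energy ?F (lifted_coords \<phi> t) - (\<Sum>j\<in>UNIV. p1.el \<phi> j t * p1.ydot \<phi> t $ j)"
    using p1.\<theta>_pos[of t] t by (simp add: time_deriv_def T_eq[OF tT] \<theta>_def p1.En_eq(1)[OF \<phi> t(1)])
qed

lemma time_derivs_piece2:
  assumes \<phi>: "\<phi> \<in> A" and t: "t \<in> p2.J \<phi>" "t \<in> {\<tau>\<^sub>i<..1}"
  shows "D_q (local_rep A L \<phi>) j (lifted_coords \<phi> t) - time_deriv ct (\<lambda>\<sigma>. D_v (local_rep A L \<phi>) j (lifted_coords \<phi> \<sigma>)) t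
      + D_v (local_rep A L \<phi>) j (lifted_coords \<phi> t) * D_z (local_rep A L \<phi>) (lifted_coords \<phi> t) = p2.el \<phi> j t"
    and "time_deriv ct (\<lambda>\<sigma>. energy (local_rep A L \<phi>) (lifted_coords \<phi> \<sigma>)) t =
      D_z (local_rep A L \<phi>) (lifted_coords \<phi> t) * energy (local_rep A L \<phi>) (lifted_coords \<phi> t) - (\<Sum>j\<in>UNIV. p2.el \<phi> j t * p2.ydot \<phi> t $ j)"
proof -
  let ?F = "local_rep A L \<phi>" and ?T = "p2.J \<phi> \<inter> {\<tau>\<^sub>i<..}"
  have at: "at t within {\<tau>\<^sub>i..1} = at t within {0..1}"
    using at_within_pieces(2)[of \<tau>\<^sub>i t] t \<tau> by simp
  have T: "openin (top_of_set {\<tau>\<^sub>i..1}) ?T"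
    by (intro openin_Int_open p2.J_openin \<phi>) auto
  have tT: "t \<in> ?T"
    using t by simp
  have T_eq: "lifted_coords \<phi> s = p2.\<xi> \<phi> s" if "s \<in> ?T" for s
    by (rule lifted_coords_pieces(2)[OF \<phi>]) (use that in \<open>auto simp: p2.J_def\<close>)
  note vd = vector_derivative_openin_cong[OF T tT]
  have "vector_derivative (\<lambda>\<sigma>. D_v ?F j (lifted_coords \<phi> \<sigma>)) (at t within {0..1}) = vector_derivative (p2.mom \<phi> j) (at t within {\<tau>\<^sub>i..1})"
    unfolding at[symmetric] by (rule vd) (simp add: T_eq p2.mom_def)
  then show "D_q ?F j (lifted_coords \<phi> t) - time_deriv ct (\<lambda>\<sigma>. D_v ?F j (lifted_coords \<phi> \<sigma>)) t + D_v ?F j (lifted_coords \<phi> t) * D_z ?F (lifted_coords \<phi> t) = p2.el \<phi> j t"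
    by (simp add: p2.el_def time_deriv_def T_eq[OF tT] \<theta>_def p2.mom_def)
  have "vector_derivative (\<lambda>\<sigma>. energy ?F (lifted_coords \<phi> \<sigma>)) (at t within {0..1}) = vector_derivative p2.En (at t within {\<tau>\<^sub>i..1})"
    unfolding at[symmetric] by (rule vd) (use T_eq p2.En_eq(1)[OF \<phi>] in simp)
  also have "\<dots> = \<theta> t * (D_z ?F (p2.\<xi> \<phi> t) * p2.En t - (\<Sum>j\<in>UNIV. p2.el \<phi> j t * p2.ydot \<phi> t $ j))"
    using p2.En_derivative[OF \<phi> t(1) Z_derivs(2)[OF t(2)]] t \<tau>
    unfolding has_real_derivative_iff_has_vector_derivative
    by (intro vector_derivative_within at_within_Icc_nonbot) auto
  finally show "time_deriv ct (\<lambda>\<sigma>. energy ?F (lifted_coords \<phi> \<sigma>)) t =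
      D_z ?F (lifted_coords \<phi> t) * energy ?F (lifted_coords \<phi> t) - (\<Sum>j\<in>UNIV. p2.el \<phi> j t * p2.ydot \<phi> t $ j)"
    using p2.\<theta>_pos[of t] t by (simp add: time_deriv_def T_eq[OF tT] \<theta>_def p2.En_eq(1)[OF \<phi> t(1)])
qed

text \<open>At \<open>\<tau>\<^sub>i\<close> itself \<open>lifted_path\<close> uses a derivative
  within \<open>{0..1}\<close>, which a jump of the velocity makes meaningless. The one-sided limits
  are instead values of the coordinate curves of the two pieces, which are continuous up to the
  impact.\<close>

lemma lifted_coords_limits:
  assumes \<phi>: "\<phi> \<in> A" and dom: "cq \<tau>\<^sub>i \<in> fst \<phi>"
  shows "Lim (at_left \<tau>\<^sub>i) (lifted_coords \<phi>) = p1.\<xi> \<phi> \<tau>\<^sub>i" "Lim (at_right \<tau>\<^sub>i) (lifted_coords \<phi>) = p2.\<xi> \<phi> \<tau>\<^sub>i"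
proof -
  have J1: "\<tau>\<^sub>i \<in> p1.J \<phi>" and J2: "\<tau>\<^sub>i \<in> p2.J \<phi>"
    using dom \<tau> by (auto simp: p1.J_def p2.J_def)
  have l: "at \<tau>\<^sub>i within p1.J \<phi> = at_left \<tau>\<^sub>i"
    using at_within_openin[OF p1.J_openin[OF \<phi>] J1] at_within_Icc_at_left[OF \<tau>(1)] by simp
  have r: "at \<tau>\<^sub>i within p2.J \<phi> = at_right \<tau>\<^sub>i"
    using at_within_openin[OF p2.J_openin[OF \<phi>] J2] at_within_Icc_at_right[OF \<tau>(2)] by simp
  have "(p1.\<xi> \<phi> \<longlongrightarrow> p1.\<xi> \<phi> \<tau>\<^sub>i) (at \<tau>\<^sub>i within p1.J \<phi>)"
    using p1.continuous_on_\<xi>[OF \<phi>] J1 by (simp add: continuous_on_def)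
  then have "(lifted_coords \<phi> \<longlongrightarrow> p1.\<xi> \<phi> \<tau>\<^sub>i) (at \<tau>\<^sub>i within p1.J \<phi>)"
    by (rule Lim_transform_eventually)
      (use lifted_coords_pieces(1)[OF \<phi>] in \<open>auto simp: eventually_at_filter p1.J_def intro!: always_eventually\<close>)
  then show "Lim (at_left \<tau>\<^sub>i) (lifted_coords \<phi>) = p1.\<xi> \<phi> \<tau>\<^sub>i"
    unfolding l by (intro tendsto_Lim) simp_all
  have "(p2.\<xi> \<phi> \<longlongrightarrow> p2.\<xi> \<phi> \<tau>\<^sub>i) (at \<tau>\<^sub>i within p2.J \<phi>)"
    using p2.continuous_on_\<xi>[OF \<phi>] J2 by (simp add: continuous_on_def)
  then have "(lifted_coords \<phi> \<longlongrightarrow> p2.\<xi> \<phi> \<tau>\<^sub>i) (at \<tau>\<^sub>i within p2.J \<phi>)"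
    by (rule Lim_transform_eventually)
      (use lifted_coords_pieces(2)[OF \<phi>] in \<open>auto simp: eventually_at_filter p2.J_def intro!: always_eventually\<close>)
  then show "Lim (at_right \<tau>\<^sub>i) (lifted_coords \<phi>) = p2.\<xi> \<phi> \<tau>\<^sub>i"
    unfolding r by (intro tendsto_Lim) simp_all
qed

text \<open>The right-hand side lists no energy equation: once the Euler-Lagrange expressions
  vanish, the second identities of \<open>time_derivs_piece1\<close> and
  \<open>time_derivs_piece2\<close> are the energy balance.\<close>

lemma equations_of_motion_iff:
  "(\<forall>t\<in>{0..<\<tau>\<^sub>i} \<union> {\<tau>\<^sub>i<..1}. \<forall>\<phi>\<in>A. cq t \<in> fst \<phi> \<longrightarrow>
      (\<forall>j. D_q (local_rep A L \<phi>) j (lifted_coords \<phi> t) - time_deriv ct (\<lambda>\<sigma>. D_v (local_rep A L \<phi>) j (lifted_coords \<phi> \<sigma>)) t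
        + D_v (local_rep A L \<phi>) j (lifted_coords \<phi> t) * D_z (local_rep A L \<phi>) (lifted_coords \<phi> t) = 0) \<and>
      time_deriv ct (\<lambda>\<sigma>. energy (local_rep A L \<phi>) (lifted_coords \<phi> \<sigma>)) t =
        D_z (local_rep A L \<phi>) (lifted_coords \<phi> t) * energy (local_rep A L \<phi>) (lifted_coords \<phi> t)) \<longleftrightarrow>
    (\<forall>\<phi>\<in>A. \<forall>j. (\<forall>t\<in>p1.J \<phi> \<inter> {0..<\<tau>\<^sub>i}. p1.el \<phi> j t = 0) \<and> (\<forall>t\<in>p2.J \<phi> \<inter> {\<tau>\<^sub>i<..1}. p2.el \<phi> j t = 0))"
  (is "(\<forall>t\<in>_. \<forall>\<phi>\<in>A. _ \<longrightarrow> ?M \<phi> t) \<longleftrightarrow> ?R")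
proof -
  have m1: "?M \<phi> t \<longleftrightarrow> (\<forall>j. p1.el \<phi> j t = 0)" if "\<phi> \<in> A" "t \<in> p1.J \<phi>" "t \<in> {0..<\<tau>\<^sub>i}" for \<phi> t
    unfolding time_derivs_piece1[OF that] by auto
  have m2: "?M \<phi> t \<longleftrightarrow> (\<forall>j. p2.el \<phi> j t = 0)" if "\<phi> \<in> A" "t \<in> p2.J \<phi>" "t \<in> {\<tau>\<^sub>i<..1}" for \<phi> t
    unfolding time_derivs_piece2[OF that] by auto
  have J: "t \<in> {0..<\<tau>\<^sub>i} \<Longrightarrow> cq t \<in> fst \<phi> \<longleftrightarrow> t \<in> p1.J \<phi>" "t \<in> {\<tau>\<^sub>i<..1} \<Longrightarrow> cq t \<in> fst \<phi> \<longleftrightarrow> t \<in> p2.J \<phi>" for t \<phi>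
    by (auto simp: p1.J_def p2.J_def)
  show ?thesis
  proof
    assume L: "\<forall>t\<in>{0..<\<tau>\<^sub>i} \<union> {\<tau>\<^sub>i<..1}. \<forall>\<phi>\<in>A. cq t \<in> fst \<phi> \<longrightarrow> ?M \<phi> t"
    show ?R
      using L m1 m2 J by blast
  next
    assume R: ?R
    show "\<forall>t\<in>{0..<\<tau>\<^sub>i} \<union> {\<tau>\<^sub>i<..1}. \<forall>\<phi>\<in>A. cq t \<in> fst \<phi> \<longrightarrow> ?M \<phi> t"
    proof (intro ballI impI)
      fix t \<phi> assume t: "t \<in> {0..<\<tau>\<^sub>i} \<union> {\<tau>\<^sub>i<..1}" and \<phi>: "\<phi> \<in> A" "cq t \<in> fst \<phi>"
      show "?M \<phi> t"
      proof (cases "t \<in> {0..<\<tau>\<^sub>i}")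
        case True
        have tJ: "t \<in> p1.J \<phi>"
          using J(1)[OF True] \<phi>(2) by blast
        show ?thesis
          unfolding m1[OF \<phi>(1) tJ True] using R \<phi>(1) tJ True by blast
      next
        case False
        then have t': "t \<in> {\<tau>\<^sub>i<..1}"
          using t by blast
        have tJ: "t \<in> p2.J \<phi>"
          using J(2)[OF t'] \<phi>(2) by blast
        show ?thesis
          unfolding m2[OF \<phi>(1) tJ t'] using R \<phi>(1) tJ t' by blast
      qed
    qed
  qed
qed

text \<open>The right-hand side is free of charts, so the conditions in one chart around the impact
  point are equivalent to those in any other, and \<open>chart_cover\<close> provides such a
  chart.\<close>

lemma impact_conditions_iff:
  "(\<forall>\<phi>\<in>A. cq \<tau>\<^sub>i \<in> fst \<phi> \<longrightarrow>
      (\<forall>v\<in>tangent_space A B (cq \<tau>\<^sub>i).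
        (\<Sum>j\<in>UNIV. D_v (local_rep A L \<phi>) j (Lim (at_left \<tau>\<^sub>i) (lifted_coords \<phi>)) * snd v \<phi> $ j) =
        (\<Sum>j\<in>UNIV. D_v (local_rep A L \<phi>) j (Lim (at_right \<tau>\<^sub>i) (lifted_coords \<phi>)) * snd v \<phi> $ j)) \<and>
      energy (local_rep A L \<phi>) (Lim (at_left \<tau>\<^sub>i) (lifted_coords \<phi>)) = energy (local_rep A L \<phi>) (Lim (at_right \<tau>\<^sub>i) (lifted_coords \<phi>))) \<longleftrightarrow>
    (\<forall>v\<in>tangent_space A B (cq \<tau>\<^sub>i). fibre_deriv L (p1.lift \<tau>\<^sub>i) v (Z \<tau>\<^sub>i) = fibre_deriv L (p2.lift \<tau>\<^sub>i) v (Z \<tau>\<^sub>i)) \<and>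
    p1.En \<tau>\<^sub>i = p2.En \<tau>\<^sub>i"
  (is "(\<forall>\<phi>\<in>A. _ \<longrightarrow> ?M \<phi>) \<longleftrightarrow> ?R")
proof -
  have M: "?M \<phi> \<longleftrightarrow> ?R" if \<phi>: "\<phi> \<in> A" "cq \<tau>\<^sub>i \<in> fst \<phi>" for \<phi>
  proof -
    have J1: "\<tau>\<^sub>i \<in> p1.J \<phi>" and J2: "\<tau>\<^sub>i \<in> p2.J \<phi>"
      using \<phi>(2) \<tau> by (auto simp: p1.J_def p2.J_def)
    have v1: "(\<Sum>j\<in>UNIV. D_v (local_rep A L \<phi>) j (p1.\<xi> \<phi> \<tau>\<^sub>i) * snd v \<phi> $ j) = fibre_deriv L (p1.lift \<tau>\<^sub>i) v (Z \<tau>\<^sub>i)"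
      and v2: "(\<Sum>j\<in>UNIV. D_v (local_rep A L \<phi>) j (p2.\<xi> \<phi> \<tau>\<^sub>i) * snd v \<phi> $ j) = fibre_deriv L (p2.lift \<tau>\<^sub>i) v (Z \<tau>\<^sub>i)"
      if v: "v \<in> tangent_space A B (cq \<tau>\<^sub>i)" for v
    proof -
      have "v \<in> tangent_bundle A \<and> fst v = cq \<tau>\<^sub>i"
        by (rule tangent_space_curve[OF v \<phi>]) blast
      then show "(\<Sum>j\<in>UNIV. D_v (local_rep A L \<phi>) j (p1.\<xi> \<phi> \<tau>\<^sub>i) * snd v \<phi> $ j) = fibre_deriv L (p1.lift \<tau>\<^sub>i) v (Z \<tau>\<^sub>i)"
        "(\<Sum>j\<in>UNIV. D_v (local_rep A L \<phi>) j (p2.\<xi> \<phi> \<tau>\<^sub>i) * snd v \<phi> $ j) = fibre_deriv L (p2.lift \<tau>\<^sub>i) v (Z \<tau>\<^sub>i)"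
        using fibre_deriv_pieces[OF \<phi>(1) _ _ \<phi>(2), of v] \<tau> by (simp_all add: p1.mom_def p2.mom_def)
    qed
    show ?thesis
      unfolding lifted_coords_limits[OF \<phi>] p1.En_eq(1)[OF \<phi>(1) J1] p2.En_eq(1)[OF \<phi>(1) J2] using v1 v2 by simp
  qed
  obtain \<psi> where \<psi>: "\<psi> \<in> A" "cq \<tau>\<^sub>i \<in> fst \<psi>"
    using chart_cover by blast
  show ?thesis
  proof
    assume "\<forall>\<phi>\<in>A. cq \<tau>\<^sub>i \<in> fst \<phi> \<longrightarrow> ?M \<phi>"
    then have "?M \<psi>"
      using \<psi> by blast
    then show ?R
      by (rule M[OF \<psi>, THEN iffD1])
  next
    assume R: ?R
    show "\<forall>\<phi>\<in>A. cq \<tau>\<^sub>i \<in> fst \<phi> \<longrightarrow> ?M \<phi>"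
      by (intro ballI impI) (rule M[THEN iffD2, OF _ _ R])
  qed
qed

end

theorem theorem1:
  fixes A :: "('q::{t2_space, second_countable_topology}, 'n::finite) chart set"
    and C :: "'q set" and k :: nat
    and L :: "('q, 'n) tvec \<times> real \<Rightarrow> real"
    and \<tau>\<^sub>i z0 :: real and q1 q2 :: 'q
    and cq :: "real \<Rightarrow> 'q" and ct :: "real \<Rightarrow> real"
  assumes "smooth_structure A"
    and "submanifold_with_boundary A k C"
    and "0 < \<tau>\<^sub>i" and "\<tau>\<^sub>i < 1"
    and "smooth_lagrangian A L" and "regular_lagrangian A L"
    and "(cq, ct) \<in> Omega A \<tau>\<^sub>i (manifold_boundary A k C) q1 q2"
    and "\<exists>Z. herglotz_solution A L \<tau>\<^sub>i z0 (cq, ct) Z"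
  shows "let B = manifold_boundary A k C; X = lifted_path A (cq, ct) (Zhat A L \<tau>\<^sub>i z0 (cq, ct)) in
    critical_point A L \<tau>\<^sub>i z0 B q1 q2 (cq, ct) \<longleftrightarrow>
    (\<forall>\<tau>\<in>{0..<\<tau>\<^sub>i} \<union> {\<tau>\<^sub>i<..1}. \<forall>\<phi>\<in>A. cq \<tau> \<in> fst \<phi> \<longrightarrow>
       (let F = local_rep A L \<phi>; x = (\<lambda>\<sigma>. coords \<phi> (X \<sigma>)) in
          (\<forall>j. D_q F j (x \<tau>) - time_deriv ct (\<lambda>\<sigma>. D_v F j (x \<sigma>)) \<tau> + D_v F j (x \<tau>) * D_z F (x \<tau>) = 0) \<and>
          time_deriv ct (\<lambda>\<sigma>. energy F (x \<sigma>)) \<tau> = D_z F (x \<tau>) * energy F (x \<tau>))) \<and>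
    (\<forall>\<phi>\<in>A. cq \<tau>\<^sub>i \<in> fst \<phi> \<longrightarrow>
       (let F = local_rep A L \<phi>; x = (\<lambda>\<sigma>. coords \<phi> (X \<sigma>));
            xminus = Lim (at_left \<tau>\<^sub>i) x; xplus = Lim (at_right \<tau>\<^sub>i) x in
          (\<forall>v \<in> tangent_space A B (cq \<tau>\<^sub>i).
             (\<Sum>j\<in>UNIV. D_v F j xminus * snd v \<phi> $ j) = (\<Sum>j\<in>UNIV. D_v F j xplus * snd v \<phi> $ j)) \<and>
          energy F xminus = energy F xplus))"
proof -
  \<comment> \<open>The existence hypothesis makes the function picked by \<open>Zhat\<close> a
    solution, so what was proved for an arbitrary solution applies to it.\<close>
  define Z where "Z = Zhat A L \<tau>\<^sub>i z0 (cq, ct)"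
  have "herglotz_solution A L \<tau>\<^sub>i z0 (cq, ct) Z"
    unfolding Z_def Zhat_def by (rule someI_ex[OF assms(8)])
  moreover have q: "cq 0 = q1" "cq 1 = q2"
    using assms(7) by (auto simp: Omega_def)
  ultimately interpret herglotz_path A L \<tau>\<^sub>i z0 "manifold_boundary A k C" cq ct Z
    using assms by unfold_locales (auto simp: Omega_def)
  show ?thesis
    using critical_point_iff equations_of_motion_iff impact_conditions_iff
    unfolding Let_def Z_def[symmetric] q lifted_coords_def[abs_def] by blast
qed

end
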